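(* Let $G$ be a $CD1$-group. Then the following statements hold: (1) $|C_G(b)|=p^{n+2t}$, so the centralizer of each non-trivial element of $N$ is a Sylow $p$-subgroup of $G$. In particular, each non-trivial element of $N$ belongs to the center of a unique Sylow $p$-subgroup of $G$. (2) The center of each Sylow $p$-subgroup of $G$ is contained in $N$. (3) If $N$ is not a Sylow $p$-subgroup of $G$, then the Sylow $p$-subgroups of $G$ are non-abelian. (4) $N=\bigcup\{Z(P)\mid P\in \mathrm{Syl}_p(G)\}$. Moreover, if $P,Q\in \mathrm{Syl}_p(G)$ and $P\neq Q$, then $Z(P)\cap Z(Q)=\{1\}$. (5) If $P\in \mathrm{Syl}_p(G)$, then $Z(P)=N$ if and only if $P\triangleleft G$. (6) $C_G(N)=O_p(G)$. (7) $O_{p'}(G)=1$. (8) If $x\in G\setminus N$, then $|C_G(x)|=|C_{G/N}(xN)|$. In particular, $(G,N)$ is a Camina pair. (9) If $P\in \mathrm{Syl}_p(G)$, then $N_G(Z(P))=N_G(P)$.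
   Context: All groups are finite. Let $\mathrm{Irr}(G)=\{\chi_1,\dots,\chi_k\}$ be the set of complex irreducible characters of $G$, with $\chi_1=1_G$ and $\chi_1(1)=1\le\chi_2(1)\le\dots\le\chi_k(1)$. A group $G$ is a $CD1$-group if $|G|>2$ and two columns of its character table differ by exactly one entry, i.e. there are non-conjugate $a,b\in G$ and an index $j$ with $\chi_j(a)\ne\chi_j(b)$ and $\chi_i(a)=\chi_i(b)$ for all $i\ne j$. For a $CD1$-group it is known that one of the two conjugacy classes is $\{1\}$, that the other one, denoted $b^G$, is uniquely determined, and that the two columns differ exactly in the row of $\chi_k$. Put $b_k=\chi_k(b)$ and $N=\bigcap_{i=1}^{k-1}\ker\chi_i$; it is known that $N=\{1\}\cup b^G$ is a minimal normal subgroup of $G$, that the order of $b$ is a prime, denoted $p$, that $|N|=p^n$ for a positive integer $n$, and that $b_k=-p^t$ for a non-negative integer $t$. These define $p,n,t$. $\mathrm{Syl}_p(G)$ is the set of Sylow $p$-subgroups of $G$. For a non-trivial proper normal subgroup $N$ of $G$, the pair $(G,N)$ is a Camina pair if $|C_G(x)|=|C_{G/N}(xN)|$ for every $x\in G\setminus N$. *)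

theory Defs
  imports
    "HOL-Algebra.Group_Action"
    "HOL-Algebra.Multiplicative_Group"
    "Jordan_Normal_Form.VS_Connect"
begin

section \<open>Complex characters of finite groups\<close>

text \<open>The units of the matrix ring form the general linear group \<open>GL\<^sub>n(\<complex>)\<close>.\<close>

definition is_rep :: "('a, 'm) monoid_scheme \<Rightarrow> nat \<Rightarrow> ('a \<Rightarrow> complex mat) \<Rightarrow> bool" where
  "is_rep G n \<rho> \<longleftrightarrow> \<rho> \<in> hom G (units_of (ring_mat TYPE(complex) n ()))"

definition irreducible_rep :: "('a, 'm) monoid_scheme \<Rightarrow> nat \<Rightarrow> ('a \<Rightarrow> complex mat) \<Rightarrow> bool" where
  "irreducible_rep G n \<rho> \<longleftrightarrow> is_rep G n \<rho> \<and> n > 0 \<and>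
     (\<forall>W. VectorSpace.subspace class_ring W (module_vec TYPE(complex) n) \<longrightarrow>
        (\<forall>g \<in> carrier G. \<forall>w \<in> W. \<rho> g *\<^sub>v w \<in> W) \<longrightarrow>
        W = {0\<^sub>v n} \<or> W = carrier_vec n)"

definition mat_trace :: "complex mat \<Rightarrow> complex" where
  "mat_trace A = (\<Sum>i < dim_row A. A $$ (i, i))"

text \<open>Characters are restricted to the carrier, so that \<open>\<chi> = \<psi>\<close> means equality as
  functions on the group and \<open>Irr G\<close> has the right cardinality.\<close>

definition rep_character :: "('a, 'm) monoid_scheme \<Rightarrow> ('a \<Rightarrow> complex mat) \<Rightarrow> 'a \<Rightarrow> complex" where
  "rep_character G \<rho> = (\<lambda>g \<in> carrier G. mat_trace (\<rho> g))"

definition Irr :: "('a, 'm) monoid_scheme \<Rightarrow> ('a \<Rightarrow> complex) set" where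
  "Irr G = {rep_character G \<rho> | n \<rho>. irreducible_rep G n \<rho>}"

definition trivial_character :: "('a, 'm) monoid_scheme \<Rightarrow> 'a \<Rightarrow> complex" where
  "trivial_character G = (\<lambda>g \<in> carrier G. 1)"

text \<open>The usual kernel of a character; it agrees with the kernel of any representation
  affording \<open>\<chi>\<close>.\<close>

definition char_ker :: "('a, 'm) monoid_scheme \<Rightarrow> ('a \<Rightarrow> complex) \<Rightarrow> 'a set" where
  "char_ker G \<chi> = {g \<in> carrier G. \<chi> g = \<chi> \<one>\<^bsub>G\<^esub>}"


section \<open>Groups with two columns differing in exactly one entry\<close>

definition conjugate_in :: "('a, 'm) monoid_scheme \<Rightarrow> 'a \<Rightarrow> 'a \<Rightarrow> bool" where
  "conjugate_in G a b \<longleftrightarrow> (\<exists>g \<in> carrier G. b = g \<otimes>\<^bsub>G\<^esub> a \<otimes>\<^bsub>G\<^esub> inv\<^bsub>G\<^esub> g)"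

definition columns_differ_once :: "('a, 'm) monoid_scheme \<Rightarrow> 'a \<Rightarrow> 'a \<Rightarrow> bool" where
  "columns_differ_once G a b \<longleftrightarrow>
     (\<exists>\<chi> \<in> Irr G. \<chi> a \<noteq> \<chi> b \<and> (\<forall>\<psi> \<in> Irr G. \<psi> \<noteq> \<chi> \<longrightarrow> \<psi> a = \<psi> b))"

definition CD1_group :: "('a, 'm) monoid_scheme \<Rightarrow> bool" where
  "CD1_group G \<longleftrightarrow> group G \<and> finite (carrier G) \<and> Coset.order G > 2 \<and>
     (\<exists>a \<in> carrier G. \<exists>b \<in> carrier G. \<not> conjugate_in G a b \<and> columns_differ_once G a b)"

text \<open>A numbering \<open>\<chi>\<^sub>1, \<dots>, \<chi>\<^sub>k\<close> of the irreducible characters by non-decreasing degree,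
  starting with the trivial one. The degrees \<open>\<chi> i \<one>\<close> are natural numbers embedded in the
  complex numbers, hence compared through their real parts.\<close>

definition Irr_numbering :: "('a, 'm) monoid_scheme \<Rightarrow> nat \<Rightarrow> (nat \<Rightarrow> 'a \<Rightarrow> complex) \<Rightarrow> bool" where
  "Irr_numbering G k \<chi> \<longleftrightarrow> bij_betw \<chi> {1..k} (Irr G) \<and> \<chi> 1 = trivial_character G \<and>
     (\<forall>i j. 1 \<le> i \<longrightarrow> i \<le> j \<longrightarrow> j \<le> k \<longrightarrow> Re (\<chi> i \<one>\<^bsub>G\<^esub>) \<le> Re (\<chi> j \<one>\<^bsub>G\<^esub>))"


section \<open>Group-theoretic notions\<close>

definition centralizer :: "('a, 'm) monoid_scheme \<Rightarrow> 'a set \<Rightarrow> 'a set" where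
  "centralizer G S = {g \<in> carrier G. \<forall>s \<in> S. g \<otimes>\<^bsub>G\<^esub> s = s \<otimes>\<^bsub>G\<^esub> g}"

definition group_center :: "('a, 'm) monoid_scheme \<Rightarrow> 'a set" where
  "group_center G = centralizer G (carrier G)"

definition Syl :: "nat \<Rightarrow> ('a, 'm) monoid_scheme \<Rightarrow> 'a set set" where
  "Syl p G = {P. subgroup P G \<and> card P = p ^ multiplicity p (Coset.order G)}"

text \<open>\<open>O\<^sub>\<pi>(G)\<close>, the largest normal \<open>\<pi>\<close>-subgroup, as the join of all normal
  \<open>\<pi>\<close>-subgroups. Thus \<open>O\<^sub>p(G)\<close> is \<open>pi_core G {p}\<close> and
  \<open>O\<^sub>p\<^sub>'(G)\<close> is \<open>pi_core G (- {p})\<close>.\<close>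

definition pi_core :: "('a, 'm) monoid_scheme \<Rightarrow> nat set \<Rightarrow> 'a set" where
  "pi_core G \<pi> = generate G (\<Union>{H. H \<lhd> G \<and> prime_factors (card H) \<subseteq> \<pi>})"

definition Camina_pair :: "('a, 'm) monoid_scheme \<Rightarrow> 'a set \<Rightarrow> bool" where
  "Camina_pair G N \<longleftrightarrow> N \<lhd> G \<and> N \<noteq> {\<one>\<^bsub>G\<^esub>} \<and> N \<noteq> carrier G \<and>
     (\<forall>x \<in> carrier G - N. card (centralizer G {x}) = card (centralizer (G Mod N) {N #>\<^bsub>G\<^esub> x}))"

end

theory Submission
  imports Defs "HOL-Algebra.Sylow" "Jordan_Normal_Form.Spectral_Radius"
begin

text \<open>
  Write \<open>\<theta>\<close> for the row in which the columns of \<open>1\<close> and \<open>b\<close> differ, \<open>d\<close> for its degree, \<open>K\<close> for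
  the class of \<open>b\<close> and \<open>\<beta> = - \<theta>(b)\<close>. Column orthogonality of \<open>1\<close> and \<open>b\<close> against a third class
  shows that \<open>\<theta>\<close> vanishes off \<open>N = {1} \<union> K\<close>, and gives \<open>d = \<beta> |K|\<close>, \<open>|G| = d (d + \<beta>)\<close> and
  \<open>|C(b)| = \<beta>\<^sup>2 |N|\<close>. That \<open>N\<close> is a subgroup, and that each \<open>y\<close> outside \<open>N\<close> is conjugate to all
  elements of \<open>N y\<close>, both follow from
  \<open>\<Sum>\<^sub>x \<chi>(x g x\<^sup>-\<^sup>1 h) = |G| \<chi>(g) \<chi>(h) / \<chi>(1)\<close> by comparing with the extreme values possible.
  Summing \<open>\<theta>\<close> over \<open>\<langle>b\<rangle>\<close> shows that \<open>\<beta>\<close> is an integer; summing it over a Sylow \<open>q\<close>-subgroup with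
  \<open>q \<noteq> p\<close> shows that \<open>q\<close> does not divide \<open>\<beta>\<close>. Hence \<open>C(b)\<close> is a Sylow \<open>p\<close>-subgroup. A \<open>p\<close>-subgroup
  acting on \<open>K\<close> has a fixed point because \<open>|K| \<equiv> -1\<close> modulo \<open>p\<close>, so the Sylow \<open>p\<close>-subgroups are
  precisely the centralizers of elements of \<open>K\<close>, and normal \<open>p\<close>-subgroups centralize \<open>N\<close>.

  Values \<open>\<chi>(g\<^sup>-\<^sup>1)\<close> take the place of complex conjugates, so unitarity is never used. Column
  orthogonality is obtained without Maschke's theorem: in the regular representation the central
  element \<open>1 - \<Sum>\<^sub>\<chi> e\<^sub>\<chi>\<close> is an idempotent that kills every irreducible representation, so its image,
  which would contain an irreducible subrepresentation, is zero.
\<close>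

section \<open>Subspaces and idempotent matrices\<close>

lemma subspace_vec_iff:
  "VectorSpace.subspace class_ring W (module_vec TYPE(complex) n) \<longleftrightarrow>
     W \<subseteq> carrier_vec n \<and> 0\<^sub>v n \<in> W \<and> (\<forall>v \<in> W. \<forall>w \<in> W. v + w \<in> W) \<and>
     (\<forall>c. \<forall>v \<in> W. c \<cdot>\<^sub>v v \<in> W)"
  using vec_vs[where ?'a = complex and n = n] vec_module[where ?'a = complex and n = n]
  unfolding subspace_def submodule_def module_vec_simps class_ring_simps by auto

text \<open>The columns of \<open>B\<close> are \<open>m\<close> linearly independent vectors of
  \<open>W\<close>. The left inverse \<open>L\<close> certifies the independence, so dimension
  arguments become identities between rectangular matrices.\<close>

definition frame :: "nat \<Rightarrow> complex vec set \<Rightarrow> nat \<Rightarrow> complex mat \<Rightarrow> complex mat \<Rightarrow> bool" where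
  "frame n W m B L \<longleftrightarrow> B \<in> carrier_mat n m \<and> L \<in> carrier_mat m n \<and> L * B = 1\<^sub>m m \<and>
     (\<forall>u \<in> carrier_vec m. B *\<^sub>v u \<in> W)"

text \<open>If \<open>n < m\<close>, padding both matrices with zeros to size \<open>m\<close>
  leaves the product equal to the identity. For square matrices a left inverse is also a right
  inverse, but row \<open>n\<close> of the padded \<open>B\<close> is zero.\<close>

lemma left_inverse_dim_le:
  fixes B L :: "complex mat"
  assumes B: "B \<in> carrier_mat n m" and L: "L \<in> carrier_mat m n" and LB: "L * B = 1\<^sub>m m"
  shows "m \<le> n"
proof (rule ccontr)
  assume "\<not> m \<le> n"
  hence nm: "n < m" by simp
  define B' where "B' = mat m m (\<lambda>(i,j). if i < n then B $$ (i,j) else 0)"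
  define L' where "L' = mat m m (\<lambda>(i,j). if j < n then L $$ (i,j) else 0)"
  have "L' * B' = 1\<^sub>m m"
  proof (rule eq_matI)
    fix i j assume ij: "i < dim_row (1\<^sub>m m :: complex mat)" "j < dim_col (1\<^sub>m m :: complex mat)"
    have "(L' * B') $$ (i,j) = (\<Sum>k<m. L' $$ (i,k) * B' $$ (k,j))"
      using ij by (simp add: L'_def B'_def scalar_prod_def lessThan_atLeast0)
    also have "\<dots> = (\<Sum>k<n. L $$ (i,k) * B $$ (k,j))"
      using ij nm by (intro sum.mono_neutral_cong_right) (auto simp: L'_def B'_def)
    also have "\<dots> = (L * B) $$ (i,j)"
      using ij B L by (simp add: scalar_prod_def lessThan_atLeast0)
    finally show "(L' * B') $$ (i,j) = 1\<^sub>m m $$ (i,j)" using LB by simp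
  qed (auto simp: L'_def B'_def)
  hence "B' * L' = 1\<^sub>m m"
    by (rule mat_mult_left_right_inverse[rotated 2]) (auto simp: L'_def B'_def)
  hence "(B' * L') $$ (n,n) = 1" using nm by simp
  moreover have "(B' * L') $$ (n,n) = 0"
    using nm by (simp add: L'_def B'_def scalar_prod_def)
  ultimately show False by simp
qed

text \<open>The defect \<open>v\<close> of \<open>w\<close> under \<open>B * L\<close> is a nonzero
  vector of \<open>W\<close> killed by \<open>L\<close>; it becomes the new column. The matrix
  \<open>R\<close> kills the old columns and fixes \<open>v\<close>, so its row at a nonzero
  coordinate of \<open>v\<close>, rescaled, is the row to append to \<open>L\<close>.\<close>

lemma frame_extend:
  assumes W: "VectorSpace.subspace class_ring W (module_vec TYPE(complex) n)"
    and fr: "frame n W m B L" and w: "w \<in> W" "B *\<^sub>v (L *\<^sub>v w) \<noteq> w"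
  shows "\<exists>B' L'. frame n W (Suc m) B' L'"
proof -
  have B: "B \<in> carrier_mat n m" and L: "L \<in> carrier_mat m n" and LB: "L * B = 1\<^sub>m m"
    and BW: "\<And>u. u \<in> carrier_vec m \<Longrightarrow> B *\<^sub>v u \<in> W"
    using fr unfolding frame_def by blast+
  have Wn: "W \<subseteq> carrier_vec n" and Wadd: "\<And>u v. u \<in> W \<Longrightarrow> v \<in> W \<Longrightarrow> u + v \<in> W"
    and Wsm: "\<And>c u. u \<in> W \<Longrightarrow> c \<cdot>\<^sub>v u \<in> W"
    using W unfolding subspace_vec_iff by auto
  have wn: "w \<in> carrier_vec n" using w Wn by auto
  define v where "v = w + (-1) \<cdot>\<^sub>v (B *\<^sub>v (L *\<^sub>v w))"
  have vW: "v \<in> W" unfolding v_def by (intro Wadd Wsm BW w mult_mat_vec_carrier[OF L] wn)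
  hence vn: "v \<in> carrier_vec n" using Wn by auto
  have Bw: "B *\<^sub>v (L *\<^sub>v w) \<in> carrier_vec n" using B L wn by auto
  have Lv: "L *\<^sub>v v = 0\<^sub>v m"
  proof -
    have "L *\<^sub>v v = L *\<^sub>v w + (-1) \<cdot>\<^sub>v (L *\<^sub>v (B *\<^sub>v (L *\<^sub>v w)))"
      unfolding v_def using L wn Bw
      by (simp add: mult_add_distrib_mat_vec[OF L] mult_mat_vec[OF L])
    also have "L *\<^sub>v (B *\<^sub>v (L *\<^sub>v w)) = L *\<^sub>v w"
      using LB L B wn by (metis assoc_mult_mat_vec mult_mat_vec_carrier one_mult_mat_vec)
    finally show ?thesis using L wn by auto
  qed
  have "v \<noteq> 0\<^sub>v n"
  proof
    assume "v = 0\<^sub>v n"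
    hence v0: "v $ i = 0" if "i < n" for i using that by simp
    have "B *\<^sub>v (L *\<^sub>v w) = w"
    proof (rule eq_vecI)
      fix i assume "i < dim_vec w"
      hence "i < n" using wn by simp
      thus "(B *\<^sub>v (L *\<^sub>v w)) $ i = w $ i"
        using v0[of i] Bw B wn by (simp add: v_def)
    qed (use Bw wn B in auto)
    with w show False by simp
  qed
  then obtain a where a: "a < n" "v $ a \<noteq> 0"
    using vn by (metis carrier_vecD eq_vecI index_zero_vec)
  define R where "R = 1\<^sub>m n - B * L"
  have R: "R \<in> carrier_mat n n" using B L by (auto simp: R_def)
  have RB: "R * B = 0\<^sub>m n m"
  proof -
    have "R * B = 1\<^sub>m n * B - B * L * B"
      unfolding R_def using B L by (intro minus_mult_distrib_mat[of _ n n]) auto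
    also have "B * L * B = B" using B L LB by (metis assoc_mult_mat right_mult_one_mat)
    finally show ?thesis using B by auto
  qed
  have Rv: "R *\<^sub>v v = v"
  proof -
    have "R *\<^sub>v v = 1\<^sub>m n *\<^sub>v v - B * L *\<^sub>v v"
      unfolding R_def using B L vn by (intro minus_mult_distrib_mat_vec[of _ n n]) auto
    also have "B * L *\<^sub>v v = 0\<^sub>v n" using B L vn Lv by (auto simp: assoc_mult_mat_vec[of _ n m _ n])
    finally show ?thesis using vn by auto
  qed
  define B' where "B' = mat n (Suc m) (\<lambda>(i,j). if j < m then B $$ (i,j) else v $ i)"
  define L' where "L' = mat (Suc m) n (\<lambda>(i,j). if i < m then L $$ (i,j) else R $$ (a,j) / v $ a)"
  have "L' * B' = 1\<^sub>m (Suc m)"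
  proof (rule eq_matI)
    fix i j assume "i < dim_row (1\<^sub>m (Suc m) :: complex mat)" "j < dim_col (1\<^sub>m (Suc m) :: complex mat)"
    hence ij: "i < Suc m" "j < Suc m" by auto
    have e: "(L' * B') $$ (i,j) = (\<Sum>k<n. L' $$ (i,k) * B' $$ (k,j))"
      using ij by (simp add: L'_def B'_def scalar_prod_def lessThan_atLeast0)
    consider "i < m" "j < m" | "i < m" "j = m" | "i = m" "j < m" | "i = m" "j = m"
      using ij by linarith
    thus "(L' * B') $$ (i,j) = 1\<^sub>m (Suc m) $$ (i,j)"
    proof cases
      case 1
      have "(L' * B') $$ (i,j) = (L * B) $$ (i,j)"
        unfolding e using 1 B L by (simp add: L'_def B'_def scalar_prod_def lessThan_atLeast0)
      thus ?thesis using 1 LB by simp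
    next
      case 2
      have "(L' * B') $$ (i,j) = (L *\<^sub>v v) $ i"
        unfolding e using 2 vn L by (simp add: L'_def B'_def scalar_prod_def lessThan_atLeast0)
      thus ?thesis using 2 Lv by simp
    next
      case 3
      have "(L' * B') $$ (i,j) = (R * B) $$ (a,j) / v $ a"
        unfolding e using 3 a B R
        by (simp add: L'_def B'_def scalar_prod_def lessThan_atLeast0 sum_divide_distrib)
      thus ?thesis using 3 RB a by simp
    next
      case 4
      have "(L' * B') $$ (i,j) = (R *\<^sub>v v) $ a / v $ a"
        unfolding e using 4 a vn R
        by (simp add: L'_def B'_def scalar_prod_def lessThan_atLeast0 sum_divide_distrib)
      thus ?thesis using 4 Rv a by simp
    qed
  qed (auto simp: L'_def B'_def)
  moreover have "B' *\<^sub>v u \<in> W" if u: "u \<in> carrier_vec (Suc m)" for u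
  proof -
    define u' where "u' = vec m (\<lambda>i. u $ i)"
    have "B' *\<^sub>v u = B *\<^sub>v u' + (u $ m) \<cdot>\<^sub>v v"
      using B u vn
      by (intro eq_vecI) (auto simp: B'_def u'_def scalar_prod_def)
    moreover have "u' \<in> carrier_vec m" by (simp add: u'_def)
    ultimately show ?thesis using Wadd Wsm BW vW by simp
  qed
  ultimately show ?thesis unfolding frame_def
    by (intro exI[of _ B'] exI[of _ L']) (auto simp: B'_def L'_def)
qed

text \<open>Frames have at most \<open>n\<close> columns, so one of maximal size exists. As it
  admits no extension, \<open>B * L\<close> fixes every vector of \<open>W\<close>: the columns span
  \<open>W\<close>.\<close>

lemma subspace_frame:
  assumes W: "VectorSpace.subspace class_ring W (module_vec TYPE(complex) n)"
  obtains m B L where "frame n W m B L" "m \<le> n" "\<And>w. w \<in> W \<Longrightarrow> B *\<^sub>v (L *\<^sub>v w) = w"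
proof -
  define P where "P m \<longleftrightarrow> (\<exists>B L. frame n W m B L)" for m
  have bound: "m \<le> n" if "P m" for m
  proof -
    from that obtain B L where "frame n W m B L" unfolding P_def by auto
    thus ?thesis by (auto simp: frame_def intro: left_inverse_dim_le[of B n m L])
  qed
  have "P 0"
  proof -
    have "0\<^sub>m n 0 *\<^sub>v u = 0\<^sub>v n" if "u \<in> carrier_vec 0" for u :: "complex vec"
      using that by (intro eq_vecI) (auto simp: scalar_prod_def)
    hence "frame n W 0 (0\<^sub>m n 0) (0\<^sub>m 0 n)"
      using W unfolding frame_def subspace_vec_iff by auto
    thus ?thesis unfolding P_def by blast
  qed
  define m where "m = (GREATEST m. P m)"
  have Pm: "P m" unfolding m_def using GreatestI_nat[of P 0 n] \<open>P 0\<close> bound by blast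
  have nP: "\<not> P (Suc m)"
    using Greatest_le_nat[of P "Suc m" n] bound unfolding m_def[symmetric] by auto
  from Pm obtain B L where fr: "frame n W m B L" unfolding P_def by blast
  have "B *\<^sub>v (L *\<^sub>v w) = w" if "w \<in> W" for w
    using frame_extend[OF W fr that] nP unfolding P_def by blast
  from that[OF fr bound[OF Pm] this] show ?thesis .
qed

section \<open>Traces of products and of idempotents\<close>

lemma mat_trace_comm:
  assumes A: "A \<in> carrier_mat n m" and B: "B \<in> carrier_mat m n"
  shows "mat_trace (A * B) = mat_trace (B * A)"
proof -
  have "mat_trace (A * B) = (\<Sum>i<n. \<Sum>j<m. A $$ (i,j) * B $$ (j,i))"
    using A B by (simp add: mat_trace_def scalar_prod_def lessThan_atLeast0)
  also have "\<dots> = (\<Sum>j<m. \<Sum>i<n. B $$ (j,i) * A $$ (i,j))"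
    by (subst sum.swap) (simp add: mult.commute)
  also have "\<dots> = mat_trace (B * A)"
    using A B by (simp add: mat_trace_def scalar_prod_def lessThan_atLeast0)
  finally show ?thesis .
qed

lemma mat_trace_one [simp]: "mat_trace (1\<^sub>m n) = of_nat n"
  by (simp add: mat_trace_def)

lemma mat_eq_if_mult_vec_eq:
  fixes A B :: "complex mat"
  assumes A: "A \<in> carrier_mat n m" and B: "B \<in> carrier_mat n m"
    and eq: "\<And>v. v \<in> carrier_vec m \<Longrightarrow> A *\<^sub>v v = B *\<^sub>v v"
  shows "A = B"
proof (rule eq_matI)
  fix i j assume "i < dim_row B" "j < dim_col B"
  hence "i < n" "j < m" using B by auto
  moreover have "A *\<^sub>v unit_vec m j = B *\<^sub>v unit_vec m j" by (intro eq) simp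
  hence "(A *\<^sub>v unit_vec m j) $ i = (B *\<^sub>v unit_vec m j) $ i" by simp
  ultimately show "A $$ (i,j) = B $$ (i,j)" using A B by simp
qed (use A B in auto)

text \<open>The trace of an idempotent is its rank. A frame of the fixed space satisfies
  \<open>E * B = B\<close> and factors \<open>E\<close> as \<open>B * (L * E)\<close>; cycling the
  trace leaves the identity of size \<open>m\<close>.\<close>

lemma idempotent_trace_Nat:
  assumes E: "E \<in> carrier_mat n n" and EE: "E * E = E"
  shows "\<exists>m::nat. mat_trace E = of_nat m"
proof -
  define W where "W = {v \<in> carrier_vec n. E *\<^sub>v v = v}"
  have "VectorSpace.subspace class_ring W (module_vec TYPE(complex) n)"
    unfolding subspace_vec_iff W_def using E
    by (auto simp: mult_add_distrib_mat_vec[OF E] mult_mat_vec[OF E])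
  then obtain m B L where fr: "frame n W m B L"
    and BL: "\<And>w. w \<in> W \<Longrightarrow> B *\<^sub>v (L *\<^sub>v w) = w" by (rule subspace_frame) blast
  have B: "B \<in> carrier_mat n m" and L: "L \<in> carrier_mat m n" and LB: "L * B = 1\<^sub>m m"
    and BW: "\<And>u. u \<in> carrier_vec m \<Longrightarrow> B *\<^sub>v u \<in> W"
    using fr unfolding frame_def by blast+
  have EB: "E * B = B"
  proof (rule mat_eq_if_mult_vec_eq[of _ n m])
    fix u :: "complex vec" assume "u \<in> carrier_vec m"
    thus "E * B *\<^sub>v u = B *\<^sub>v u"
      using BW[of u] assoc_mult_mat_vec[OF E B, of u] by (simp add: W_def)
  qed (use E B in auto)
  have BLE: "B * (L * E) = E"
  proof (rule mat_eq_if_mult_vec_eq[of _ n n])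
    fix u :: "complex vec" assume u: "u \<in> carrier_vec n"
    have "E *\<^sub>v u \<in> W"
      using assoc_mult_mat_vec[OF E E u] EE E u unfolding W_def by simp
    from BL[OF this] show "B * (L * E) *\<^sub>v u = E *\<^sub>v u"
      using B L E u by (auto simp: assoc_mult_mat_vec[OF L E] assoc_mult_mat_vec[of B n m "L * E" n])
  qed (use E B L in auto)
  have "mat_trace E = mat_trace (B * (L * E))" by (simp add: BLE)
  also have "\<dots> = mat_trace (L * E * B)" using B L E by (intro mat_trace_comm[of _ n m]) auto
  also have "L * E * B = 1\<^sub>m m" using EB LB B L E by (simp add: assoc_mult_mat[OF L E B])
  finally show ?thesis by auto
qed

section \<open>Representations\<close>

text \<open>Matrices of all sizes share one type, so the size is passed explicitly; an empty sum is
  then the zero matrix of that size.\<close>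

definition mat_sum :: "nat \<Rightarrow> nat \<Rightarrow> ('b \<Rightarrow> complex mat) \<Rightarrow> 'b set \<Rightarrow> complex mat" where
  "mat_sum n m f S = mat n m (\<lambda>(i,j). \<Sum>x\<in>S. f x $$ (i,j))"

lemma mat_sum_carrier [simp]: "mat_sum n m f S \<in> carrier_mat n m"
  by (simp add: mat_sum_def)

lemma mat_sum_index [simp]:
  "i < n \<Longrightarrow> j < m \<Longrightarrow> mat_sum n m f S $$ (i,j) = (\<Sum>x\<in>S. f x $$ (i,j))"
  by (simp add: mat_sum_def)

lemma mat_sum_dim [simp]: "dim_row (mat_sum n m f S) = n" "dim_col (mat_sum n m f S) = m"
  by (simp_all add: mat_sum_def)

lemma mat_sum_cong:
  assumes "\<And>x. x \<in> S \<Longrightarrow> f x = g x"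
  shows "mat_sum n m f S = mat_sum n m g S"
  using assms by (intro eq_matI) auto

lemma mat_sum_reindex:
  assumes "bij_betw \<pi> S T"
  shows "mat_sum n m (\<lambda>x. f (\<pi> x)) S = mat_sum n m f T"
proof (rule eq_matI)
  fix i j assume "i < dim_row (mat_sum n m f T)" "j < dim_col (mat_sum n m f T)"
  thus "mat_sum n m (\<lambda>x. f (\<pi> x)) S $$ (i,j) = mat_sum n m f T $$ (i,j)"
    using sum.reindex_bij_betw[OF assms, of "\<lambda>x. f x $$ (i,j)"] by simp
qed auto

lemma mult_mat_index:
  fixes A B :: "complex mat"
  assumes "A \<in> carrier_mat n m" "B \<in> carrier_mat m l" "i < n" "j < l"
  shows "(A * B) $$ (i,j) = (\<Sum>k<m. A $$ (i,k) * B $$ (k,j))"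
  using assms by (simp add: scalar_prod_def lessThan_atLeast0)

lemma mult_mat_sum:
  assumes A: "A \<in> carrier_mat l n" and f: "\<And>x. x \<in> S \<Longrightarrow> f x \<in> carrier_mat n m"
  shows "A * mat_sum n m f S = mat_sum l m (\<lambda>x. A * f x) S"
proof (rule eq_matI)
  fix i j assume "i < dim_row (mat_sum l m (\<lambda>x. A * f x) S)" "j < dim_col (mat_sum l m (\<lambda>x. A * f x) S)"
  hence ij: "i < l" "j < m" by auto
  have "(A * mat_sum n m f S) $$ (i,j) = (\<Sum>k<n. \<Sum>x\<in>S. A $$ (i,k) * f x $$ (k,j))"
    using ij by (simp add: mult_mat_index[OF A mat_sum_carrier] sum_distrib_left)
  also have "\<dots> = (\<Sum>x\<in>S. (A * f x) $$ (i,j))"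
    by (subst sum.swap) (intro sum.cong refl, simp add: mult_mat_index[OF A f] ij)
  finally show "(A * mat_sum n m f S) $$ (i,j) = mat_sum l m (\<lambda>x. A * f x) S $$ (i,j)"
    using ij by simp
qed (use A in auto)

lemma mat_sum_mult:
  assumes A: "A \<in> carrier_mat m l" and f: "\<And>x. x \<in> S \<Longrightarrow> f x \<in> carrier_mat n m"
  shows "mat_sum n m f S * A = mat_sum n l (\<lambda>x. f x * A) S"
proof (rule eq_matI)
  fix i j assume "i < dim_row (mat_sum n l (\<lambda>x. f x * A) S)" "j < dim_col (mat_sum n l (\<lambda>x. f x * A) S)"
  hence ij: "i < n" "j < l" by auto
  have "(mat_sum n m f S * A) $$ (i,j) = (\<Sum>k<m. \<Sum>x\<in>S. f x $$ (i,k) * A $$ (k,j))"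
    using ij by (simp add: mult_mat_index[OF mat_sum_carrier A] sum_distrib_right)
  also have "\<dots> = (\<Sum>x\<in>S. (f x * A) $$ (i,j))"
    by (subst sum.swap) (intro sum.cong refl, simp add: mult_mat_index[OF f A] ij)
  finally show "(mat_sum n m f S * A) $$ (i,j) = mat_sum n l (\<lambda>x. f x * A) S $$ (i,j)"
    using ij by simp
qed (use A in auto)

text \<open>A matrix unit between two matrices isolates a product of one entry of each. Averaging
  matrix units therefore yields the orthogonality of coefficients.\<close>

lemma mult_elementary_index:
  fixes A B :: "complex mat"
  assumes A: "A \<in> carrier_mat n n" and B: "B \<in> carrier_mat m m"
    and "i < n" "a < n" "b < m" "j < m"
  shows "(A * mat n m (\<lambda>(k,l). if k = a \<and> l = b then 1 else 0) * B) $$ (i,j) = A $$ (i,a) * B $$ (b,j)"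
proof -
  let ?E = "mat n m (\<lambda>(k,l). if k = a \<and> l = b then 1 else 0) :: complex mat"
  have E: "?E \<in> carrier_mat n m" by simp
  have AE: "(A * ?E) $$ (i,l) = (if l = b then A $$ (i,a) else 0)" if "l < m" for l
  proof -
    have "(A * ?E) $$ (i,l) = (\<Sum>k<n. if k = a then (if l = b then A $$ (i,k) else 0) else 0)"
      unfolding mult_mat_index[OF A E \<open>i < n\<close> that] using that assms by (intro sum.cong) auto
    thus ?thesis using assms by simp
  qed
  have "(A * ?E * B) $$ (i,j) = (\<Sum>l<m. if l = b then A $$ (i,a) * B $$ (l,j) else 0)"
    unfolding mult_mat_index[OF mult_carrier_mat[OF A E] B \<open>i < n\<close> \<open>j < m\<close>]
    by (intro sum.cong) (auto simp: AE)
  thus ?thesis using assms by simp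
qed

lemma mat_trace_mat_sum:
  assumes "\<And>x. x \<in> S \<Longrightarrow> f x \<in> carrier_mat n n"
  shows "mat_trace (mat_sum n n f S) = (\<Sum>x\<in>S. mat_trace (f x))"
proof -
  have "mat_trace (mat_sum n n f S) = (\<Sum>x\<in>S. \<Sum>i<n. f x $$ (i,i))"
    by (simp add: mat_trace_def sum.swap[of _ S])
  also have "\<dots> = (\<Sum>x\<in>S. mat_trace (f x))"
    using assms by (intro sum.cong refl) (auto simp: mat_trace_def)
  finally show ?thesis .
qed

lemma mat_trace_smult: "A \<in> carrier_mat n n \<Longrightarrow> mat_trace (c \<cdot>\<^sub>m A) = c * mat_trace A"
  by (auto simp: mat_trace_def sum_distrib_left)

context group
begin

section \<open>Matrix representations of a group\<close>

lemma is_repI: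
  assumes "\<And>g. g \<in> carrier G \<Longrightarrow> \<rho> g \<in> carrier_mat n n"
    and "\<And>g h. g \<in> carrier G \<Longrightarrow> h \<in> carrier G \<Longrightarrow> \<rho> (g \<otimes> h) = \<rho> g * \<rho> h"
    and "\<rho> \<one> = 1\<^sub>m n"
  shows "is_rep G n \<rho>"
proof -
  have "\<rho> g \<in> Units (ring_mat TYPE(complex) n ())" if g: "g \<in> carrier G" for g
  proof -
    have "\<rho> (inv g) * \<rho> g = 1\<^sub>m n" "\<rho> g * \<rho> (inv g) = 1\<^sub>m n"
      using assms(2)[of "inv g" g] assms(2)[of g "inv g"] assms(3) g by auto
    thus ?thesis using assms(1) g unfolding Units_def ring_mat_simps by blast
  qed
  thus ?thesis using assms(2) unfolding is_rep_def hom_def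
    by (auto simp: units_of_def ring_mat_simps)
qed

lemma
  assumes "is_rep G n \<rho>"
  shows rep_carrier: "g \<in> carrier G \<Longrightarrow> \<rho> g \<in> carrier_mat n n"
    and rep_mult: "g \<in> carrier G \<Longrightarrow> h \<in> carrier G \<Longrightarrow> \<rho> (g \<otimes> h) = \<rho> g * \<rho> h"
    and rep_one: "\<rho> \<one> = 1\<^sub>m n"
proof -
  have U: "\<rho> g \<in> Units (ring_mat TYPE(complex) n ())" if "g \<in> carrier G" for g
    using assms that unfolding is_rep_def hom_def by (auto simp: units_of_def)
  thus c: "g \<in> carrier G \<Longrightarrow> \<rho> g \<in> carrier_mat n n" for g
    unfolding Units_def ring_mat_simps by blast
  show m: "g \<in> carrier G \<Longrightarrow> h \<in> carrier G \<Longrightarrow> \<rho> (g \<otimes> h) = \<rho> g * \<rho> h" for g h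
    using assms unfolding is_rep_def hom_def by (auto simp: units_of_def ring_mat_simps)
  obtain X where X: "X \<in> carrier_mat n n" "X * \<rho> \<one> = 1\<^sub>m n"
    using U[of \<one>] unfolding Units_def ring_mat_simps by auto
  \<comment> \<open>An invertible idempotent is the identity: one factor is cancelled with the
    inverse \<open>X\<close>.\<close>
  have idem: "\<rho> \<one> * \<rho> \<one> = \<rho> \<one>" using m[of \<one> \<one>] by simp
  have "\<rho> \<one> = X * \<rho> \<one> * \<rho> \<one>" using X c[of \<one>] by simp
  also have "\<dots> = X * (\<rho> \<one> * \<rho> \<one>)" using X(1) c[of \<one>] by (intro assoc_mult_mat[of _ n n]) auto
  finally show "\<rho> \<one> = 1\<^sub>m n" using X idem by simp
qed

lemma rep_inv:
  assumes "is_rep G n \<rho>" "g \<in> carrier G"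
  shows "\<rho> (inv g) * \<rho> g = 1\<^sub>m n" "\<rho> g * \<rho> (inv g) = 1\<^sub>m n"
  using rep_mult[OF assms(1), of "inv g" g] rep_mult[OF assms(1), of g "inv g"] assms
  by (auto simp: rep_one)

section \<open>Schur's lemma\<close>

lemma irreducible_subspace:
  assumes "irreducible_rep G n \<rho>"
    and "VectorSpace.subspace class_ring W (module_vec TYPE(complex) n)"
    and "\<And>g w. g \<in> carrier G \<Longrightarrow> w \<in> W \<Longrightarrow> \<rho> g *\<^sub>v w \<in> W"
  shows "W = {0\<^sub>v n} \<or> W = carrier_vec n"
  using assms unfolding irreducible_rep_def by blast

text \<open>Over the complex numbers \<open>T\<close> has an eigenvalue \<open>c\<close>. Its
  eigenspace is nonzero, and invariant because \<open>T\<close> commutes with the representation,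
  hence it is the whole space.\<close>

lemma schur_scalar:
  assumes irr: "irreducible_rep G n \<rho>" and T: "T \<in> carrier_mat n n"
    and comm: "\<And>g. g \<in> carrier G \<Longrightarrow> \<rho> g * T = T * \<rho> g"
  shows "\<exists>c. T = c \<cdot>\<^sub>m 1\<^sub>m n"
proof -
  have rep: "is_rep G n \<rho>" and n: "n > 0" using irr unfolding irreducible_rep_def by auto
  obtain c v where v: "eigenvector T v c"
    using spectrum_non_empty[OF T n] unfolding spectrum_def eigenvalue_def by auto
  define W where "W = {w \<in> carrier_vec n. T *\<^sub>v w = c \<cdot>\<^sub>v w}"
  have sub: "VectorSpace.subspace class_ring W (module_vec TYPE(complex) n)"
    unfolding subspace_vec_iff W_def using T
    by (auto simp: mult_add_distrib_mat_vec[OF T] mult_mat_vec[OF T] smult_add_distrib_vec[of _ n]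
        smult_smult_assoc mult.commute)
  have "\<rho> g *\<^sub>v w \<in> W" if "g \<in> carrier G" "w \<in> W" for g w
  proof -
    have R: "\<rho> g \<in> carrier_mat n n" using rep_carrier[OF rep that(1)] .
    have w: "w \<in> carrier_vec n" "T *\<^sub>v w = c \<cdot>\<^sub>v w" using that by (auto simp: W_def)
    have "T *\<^sub>v (\<rho> g *\<^sub>v w) = \<rho> g *\<^sub>v (T *\<^sub>v w)"
      using assoc_mult_mat_vec[OF T R w(1)] assoc_mult_mat_vec[OF R T w(1)] comm[OF that(1)] by simp
    thus ?thesis using w R by (simp add: W_def mult_mat_vec[OF R])
  qed
  hence "W = {0\<^sub>v n} \<or> W = carrier_vec n" by (intro irreducible_subspace[OF irr sub])
  moreover have "v \<in> W" "v \<noteq> 0\<^sub>v n" using v T unfolding eigenvector_def W_def by auto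
  ultimately have W: "W = carrier_vec n" by auto
  have "T = c \<cdot>\<^sub>m 1\<^sub>m n"
  proof (rule mat_eq_if_mult_vec_eq[OF T])
    fix u :: "complex vec" assume u: "u \<in> carrier_vec n"
    hence "T *\<^sub>v u = c \<cdot>\<^sub>v u" using W unfolding W_def by blast
    thus "T *\<^sub>v u = c \<cdot>\<^sub>m 1\<^sub>m n *\<^sub>v u"
      using u by (auto intro!: eq_vecI simp: scalar_prod_smult_left)
  qed auto
  thus ?thesis ..
qed

text \<open>A nonzero intertwiner has trivial kernel and full image, hence is invertible; the two
  representations are then similar and have equal traces. Inequivalence is phrased through
  characters because \<open>Irr\<close> is a set of characters.\<close>

lemma schur_zero:
  assumes irr: "irreducible_rep G n \<rho>" "irreducible_rep G m \<sigma>" and T: "T \<in> carrier_mat n m"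
    and comm: "\<And>g. g \<in> carrier G \<Longrightarrow> \<rho> g * T = T * \<sigma> g"
    and neq: "rep_character G \<rho> \<noteq> rep_character G \<sigma>"
  shows "T = 0\<^sub>m n m"
proof (rule ccontr)
  assume T0: "T \<noteq> 0\<^sub>m n m"
  have rep: "is_rep G n \<rho>" "is_rep G m \<sigma>" using irr unfolding irreducible_rep_def by auto
  obtain v where v: "v \<in> carrier_vec m" "T *\<^sub>v v \<noteq> 0\<^sub>v n"
  proof -
    have "0\<^sub>m n m *\<^sub>v w = 0\<^sub>v n" if "w \<in> carrier_vec m" for w :: "complex vec"
      using that by (intro eq_vecI) auto
    thus ?thesis using T0 mat_eq_if_mult_vec_eq[OF T, of "0\<^sub>m n m"] that by fastforce
  qed
  define K where "K = {w \<in> carrier_vec m. T *\<^sub>v w = 0\<^sub>v n}"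
  define I where "I = {T *\<^sub>v w | w. w \<in> carrier_vec m}"
  have "VectorSpace.subspace class_ring K (module_vec TYPE(complex) m)"
    unfolding subspace_vec_iff K_def using T
    by (auto simp: mult_add_distrib_mat_vec[OF T] mult_mat_vec[OF T])
  moreover have TC: "T *\<^sub>v (\<sigma> g *\<^sub>v w) = \<rho> g *\<^sub>v (T *\<^sub>v w)"
    if "g \<in> carrier G" "w \<in> carrier_vec m" for g w
    using assoc_mult_mat_vec[OF T rep_carrier[OF rep(2) that(1)] that(2)]
      assoc_mult_mat_vec[OF rep_carrier[OF rep(1) that(1)] T that(2)] comm[OF that(1)] by simp
  have "\<sigma> g *\<^sub>v w \<in> K" if "g \<in> carrier G" "w \<in> K" for g w
    using TC[of g w] that rep_carrier[OF rep(1) that(1)] rep_carrier[OF rep(2) that(1)] by (auto simp: K_def)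
  ultimately have "K = {0\<^sub>v m} \<or> K = carrier_vec m" by (intro irreducible_subspace[OF irr(2)])
  hence K: "K = {0\<^sub>v m}" using v by (auto simp: K_def)
  have "VectorSpace.subspace class_ring I (module_vec TYPE(complex) n)"
    unfolding subspace_vec_iff
  proof (intro conjI ballI allI)
    show "I \<subseteq> carrier_vec n" using T by (auto simp: I_def)
    show "0\<^sub>v n \<in> I" using T unfolding I_def by (auto intro!: exI[of _ "0\<^sub>v m"])
    fix a b assume "a \<in> I" "b \<in> I"
    then obtain a' b' where "a' \<in> carrier_vec m" "b' \<in> carrier_vec m" "a = T *\<^sub>v a'" "b = T *\<^sub>v b'"
      by (auto simp: I_def)
    thus "a + b \<in> I" unfolding I_def
      by (auto intro!: exI[of _ "a' + b'"] simp: mult_add_distrib_mat_vec[OF T])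
  next
    fix c a assume "a \<in> I"
    then obtain a' where "a' \<in> carrier_vec m" "a = T *\<^sub>v a'" by (auto simp: I_def)
    thus "c \<cdot>\<^sub>v a \<in> I" unfolding I_def
      by (auto intro!: exI[of _ "c \<cdot>\<^sub>v a'"] simp: mult_mat_vec[OF T])
  qed
  moreover have "\<rho> g *\<^sub>v w \<in> I" if g: "g \<in> carrier G" and w: "w \<in> I" for g w
  proof -
    obtain w' where w': "w' \<in> carrier_vec m" "w = T *\<^sub>v w'" using w by (auto simp: I_def)
    hence "\<rho> g *\<^sub>v w = T *\<^sub>v (\<sigma> g *\<^sub>v w')" using TC g by simp
    thus ?thesis using w' rep_carrier[OF rep(2) g] unfolding I_def by auto
  qed
  ultimately have "I = {0\<^sub>v n} \<or> I = carrier_vec n" by (intro irreducible_subspace[OF irr(1)])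
  moreover have "T *\<^sub>v v \<in> I" using v by (auto simp: I_def)
  ultimately have I: "I = carrier_vec n" using v by auto
  have "\<exists>u. u \<in> carrier_vec m \<and> T *\<^sub>v u = unit_vec n i" for i
  proof -
    have "unit_vec n i \<in> I" unfolding I by simp
    thus ?thesis unfolding I_def by force
  qed
  then obtain f where f: "\<And>i. f i \<in> carrier_vec m" "\<And>i. T *\<^sub>v f i = unit_vec n i" by metis
  \<comment> \<open>Column \<open>i\<close> of \<open>X\<close> is a preimage of the
    \<open>i\<close>-th unit vector under \<open>T\<close>, which makes \<open>X\<close> a right
    inverse.\<close>
  define X where "X = mat m n (\<lambda>(a,i). f i $ a)"
  have X: "X \<in> carrier_mat m n" by (simp add: X_def)
  have TX: "T * X = 1\<^sub>m n"
  proof (rule eq_matI)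
    fix i j assume "i < dim_row (1\<^sub>m n :: complex mat)" "j < dim_col (1\<^sub>m n :: complex mat)"
    hence ij: "i < n" "j < n" by auto
    have "(T * X) $$ (i,j) = (T *\<^sub>v f j) $ i"
      using T X f(1)[of j] ij by (simp add: scalar_prod_def X_def)
    thus "(T * X) $$ (i,j) = 1\<^sub>m n $$ (i,j)" using f(2) ij by auto
  qed (use T X in auto)
  have XT: "X * T = 1\<^sub>m m"
  proof (rule mat_eq_if_mult_vec_eq)
    fix u :: "complex vec" assume u: "u \<in> carrier_vec m"
    \<comment> \<open>The difference \<open>y\<close> lies in the kernel of \<open>T\<close>, which
      is already known to be trivial.\<close>
    define y where "y = X *\<^sub>v (T *\<^sub>v u) + (-1) \<cdot>\<^sub>v u"
    have Tu: "T *\<^sub>v u \<in> carrier_vec n" using T u by auto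
    have y: "y \<in> carrier_vec m" using X Tu u by (auto simp: y_def)
    have "T *\<^sub>v (X *\<^sub>v (T *\<^sub>v u)) = T *\<^sub>v u"
      using assoc_mult_mat_vec[OF T X Tu] TX Tu by simp
    hence "T *\<^sub>v y = T *\<^sub>v u + (-1) \<cdot>\<^sub>v (T *\<^sub>v u)"
      unfolding y_def using X T u Tu
      by (subst mult_add_distrib_mat_vec[OF T]) (auto simp: mult_mat_vec[OF T])
    also have "\<dots> = 0\<^sub>v n" using Tu T by (intro eq_vecI) auto
    finally have y0: "y = 0\<^sub>v m" using y K by (auto simp: K_def)
    have XTu: "X *\<^sub>v (T *\<^sub>v u) \<in> carrier_vec m" using X Tu by auto
    have "X *\<^sub>v (T *\<^sub>v u) = u"
    proof (rule eq_vecI)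
      fix i assume "i < dim_vec u"
      hence "i < m" using u by simp
      hence "y $ i = 0" using y0 by simp
      thus "(X *\<^sub>v (T *\<^sub>v u)) $ i = u $ i" using \<open>i < m\<close> XTu u X by (simp add: y_def)
    qed (use XTu u X in auto)
    thus "X * T *\<^sub>v u = 1\<^sub>m m *\<^sub>v u" using assoc_mult_mat_vec[OF X T u] u by simp
  qed (use X T in auto)
  have "mat_trace (\<rho> g) = mat_trace (\<sigma> g)" if g: "g \<in> carrier G" for g
  proof -
    have c: "\<rho> g \<in> carrier_mat n n" "\<sigma> g \<in> carrier_mat m m"
      using rep_carrier rep g by auto
    have "mat_trace (\<rho> g) = mat_trace (\<rho> g * T * X)" using TX c T X by (simp add: assoc_mult_mat[of _ n n])
    also have "\<dots> = mat_trace (T * (\<sigma> g * X))" using comm[OF g] c T X by (simp add: assoc_mult_mat[of _ n m])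
    also have "\<dots> = mat_trace (\<sigma> g * X * T)" using c T X by (intro mat_trace_comm[of _ n m]) auto
    also have "\<dots> = mat_trace (\<sigma> g)" using c T X XT by (simp add: assoc_mult_mat[of _ m m])
    finally show ?thesis .
  qed
  hence "rep_character G \<rho> = rep_character G \<sigma>" unfolding rep_character_def by auto
  with neq show False by simp
qed

text \<open>A nonzero invariant subspace of least dimension inside \<open>W\<close> is irreducible.
  The columns of \<open>B\<close> are a basis of it, and \<open>\<sigma>\<close> is the action
  written in this basis.\<close>

lemma subrep_irreducible:
  assumes rep: "is_rep G n R"
    and W: "VectorSpace.subspace class_ring W (module_vec TYPE(complex) n)"
    and inv: "\<And>g w. g \<in> carrier G \<Longrightarrow> w \<in> W \<Longrightarrow> R g *\<^sub>v w \<in> W"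
    and W0: "W \<noteq> {0\<^sub>v n}"
  obtains m \<sigma> B L where "irreducible_rep G m \<sigma>" "frame n W m B L"
    "\<And>g. g \<in> carrier G \<Longrightarrow> R g * B = B * \<sigma> g"
proof -
  \<comment> \<open>\<open>Q m\<close> says that \<open>W\<close> contains an invariant subspace of
    dimension \<open>m > 0\<close>: the equation expresses that each \<open>R g\<close> maps the
    columns of \<open>B\<close> into their span, onto which \<open>B * L\<close> projects.\<close>
  define Q where "Q m \<longleftrightarrow> m > 0 \<and> (\<exists>B L. frame n W m B L \<and>
     (\<forall>g \<in> carrier G. R g * B = B * (L * R g * B)))" for m
  have Qex: "\<exists>m. Q m"
  proof -
    obtain m B L where fr: "frame n W m B L" and BL: "\<And>w. w \<in> W \<Longrightarrow> B *\<^sub>v (L *\<^sub>v w) = w"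
      using W by (rule subspace_frame) blast
    have B: "B \<in> carrier_mat n m" and L: "L \<in> carrier_mat m n"
      and BW: "\<And>u. u \<in> carrier_vec m \<Longrightarrow> B *\<^sub>v u \<in> W" using fr unfolding frame_def by blast+
    have "R g * B = B * (L * R g * B)" if g: "g \<in> carrier G" for g
    proof (rule mat_eq_if_mult_vec_eq[of _ n m])
      have Rg: "R g \<in> carrier_mat n n" using rep_carrier[OF rep g] .
      fix u :: "complex vec" assume u: "u \<in> carrier_vec m"
      have 1: "R g * B *\<^sub>v u = R g *\<^sub>v (B *\<^sub>v u)" using assoc_mult_mat_vec[OF Rg B u] .
      have "R g * B *\<^sub>v u \<in> W" unfolding 1 using inv g BW u by blast
      from BL[OF this] have "R g * B *\<^sub>v u = B *\<^sub>v (L *\<^sub>v (R g * B *\<^sub>v u))" by simp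
      also have "\<dots> = B *\<^sub>v (L * (R g * B) *\<^sub>v u)"
        using assoc_mult_mat_vec[of L m n "R g * B" m u] L Rg B u by simp
      also have "\<dots> = B * (L * (R g * B)) *\<^sub>v u"
        using assoc_mult_mat_vec[of B n m "L * (R g * B)" m u] L Rg B u by simp
      also have "L * (R g * B) = L * R g * B" using assoc_mult_mat[OF L Rg B] by simp
      finally show "R g * B *\<^sub>v u = B * (L * R g * B) *\<^sub>v u" .
    qed (use B L rep_carrier[OF rep g] in auto)
    moreover have "m > 0"
    proof (rule ccontr)
      assume "\<not> m > 0"
      hence m: "m = 0" by simp
      have "w = 0\<^sub>v n" if w: "w \<in> W" for w
      proof -
        have "w = B *\<^sub>v (L *\<^sub>v w)" using BL w by simp
        also have "\<dots> = 0\<^sub>v n"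
          using B L m by (intro eq_vecI) (auto simp: scalar_prod_def)
        finally show ?thesis .
      qed
      with W0 W show False unfolding subspace_vec_iff by blast
    qed
    ultimately show ?thesis using fr unfolding Q_def by blast
  qed
  define m where "m = (LEAST m. Q m)"
  have "Q m" and least: "\<And>k. Q k \<Longrightarrow> m \<le> k"
    unfolding m_def using Qex by (auto intro: LeastI_ex Least_le)
  then obtain B L where m: "m > 0" and fr: "frame n W m B L"
    and RB: "\<And>g. g \<in> carrier G \<Longrightarrow> R g * B = B * (L * R g * B)" unfolding Q_def by blast
  have B: "B \<in> carrier_mat n m" and L: "L \<in> carrier_mat m n" and LB: "L * B = 1\<^sub>m m"
    and BW: "\<And>u. u \<in> carrier_vec m \<Longrightarrow> B *\<^sub>v u \<in> W" using fr unfolding frame_def by blast+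
  note Rc = rep_carrier[OF rep]
  define \<sigma> where "\<sigma> g = L * R g * B" for g
  have \<sigma>c: "\<sigma> g \<in> carrier_mat m m" if "g \<in> carrier G" for g
    using Rc[OF that] L B by (simp add: \<sigma>_def)
  have LRB: "\<sigma> g = L * (R g * B)" if "g \<in> carrier G" for g
    using assoc_mult_mat[OF L Rc[OF that] B] by (simp add: \<sigma>_def)
  have RB': "R g * B = B * \<sigma> g" if "g \<in> carrier G" for g using RB[OF that] by (simp add: \<sigma>_def)
  have rep\<sigma>: "is_rep G m \<sigma>"
  proof (rule is_repI)
    fix g h assume gh: "g \<in> carrier G" "h \<in> carrier G"
    have "\<sigma> (g \<otimes> h) = L * (R g * (R h * B))"
      using LRB[of "g \<otimes> h"] rep_mult[OF rep gh] gh assoc_mult_mat[OF Rc[OF gh(1)] Rc[OF gh(2)] B] by simp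
    also have "R g * (R h * B) = R g * B * \<sigma> h"
      unfolding RB'[OF gh(2)] using assoc_mult_mat[OF Rc[OF gh(1)] B \<sigma>c[OF gh(2)]] by simp
    also have "L * \<dots> = L * (R g * B) * \<sigma> h"
      using assoc_mult_mat[OF L mult_carrier_mat[OF Rc[OF gh(1)] B] \<sigma>c[OF gh(2)]] by simp
    finally show "\<sigma> (g \<otimes> h) = \<sigma> g * \<sigma> h" using LRB gh by simp
  next
    show "\<sigma> \<one> = 1\<^sub>m m" using L B LB by (simp add: \<sigma>_def rep_one[OF rep])
  qed (rule \<sigma>c)
  have "irreducible_rep G m \<sigma>"
    unfolding irreducible_rep_def
  proof (intro conjI allI impI rep\<sigma> m)
    fix U assume U: "VectorSpace.subspace class_ring U (module_vec TYPE(complex) m)"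
      and Uinv: "\<forall>g \<in> carrier G. \<forall>w \<in> U. \<sigma> g *\<^sub>v w \<in> U"
    \<comment> \<open>An invariant subspace \<open>U\<close> for \<open>\<sigma>\<close> is carried
      by \<open>B\<close> to an invariant subspace of \<open>W\<close> with frame
      \<open>B * B'\<close>, so the minimality of \<open>m\<close> leaves only the dimensions 0 and
      \<open>m\<close>.\<close>
    obtain m' B' L' where fr': "frame m U m' B' L'" and m'm: "m' \<le> m"
      and BL': "\<And>w. w \<in> U \<Longrightarrow> B' *\<^sub>v (L' *\<^sub>v w) = w"
      using subspace_frame[OF U] by blast
    have B': "B' \<in> carrier_mat m m'" and L': "L' \<in> carrier_mat m' m" and LB': "L' * B' = 1\<^sub>m m'"
      and BU: "\<And>u. u \<in> carrier_vec m' \<Longrightarrow> B' *\<^sub>v u \<in> U" using fr' unfolding frame_def by blast+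
    show "U = {0\<^sub>v m} \<or> U = carrier_vec m"
    proof (cases "m' = 0")
      case True
      have "w = 0\<^sub>v m" if w: "w \<in> U" for w
      proof -
        have "w = B' *\<^sub>v (L' *\<^sub>v w)" using BL' w by simp
        also have "\<dots> = 0\<^sub>v m" using B' L' True by (intro eq_vecI) (auto simp: scalar_prod_def)
        finally show ?thesis .
      qed
      thus ?thesis using U unfolding subspace_vec_iff by blast
    next
      case False
      have "R g * (B * B') = (B * B') * (L' * L * R g * (B * B'))" if g: "g \<in> carrier G" for g
      proof -
        have sB': "\<sigma> g * B' = B' * (L' * (\<sigma> g * B'))"
        proof (rule mat_eq_if_mult_vec_eq[of _ m m'])
          fix u :: "complex vec" assume u: "u \<in> carrier_vec m'"
          have sg: "\<sigma> g \<in> carrier_mat m m" using \<sigma>c g by blast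
          have 1: "\<sigma> g * B' *\<^sub>v u = \<sigma> g *\<^sub>v (B' *\<^sub>v u)" using assoc_mult_mat_vec[OF sg B' u] .
          have "\<sigma> g * B' *\<^sub>v u \<in> U" unfolding 1 using Uinv g BU u by blast
          from BL'[OF this] have "\<sigma> g * B' *\<^sub>v u = B' *\<^sub>v (L' *\<^sub>v (\<sigma> g * B' *\<^sub>v u))" by simp
          also have "\<dots> = B' *\<^sub>v (L' * (\<sigma> g * B') *\<^sub>v u)"
            using assoc_mult_mat_vec[of L' m' m "\<sigma> g * B'" m' u] L' sg B' u by simp
          also have "\<dots> = B' * (L' * (\<sigma> g * B')) *\<^sub>v u"
            using assoc_mult_mat_vec[of B' m m' "L' * (\<sigma> g * B')" m' u] L' sg B' u by simp
          finally show "\<sigma> g * B' *\<^sub>v u = B' * (L' * (\<sigma> g * B')) *\<^sub>v u" .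
        qed (use B' L' \<sigma>c[OF g] in auto)
        note cc = Rc[OF g] B L B' L' \<sigma>c[OF g]
        have "R g * (B * B') = R g * B * B'" using cc by (simp add: assoc_mult_mat[of _ n n])
        also have "\<dots> = B * (\<sigma> g * B')" using RB'[OF g] cc by (simp add: assoc_mult_mat[of _ n m])
        also have "\<dots> = B * B' * (L' * (\<sigma> g * B'))"
          by (subst sB') (rule assoc_mult_mat[symmetric, of _ n m _ m' _ m'], use cc in auto)
        also have "\<sigma> g * B' = L * (R g * B * B')"
          unfolding LRB[OF g] using cc by (intro assoc_mult_mat[of _ m n _ m _ m']) auto
        also have "R g * B * B' = R g * (B * B')" using cc by (simp add: assoc_mult_mat[of _ n n])
        also have "L' * (L * (R g * (B * B'))) = L' * L * (R g * (B * B'))"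
          using cc by (intro assoc_mult_mat[symmetric, of _ m' m _ n _ m']) auto
        also have "\<dots> = L' * L * R g * (B * B')"
          using cc by (intro assoc_mult_mat[symmetric, of _ m' n _ n _ m']) auto
        finally show ?thesis .
      qed
      moreover have "frame n W m' (B * B') (L' * L)"
        unfolding frame_def
      proof (intro conjI ballI)
        have "L' * L * (B * B') = L' * (L * (B * B'))"
          using L L' B B' by (intro assoc_mult_mat[of _ m' m _ n _ m']) auto
        also have "L * (B * B') = B'" using assoc_mult_mat[OF L B B'] LB B' by simp
        finally show "L' * L * (B * B') = 1\<^sub>m m'" using LB' by simp
        fix u :: "complex vec" assume u: "u \<in> carrier_vec m'"
        show "B * B' *\<^sub>v u \<in> W" using assoc_mult_mat_vec[OF B B' u] BW[of "B' *\<^sub>v u"] B' u by simp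
      qed (use L L' B B' in auto)
      ultimately have "Q m'" using False unfolding Q_def by blast
      hence "m' = m" using least m'm by fastforce
      \<comment> \<open>Now \<open>B'\<close> is square, so its left inverse is two-sided and
        \<open>U\<close> is the full space.\<close>
      hence "B' * L' = 1\<^sub>m m" using mat_mult_left_right_inverse[of L' m B'] B' L' LB' by simp
      have "w \<in> U" if "w \<in> carrier_vec m" for w
      proof -
        have "w = B' *\<^sub>v (L' *\<^sub>v w)"
          using \<open>B' * L' = 1\<^sub>m m\<close> assoc_mult_mat_vec[OF B' L' that] that by simp
        thus ?thesis using BU[of "L' *\<^sub>v w"] L' that by simp
      qed
      thus ?thesis using U unfolding subspace_vec_iff by blast
    qed
  qed
  from that[OF this fr RB'] show ?thesis .
qed

end

section \<open>Orthogonality relations\<close>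

context group
begin

section \<open>Characters and averages over the group\<close>

lemma bij_betw_mult_left: "g \<in> carrier G \<Longrightarrow> bij_betw (\<lambda>x. g \<otimes> x) (carrier G) (carrier G)"
  by (rule bij_betw_byWitness[where f' = "\<lambda>x. inv g \<otimes> x"]) (auto simp: m_assoc[symmetric])

lemma bij_betw_conj:
  "g \<in> carrier G \<Longrightarrow> bij_betw (\<lambda>x. g \<otimes> x \<otimes> inv g) (carrier G) (carrier G)"
  by (rule bij_betw_byWitness[where f' = "\<lambda>x. inv g \<otimes> x \<otimes> g"])
     (auto simp: m_assoc, auto simp: m_assoc[symmetric])

lemma rep_character_apply: "g \<in> carrier G \<Longrightarrow> rep_character G \<rho> g = mat_trace (\<rho> g)"
  by (simp add: rep_character_def)

lemma rep_character_one: "is_rep G n \<rho> \<Longrightarrow> rep_character G \<rho> \<one> = of_nat n"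
  by (simp add: rep_character_apply rep_one)

lemma rep_character_conj:
  assumes rep: "is_rep G n \<rho>" and "g \<in> carrier G" "x \<in> carrier G"
  shows "rep_character G \<rho> (g \<otimes> x \<otimes> inv g) = rep_character G \<rho> x"
proof -
  note c = rep_carrier[OF rep]
  have "rep_character G \<rho> (g \<otimes> x \<otimes> inv g) = mat_trace (\<rho> g * \<rho> x * \<rho> (inv g))"
    using assms by (simp add: rep_character_apply rep_mult[OF rep])
  also have "\<dots> = mat_trace (\<rho> (inv g) * (\<rho> g * \<rho> x))"
    using assms by (intro mat_trace_comm[of _ n n] mult_carrier_mat[of _ n n] c) auto
  also have "\<rho> (inv g) * (\<rho> g * \<rho> x) = \<rho> x"
    using assms c[of "inv g"] c[of g] c[of x] rep_inv[OF rep, of g]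
    by (simp add: assoc_mult_mat[symmetric, of _ n n _ n _ n])
  finally show ?thesis using assms by (simp add: rep_character_apply)
qed

text \<open>Each summand satisfies \<open>\<rho> g * F x = F (g \<otimes> x) * \<sigma> g\<close>,
  and left translation permutes the group.\<close>

lemma intertwiner_average:
  assumes rho: "is_rep G n \<rho>" and sigma: "is_rep G m \<sigma>" and A: "A \<in> carrier_mat n m"
    and g: "g \<in> carrier G"
  defines "T \<equiv> mat_sum n m (\<lambda>x. \<rho> x * A * \<sigma> (inv x)) (carrier G)"
  shows "\<rho> g * T = T * \<sigma> g"
proof -
  note c = rep_carrier[OF rho] rep_carrier[OF sigma]
  define F where "F x = \<rho> x * A * \<sigma> (inv x)" for x
  have F: "F x \<in> carrier_mat n m" if "x \<in> carrier G" for x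
    using that unfolding F_def by (intro mult_carrier_mat[of _ n m] mult_carrier_mat[of _ n n] A c) auto
  have "\<rho> g * F x = F (g \<otimes> x) * \<sigma> g" if x: "x \<in> carrier G" for x
  proof -
    note cc = c(1)[OF g] c(1)[OF x] A c(2)[OF inv_closed[OF x]] c(2)[OF inv_closed[OF g]] c(2)[OF g]
    have "F (g \<otimes> x) * \<sigma> g = (\<rho> g * \<rho> x) * A * (\<sigma> (inv x) * \<sigma> (inv g)) * \<sigma> g"
      using g x by (simp add: F_def inv_mult_group rep_mult[OF rho] rep_mult[OF sigma])
    also have "\<dots> = (\<rho> g * \<rho> x) * A * (\<sigma> (inv x) * \<sigma> (inv g) * \<sigma> g)"
      using cc by (intro assoc_mult_mat[of _ n m _ m _ m]) auto
    also have "\<sigma> (inv x) * \<sigma> (inv g) * \<sigma> g = \<sigma> (inv x) * (\<sigma> (inv g) * \<sigma> g)"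
      using cc by (intro assoc_mult_mat[of _ m m _ m _ m]) auto
    also have "\<dots> = \<sigma> (inv x)" using rep_inv[OF sigma g] cc by simp
    also have "\<rho> g * \<rho> x * A * \<sigma> (inv x) = \<rho> g * \<rho> x * (A * \<sigma> (inv x))"
      using cc by (intro assoc_mult_mat[of _ n n _ m _ m]) auto
    also have "\<dots> = \<rho> g * (\<rho> x * (A * \<sigma> (inv x)))"
      using cc by (intro assoc_mult_mat[of _ n n _ n _ m]) auto
    also have "\<rho> x * (A * \<sigma> (inv x)) = F x"
      unfolding F_def using cc by (intro assoc_mult_mat[symmetric, of _ n n _ m _ m]) auto
    finally show ?thesis by simp
  qed
  hence "mat_sum n m (\<lambda>x. \<rho> g * F x) (carrier G) = mat_sum n m (\<lambda>x. F (g \<otimes> x) * \<sigma> g) (carrier G)"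
    by (rule mat_sum_cong)
  hence "\<rho> g * T = mat_sum n m (\<lambda>x. F (g \<otimes> x) * \<sigma> g) (carrier G)"
    unfolding T_def F_def[symmetric] using mult_mat_sum[where S = "carrier G" and f = F, OF c(1)[OF g] F] by simp
  also have "\<dots> = mat_sum n m (\<lambda>x. F x * \<sigma> g) (carrier G)"
    by (rule mat_sum_reindex[OF bij_betw_mult_left[OF g], of n m "\<lambda>x. F x * \<sigma> g"])
  also have "\<dots> = T * \<sigma> g"
    unfolding T_def F_def[symmetric] using mat_sum_mult[where S = "carrier G" and f = F, OF c(2)[OF g] F] by simp
  finally show ?thesis .
qed

text \<open>By Schur's lemma the average is a scalar matrix. Every summand has the trace of
  \<open>A\<close>, and this determines the scalar.\<close>

lemma irreducible_average:
  assumes irr: "irreducible_rep G n \<rho>" and A: "A \<in> carrier_mat n n"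
  shows "mat_sum n n (\<lambda>x. \<rho> x * A * \<rho> (inv x)) (carrier G) =
    (of_nat (Coset.order G) * mat_trace A / of_nat n) \<cdot>\<^sub>m 1\<^sub>m n"
proof -
  have rep: "is_rep G n \<rho>" and n: "n > 0" using irr unfolding irreducible_rep_def by auto
  note rc = rep_carrier[OF rep]
  define T where "T = mat_sum n n (\<lambda>x. \<rho> x * A * \<rho> (inv x)) (carrier G)"
  obtain c where c: "T = c \<cdot>\<^sub>m 1\<^sub>m n"
    using schur_scalar[OF irr, of T] intertwiner_average[OF rep rep A] unfolding T_def by auto
  have "mat_trace T = (\<Sum>x\<in>carrier G. mat_trace (\<rho> x * A * \<rho> (inv x)))"
    unfolding T_def by (intro mat_trace_mat_sum mult_carrier_mat[of _ n n] A rc) auto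
  also have "\<dots> = (\<Sum>x\<in>carrier G. mat_trace A)"
  proof (intro sum.cong refl)
    fix x assume x: "x \<in> carrier G"
    note cc = rc[OF x] rc[OF inv_closed[OF x]] A
    have "mat_trace (\<rho> x * A * \<rho> (inv x)) = mat_trace (\<rho> (inv x) * (\<rho> x * A))"
      using cc by (intro mat_trace_comm[of _ n n]) auto
    also have "\<rho> (inv x) * (\<rho> x * A) = \<rho> (inv x) * \<rho> x * A"
      using cc by (intro assoc_mult_mat[symmetric, of _ n n _ n _ n]) auto
    finally show "mat_trace (\<rho> x * A * \<rho> (inv x)) = mat_trace A" using rep_inv[OF rep x] A by simp
  qed
  finally have "mat_trace T = of_nat (Coset.order G) * mat_trace A" by (simp add: Coset.order_def)
  moreover have "mat_trace T = c * of_nat n" unfolding c by (simp add: mat_trace_smult[of _ n])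
  ultimately have "c = of_nat (Coset.order G) * mat_trace A / of_nat n" using n by (simp add: field_simps)
  thus ?thesis using c unfolding T_def by simp
qed

text \<open>Averaging the matrix \<open>\<rho> g\<close> gives a scalar matrix; multiply it by
  \<open>\<rho> h\<close> and take the trace.\<close>

lemma irr_character_class_sum:
  assumes irr: "irreducible_rep G n \<rho>" and g: "g \<in> carrier G" and h: "h \<in> carrier G"
  shows "(\<Sum>x\<in>carrier G. rep_character G \<rho> (x \<otimes> g \<otimes> inv x \<otimes> h)) =
    of_nat (Coset.order G) / of_nat n * rep_character G \<rho> g * rep_character G \<rho> h"
proof -
  have rep: "is_rep G n \<rho>" using irr unfolding irreducible_rep_def by auto
  note rc = rep_carrier[OF rep]
  have "(\<Sum>x\<in>carrier G. rep_character G \<rho> (x \<otimes> g \<otimes> inv x \<otimes> h)) =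
      (\<Sum>x\<in>carrier G. mat_trace (\<rho> x * \<rho> g * \<rho> (inv x) * \<rho> h))"
    using g h by (intro sum.cong refl) (simp add: rep_character_apply rep_mult[OF rep])
  also have "\<dots> = mat_trace (mat_sum n n (\<lambda>x. \<rho> x * \<rho> g * \<rho> (inv x) * \<rho> h) (carrier G))"
    using rc g h by (intro mat_trace_mat_sum[symmetric] mult_carrier_mat[of _ n n]) auto
  also have "mat_sum n n (\<lambda>x. \<rho> x * \<rho> g * \<rho> (inv x) * \<rho> h) (carrier G) =
      mat_sum n n (\<lambda>x. \<rho> x * \<rho> g * \<rho> (inv x)) (carrier G) * \<rho> h"
    using rc g h by (intro mat_sum_mult[symmetric] mult_carrier_mat[of _ n n]) auto
  also have "\<dots> = (of_nat (Coset.order G) * mat_trace (\<rho> g) / of_nat n) \<cdot>\<^sub>m \<rho> h"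
    unfolding irreducible_average[OF irr rc[OF g]] using rc[OF h] by (simp add: mult_smult_assoc_mat[of _ n n _ n])
  also have "mat_trace \<dots> = of_nat (Coset.order G) / of_nat n * rep_character G \<rho> g * rep_character G \<rho> h"
    using rc[OF h] g h by (simp add: mat_trace_smult[of _ n] rep_character_apply)
  finally show ?thesis .
qed

text \<open>The average of a matrix unit intertwines the two representations and so vanishes; its
  entries are the sums in question.\<close>

lemma coefficient_orthogonality_neq:
  assumes irr: "irreducible_rep G n \<rho>" "irreducible_rep G m \<sigma>"
    and neq: "rep_character G \<rho> \<noteq> rep_character G \<sigma>"
    and "i < n" "a < n" "b < m" "j < m"
  shows "(\<Sum>x\<in>carrier G. \<rho> x $$ (i,a) * \<sigma> (inv x) $$ (b,j)) = 0"
proof -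
  have rep: "is_rep G n \<rho>" "is_rep G m \<sigma>" using irr unfolding irreducible_rep_def by auto
  define E :: "complex mat" where "E = mat n m (\<lambda>(k,l). if k = a \<and> l = b then 1 else 0)"
  have E: "E \<in> carrier_mat n m" by (simp add: E_def)
  define T where "T = mat_sum n m (\<lambda>x. \<rho> x * E * \<sigma> (inv x)) (carrier G)"
  have "T = 0\<^sub>m n m"
    using schur_zero[OF irr _ _ neq, of T] intertwiner_average[OF rep E] unfolding T_def by auto
  hence "T $$ (i,j) = 0" using assms by simp
  thus ?thesis using assms rep
    by (simp add: T_def E_def mult_elementary_index rep_carrier)
qed

text \<open>Here the average of a matrix unit is scalar, and the scalar is governed by the trace of
  the unit, which is 1 exactly on the diagonal.\<close>

lemma coefficient_orthogonality_eq:
  assumes irr: "irreducible_rep G n \<rho>"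
    and "i < n" "a < n" "b < n" "j < n"
  shows "(\<Sum>x\<in>carrier G. \<rho> x $$ (i,a) * \<rho> (inv x) $$ (b,j)) =
    (if a = b \<and> i = j then of_nat (Coset.order G) / of_nat n else 0)"
proof -
  have rep: "is_rep G n \<rho>" using irr unfolding irreducible_rep_def by auto
  define E :: "complex mat" where "E = mat n n (\<lambda>(k,l). if k = a \<and> l = b then 1 else 0)"
  have E: "E \<in> carrier_mat n n" by (simp add: E_def)
  have "mat_trace E = (\<Sum>k<n. if k = a then (if a = b then 1 else 0) else 0)"
    unfolding mat_trace_def by (intro sum.cong) (auto simp: E_def)
  hence tr: "mat_trace E = (if a = b then 1 else 0)" using assms by simp
  have "mat_sum n n (\<lambda>x. \<rho> x * E * \<rho> (inv x)) (carrier G) $$ (i,j) =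
      ((of_nat (Coset.order G) * mat_trace E / of_nat n) \<cdot>\<^sub>m 1\<^sub>m n) $$ (i,j)"
    by (simp only: irreducible_average[OF irr E])
  thus ?thesis using assms rep tr
    by (simp add: E_def mult_elementary_index rep_carrier split: if_splits)
qed

text \<open>Scaled by degree over group order, the sum is the action of the central idempotent
  \<open>e_\<chi>\<close>: it is one on irreducible representations with character
  \<open>\<chi>\<close> and zero on the other irreducible ones. The proof expands the character into
  diagonal coefficients.\<close>

lemma irreducible_class_sum:
  assumes irr: "irreducible_rep G n \<rho>" "irreducible_rep G m \<sigma>"
  shows "mat_sum m m (\<lambda>x. rep_character G \<rho> (inv x) \<cdot>\<^sub>m \<sigma> x) (carrier G) =
    (if rep_character G \<rho> = rep_character G \<sigma> then of_nat (Coset.order G) / of_nat m else 0) \<cdot>\<^sub>m 1\<^sub>m m"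
proof (rule eq_matI, goal_cases)
  case (1 i j)
  hence ij: "i < m" "j < m" by auto
  have rep: "is_rep G n \<rho>" "is_rep G m \<sigma>" using irr unfolding irreducible_rep_def by auto
  note rc = rep_carrier[OF rep(1)] rep_carrier[OF rep(2)]
  show ?case
  proof (cases "rep_character G \<rho> = rep_character G \<sigma>")
    case True
    \<comment> \<open>Only the character of \<open>\<rho>\<close> enters, so its diagonal
      coefficients may be replaced by those of \<open>\<sigma>\<close>.\<close>
    have "mat_sum m m (\<lambda>x. rep_character G \<rho> (inv x) \<cdot>\<^sub>m \<sigma> x) (carrier G) $$ (i,j) =
        (\<Sum>x\<in>carrier G. \<Sum>a<m. \<sigma> x $$ (i,j) * \<sigma> (inv x) $$ (a,a))"
      unfolding mat_sum_index[OF ij]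
    proof (intro sum.cong refl, goal_cases)
      case (1 x)
      thus ?case using ij True rc(2)[of x] rc(2)[of "inv x"]
        by (simp add: rep_character_apply mat_trace_def sum_distrib_left mult.commute)
    qed
    also have "\<dots> = (\<Sum>a<m. if j = a \<and> i = a then of_nat (Coset.order G) / of_nat m else 0)"
      by (subst sum.swap) (intro sum.cong refl, simp add: coefficient_orthogonality_eq[OF irr(2)] ij)
    also have "\<dots> = (\<Sum>a<m. if j = a then (if i = j then of_nat (Coset.order G) / of_nat m else 0) else 0)"
      by (intro sum.cong) auto
    also have "\<dots> = (if i = j then of_nat (Coset.order G) / of_nat m else 0)" using ij by simp
    finally show ?thesis using True ij by simp
  next
    case False
    have "mat_sum m m (\<lambda>x. rep_character G \<rho> (inv x) \<cdot>\<^sub>m \<sigma> x) (carrier G) $$ (i,j) =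
        (\<Sum>x\<in>carrier G. \<Sum>a<n. \<sigma> x $$ (i,j) * \<rho> (inv x) $$ (a,a))"
      unfolding mat_sum_index[OF ij]
    proof (intro sum.cong refl, goal_cases)
      case (1 x)
      thus ?case using ij rc(2)[of x] rc(1)[of "inv x"]
        by (simp add: rep_character_apply mat_trace_def sum_distrib_left mult.commute)
    qed
    also have "\<dots> = 0"
      using False by (subst sum.swap) (simp add: coefficient_orthogonality_neq[OF irr(2,1)] ij)
    finally show ?thesis using False ij by simp
  qed
qed auto

text \<open>The sum \<open>M\<close> of the matrices over \<open>Q\<close> absorbs each of them, so
  \<open>M\<close> divided by \<open>card Q\<close> is idempotent; its trace is the dimension of the
  space of vectors fixed by \<open>Q\<close>.\<close>

lemma subgroup_sum_Nat:
  assumes rep: "is_rep G n \<rho>" and fin: "finite (carrier G)" and Q: "subgroup Q G"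
  shows "\<exists>m::nat. (\<Sum>x\<in>Q. rep_character G \<rho> x) = of_nat (card Q * m)"
proof -
  note rc = rep_carrier[OF rep]
  have QG: "Q \<subseteq> carrier G" using Q by (rule subgroup.subset)
  have cQ: "card Q > 0" using fin Q QG by (metis card_gt_0_iff empty_iff finite_subset subgroup.one_closed)
  define M where "M = mat_sum n n \<rho> Q"
  have M: "M \<in> carrier_mat n n" by (simp add: M_def)
  have gM: "\<rho> g * M = M" if g: "g \<in> Q" for g
  proof -
    have gG: "g \<in> carrier G" using g QG by auto
    have "\<rho> g * M = mat_sum n n (\<lambda>x. \<rho> g * \<rho> x) Q"
      unfolding M_def using rc QG gG by (intro mult_mat_sum) auto
    also have "\<dots> = mat_sum n n (\<lambda>x. \<rho> (g \<otimes> x)) Q"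
      using QG gG by (intro mat_sum_cong) (auto simp: rep_mult[OF rep])
    also have "\<dots> = M" unfolding M_def
    proof (rule mat_sum_reindex)
      show "bij_betw (\<lambda>x. g \<otimes> x) Q Q"
        using g QG gG Q
        by (intro bij_betw_byWitness[where f' = "\<lambda>x. inv g \<otimes> x"])
           (auto simp: m_assoc[symmetric] subgroup.m_closed subgroup.m_inv_closed subsetD)
    qed
    finally show ?thesis .
  qed
  have "M * M = mat_sum n n (\<lambda>x. \<rho> x * M) Q"
    unfolding M_def[of] using rc QG by (intro mat_sum_mult) auto
  also have "\<dots> = of_nat (card Q) \<cdot>\<^sub>m M"
  proof (rule eq_matI, goal_cases)
    case (1 i j)
    thus ?case using gM by (simp add: M_def)
  qed (use M in auto)
  finally have MM: "M * M = of_nat (card Q) \<cdot>\<^sub>m M" .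
  define E where "E = (1 / of_nat (card Q)) \<cdot>\<^sub>m M"
  have E: "E \<in> carrier_mat n n" using M by (simp add: E_def)
  have "E * E = E"
  proof -
    have "E * E = (1 / of_nat (card Q)) \<cdot>\<^sub>m ((1 / of_nat (card Q)) \<cdot>\<^sub>m (M * M))"
      unfolding E_def using M by (simp add: mult_smult_assoc_mat[of _ n n _ n] mult_smult_distrib[of _ n n _ n])
    also have "\<dots> = E" unfolding MM E_def using cQ M by (intro eq_matI) auto
    finally show ?thesis .
  qed
  then obtain m where m: "mat_trace E = of_nat m" using idempotent_trace_Nat[OF E] by blast
  have "(\<Sum>x\<in>Q. rep_character G \<rho> x) = (\<Sum>x\<in>Q. mat_trace (\<rho> x))"
    using QG by (intro sum.cong) (auto simp: rep_character_apply)
  also have "\<dots> = mat_trace M" unfolding M_def using QG rc by (intro mat_trace_mat_sum[symmetric]) auto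
  also have "\<dots> = of_nat (card Q) * mat_trace E"
    using cQ M by (simp add: E_def mat_trace_smult[of _ n])
  finally show ?thesis using m by auto
qed

section \<open>The regular representation\<close>

lemma mult_inv_eq_one:
  assumes "x \<in> carrier G" "h \<in> carrier G"
  shows "x \<otimes> inv h = \<one> \<longleftrightarrow> x = h"
proof
  assume "x \<otimes> inv h = \<one>"
  hence "inv (inv h) = x" using assms by (intro inv_equality) auto
  thus "x = h" using assms by simp
qed (use assms in auto)

lemma conj_eq_one:
  assumes "h \<in> carrier G" "x \<in> carrier G"
  shows "h \<otimes> x \<otimes> inv h = \<one> \<longleftrightarrow> x = \<one>"
  using mult_inv_eq_one[of "h \<otimes> x" h] assms by simp

text \<open>Read \<open>z\<close> as an element of the group algebra: it is central, idempotent for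
  convolution, and acts as zero in every irreducible representation. In the regular representation
  the vectors it fixes form an invariant subspace. Were this nonzero, it would contain an
  irreducible subrepresentation on which \<open>z\<close> acts both as one and as zero.\<close>

lemma regular_rep_annihilated:
  fixes z :: "'a \<Rightarrow> complex"
  assumes fin: "finite (carrier G)"
    and class_fun: "\<And>g x. g \<in> carrier G \<Longrightarrow> x \<in> carrier G \<Longrightarrow> z (g \<otimes> x \<otimes> inv g) = z x"
    and idem: "\<And>h. h \<in> carrier G \<Longrightarrow> (\<Sum>x\<in>carrier G. z x * z (inv x \<otimes> h)) = z h"
    and kills: "\<And>m \<sigma>. irreducible_rep G m \<sigma> \<Longrightarrow> mat_sum m m (\<lambda>x. z x \<cdot>\<^sub>m \<sigma> x) (carrier G) = 0\<^sub>m m m"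
    and g: "g \<in> carrier G"
  shows "z g = 0"
proof (rule ccontr)
  assume zg: "z g \<noteq> 0"
  define n where "n = card (carrier G)"
  obtain e where e: "bij_betw e {..<n} (carrier G)"
    using ex_bij_betw_nat_finite[OF fin] by (auto simp: n_def lessThan_atLeast0)
  have eG: "e i \<in> carrier G" if "i < n" for i using e that by (auto dest: bij_betwE)
  have e_inj: "e i = e j \<longleftrightarrow> i = j" if "i < n" "j < n" for i j
    using e that by (auto simp: bij_betw_def inj_on_def)
  \<comment> \<open>Permutation matrices of left multiplication, the group being enumerated by
    \<open>e\<close>.\<close>
  define R where "R x = mat n n (\<lambda>(i,j). if x \<otimes> e j = e i then 1 else 0 :: complex)" for x
  have R: "R x \<in> carrier_mat n n" for x by (simp add: R_def)
  have R_sum: "(\<Sum>j<n. R x $$ (i,j) * f (e j)) = f (inv x \<otimes> e i)"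
    if x: "x \<in> carrier G" and i: "i < n" for x i and f :: "'a \<Rightarrow> complex"
  proof -
    have "(\<Sum>j<n. R x $$ (i,j) * f (e j)) = (\<Sum>j<n. if e j = inv x \<otimes> e i then f (e j) else 0)"
    proof (intro sum.cong refl)
      fix j assume "j \<in> {..<n}"
      hence j: "j < n" by simp
      have "x \<otimes> e j = e i \<longleftrightarrow> e j = inv x \<otimes> e i"
        unfolding inv_solve_left[OF eG[OF j] x eG[OF i]] by (rule eq_commute)
      thus "R x $$ (i,j) * f (e j) = (if e j = inv x \<otimes> e i then f (e j) else 0)"
        using i j by (simp add: R_def)
    qed
    also have "\<dots> = (\<Sum>y\<in>carrier G. if y = inv x \<otimes> e i then f y else 0)"
      by (rule sum.reindex_bij_betw[OF e, of "\<lambda>y. if y = inv x \<otimes> e i then f y else 0"])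
    also have "\<dots> = f (inv x \<otimes> e i)" using fin x eG[OF i] by simp
    finally show ?thesis .
  qed
  have rep: "is_rep G n R"
  proof (rule is_repI)
    fix x y assume xy: "x \<in> carrier G" "y \<in> carrier G"
    show "R (x \<otimes> y) = R x * R y"
    proof (rule eq_matI)
      fix i j assume "i < dim_row (R x * R y)" "j < dim_col (R x * R y)"
      hence ij: "i < n" "j < n" by (auto simp: R_def)
      have "(R x * R y) $$ (i,j) = (\<Sum>k<n. R x $$ (i,k) * (if y \<otimes> e j = e k then 1 else 0))"
        unfolding mult_mat_index[OF R R ij] by (intro sum.cong) (auto simp: R_def ij)
      also have "\<dots> = (if y \<otimes> e j = inv x \<otimes> e i then 1 else 0)"
        using R_sum[OF xy(1) ij(1), of "\<lambda>u. if y \<otimes> e j = u then 1 else 0"] by simp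
      also have "\<dots> = R (x \<otimes> y) $$ (i,j)"
        using ij xy eG[OF ij(1)] eG[OF ij(2)] by (simp add: R_def m_assoc inv_solve_left)
      finally show "R (x \<otimes> y) $$ (i,j) = (R x * R y) $$ (i,j)" by simp
    qed (auto simp: R_def)
  next
    show "R \<one> = 1\<^sub>m n" by (intro eq_matI) (auto simp: R_def eG e_inj)
  qed (rule R)
  define Z where "Z = mat_sum n n (\<lambda>x. z x \<cdot>\<^sub>m R x) (carrier G)"
  have Z: "Z \<in> carrier_mat n n" by (simp add: Z_def)
  \<comment> \<open>Since \<open>z\<close> is a class function, conjugating the summation variable
    moves \<open>R h\<close> across \<open>Z\<close>.\<close>
  have ZR: "R h * Z = Z * R h" if h: "h \<in> carrier G" for h
  proof -
    have "R h * Z = mat_sum n n (\<lambda>x. R h * (z x \<cdot>\<^sub>m R x)) (carrier G)"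
      unfolding Z_def using R by (intro mult_mat_sum) auto
    also have "\<dots> = mat_sum n n (\<lambda>x. z (h \<otimes> x \<otimes> inv h) \<cdot>\<^sub>m R (h \<otimes> x \<otimes> inv h) * R h) (carrier G)"
    proof (rule mat_sum_cong)
      fix x assume x: "x \<in> carrier G"
      have "R (h \<otimes> x \<otimes> inv h) * R h = R h * R x"
        using h x rep_mult[OF rep, of "h \<otimes> x \<otimes> inv h" h] rep_mult[OF rep, of h x]
        by (simp add: m_assoc)
      thus "R h * (z x \<cdot>\<^sub>m R x) = z (h \<otimes> x \<otimes> inv h) \<cdot>\<^sub>m R (h \<otimes> x \<otimes> inv h) * R h"
        using class_fun[OF h x] by (simp add: mult_smult_distrib[OF R R] mult_smult_assoc_mat[OF R R])
    qed
    also have "\<dots> = mat_sum n n (\<lambda>x. z x \<cdot>\<^sub>m R x * R h) (carrier G)"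
      by (rule mat_sum_reindex[OF bij_betw_conj[OF h], of n n "\<lambda>x. z x \<cdot>\<^sub>m R x * R h"])
    also have "\<dots> = Z * R h" unfolding Z_def using R by (intro mat_sum_mult[symmetric]) auto
    finally show ?thesis .
  qed
  \<comment> \<open>This is \<open>z\<close> itself as a vector of the group algebra.
    \<open>Z\<close> sends it to the convolution square of \<open>z\<close>, so it is a fixed
    vector, and it is nonzero because of its coordinate at \<open>g\<close>.\<close>
  define \<zeta> where "\<zeta> = vec n (\<lambda>i. z (e i))"
  have \<zeta>: "\<zeta> \<in> carrier_vec n" by (simp add: \<zeta>_def)
  have Z\<zeta>: "Z *\<^sub>v \<zeta> = \<zeta>"
  proof (rule eq_vecI)
    fix i assume "i < dim_vec \<zeta>"
    hence i: "i < n" by (simp add: \<zeta>_def)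
    have "(Z *\<^sub>v \<zeta>) $ i = (\<Sum>j<n. \<Sum>x\<in>carrier G. z x * R x $$ (i,j) * z (e j))"
      using i Z \<zeta> by (simp add: scalar_prod_def Z_def \<zeta>_def R_def sum_distrib_right lessThan_atLeast0)
    also have "\<dots> = (\<Sum>x\<in>carrier G. z x * (\<Sum>j<n. R x $$ (i,j) * z (e j)))"
      by (subst sum.swap) (simp add: sum_distrib_left mult.assoc)
    also have "\<dots> = (\<Sum>x\<in>carrier G. z x * z (inv x \<otimes> e i))"
      using R_sum i by (intro sum.cong) auto
    also have "\<dots> = z (e i)" using idem eG i by simp
    finally show "(Z *\<^sub>v \<zeta>) $ i = \<zeta> $ i" using i by (simp add: \<zeta>_def)
  qed (use Z in \<open>auto simp: \<zeta>_def\<close>)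
  define W where "W = {w \<in> carrier_vec n. Z *\<^sub>v w = w}"
  have sub: "VectorSpace.subspace class_ring W (module_vec TYPE(complex) n)"
    unfolding subspace_vec_iff W_def using Z
    by (auto simp: mult_add_distrib_mat_vec[OF Z] mult_mat_vec[OF Z])
  have inv: "R h *\<^sub>v w \<in> W" if h: "h \<in> carrier G" and w: "w \<in> W" for h w
  proof -
    have w: "w \<in> carrier_vec n" "Z *\<^sub>v w = w" using w by (auto simp: W_def)
    have "Z *\<^sub>v (R h *\<^sub>v w) = R h *\<^sub>v w"
      using assoc_mult_mat_vec[OF Z R w(1), of h] assoc_mult_mat_vec[OF R Z w(1), of h] ZR[OF h] w(2) by simp
    thus ?thesis using w R[of h] by (simp add: W_def)
  qed
  have W0: "W \<noteq> {0\<^sub>v n}"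
  proof
    assume W0: "W = {0\<^sub>v n}"
    obtain i where i: "i < n" "e i = g" using e g bij_betw_imp_surj_on[OF e] by (metis imageE lessThan_iff)
    have "\<zeta> \<in> W" using \<zeta> Z\<zeta> by (simp add: W_def)
    hence "\<zeta> $ i = 0" using W0 i by simp
    thus False using zg i by (simp add: \<zeta>_def)
  qed
  obtain m \<sigma> B L where irr: "irreducible_rep G m \<sigma>" and fr: "frame n W m B L"
    and RB: "\<And>g. g \<in> carrier G \<Longrightarrow> R g * B = B * \<sigma> g"
    using subrep_irreducible[OF rep sub inv W0] by blast
  have B: "B \<in> carrier_mat n m" and L: "L \<in> carrier_mat m n" and LB: "L * B = 1\<^sub>m m"
    and BW: "\<And>u. u \<in> carrier_vec m \<Longrightarrow> B *\<^sub>v u \<in> W" using fr unfolding frame_def by blast+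
  have m: "m > 0" and rep': "is_rep G m \<sigma>" using irr unfolding irreducible_rep_def by auto
  have ZB: "Z * B = B"
  proof (rule mat_eq_if_mult_vec_eq[of _ n m])
    fix u :: "complex vec" assume u: "u \<in> carrier_vec m"
    show "Z * B *\<^sub>v u = B *\<^sub>v u" using BW[OF u] assoc_mult_mat_vec[OF Z B u] by (simp add: W_def)
  qed (use Z B in auto)
  \<comment> \<open>The columns of \<open>B\<close> are fixed by \<open>Z\<close>, yet
    \<open>Z\<close> acts on them through \<open>\<sigma>\<close>, where \<open>kills\<close> makes
    it zero.\<close>
  have "Z * B = 0\<^sub>m n m"
  proof -
    have "Z * B = mat_sum n m (\<lambda>x. z x \<cdot>\<^sub>m R x * B) (carrier G)"
      unfolding Z_def using R B by (intro mat_sum_mult) auto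
    also have "\<dots> = mat_sum n m (\<lambda>x. B * (z x \<cdot>\<^sub>m \<sigma> x)) (carrier G)"
    proof (rule mat_sum_cong)
      fix x assume x: "x \<in> carrier G"
      have "z x \<cdot>\<^sub>m R x * B = z x \<cdot>\<^sub>m (R x * B)" by (rule mult_smult_assoc_mat[OF R B])
      also have "\<dots> = B * (z x \<cdot>\<^sub>m \<sigma> x)"
        unfolding RB[OF x] by (rule mult_smult_distrib[symmetric, OF B rep_carrier[OF rep' x]])
      finally show "z x \<cdot>\<^sub>m R x * B = B * (z x \<cdot>\<^sub>m \<sigma> x)" .
    qed
    also have "\<dots> = B * mat_sum m m (\<lambda>x. z x \<cdot>\<^sub>m \<sigma> x) (carrier G)"
      by (rule mult_mat_sum[symmetric, OF B]) (simp add: rep_carrier[OF rep'])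
    also have "\<dots> = 0\<^sub>m n m" unfolding kills[OF irr] using B by simp
    finally show ?thesis .
  qed
  with ZB[symmetric] have B0: "B = 0\<^sub>m n m" by (rule trans)
  have "L * B = 0\<^sub>m m m" unfolding B0 using L by simp
  with LB[symmetric] have "1\<^sub>m m = (0\<^sub>m m m :: complex mat)" by (rule trans)
  hence "(1\<^sub>m m :: complex mat) $$ (0,0) = 0\<^sub>m m m $$ (0,0)" by simp
  thus False using m by simp
qed

section \<open>Irreducible characters and column orthogonality\<close>

lemma Irr_obtain_rep:
  assumes "\<chi> \<in> Irr G"
  obtains n \<rho> where "irreducible_rep G n \<rho>" "is_rep G n \<rho>" "n > 0" "\<chi> = rep_character G \<rho>"
    "\<chi> \<one> = of_nat n"
proof -
  obtain n \<rho> where 1: "irreducible_rep G n \<rho>" "\<chi> = rep_character G \<rho>"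
    using assms unfolding Irr_def by auto
  moreover from 1 have 2: "is_rep G n \<rho>" "n > 0" unfolding irreducible_rep_def by auto
  ultimately show ?thesis using rep_character_one[OF 2(1)] by (intro that[of n \<rho>]) simp_all
qed

lemma Irr_degree:
  assumes "\<chi> \<in> Irr G"
  obtains n :: nat where "\<chi> \<one> = of_nat n" "n > 0"
  by (rule Irr_obtain_rep[OF assms]) (rule that)

lemma Irr_conj:
  assumes "\<chi> \<in> Irr G" "g \<in> carrier G" "x \<in> carrier G"
  shows "\<chi> (g \<otimes> x \<otimes> inv g) = \<chi> x"
proof -
  obtain n \<rho> where \<rho>: "irreducible_rep G n \<rho>" "is_rep G n \<rho>" "\<chi> = rep_character G \<rho>" "\<chi> \<one> = of_nat n"
    by (rule Irr_obtain_rep[OF assms(1)])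
  show ?thesis
    using rep_character_conj[OF \<rho>(2) assms(2,3)] \<rho>(3,4) by simp
qed

lemma Irr_class_sum:
  assumes "\<chi> \<in> Irr G" "g \<in> carrier G" "h \<in> carrier G"
  shows "(\<Sum>x\<in>carrier G. \<chi> (x \<otimes> g \<otimes> inv x \<otimes> h)) = of_nat (Coset.order G) / \<chi> \<one> * \<chi> g * \<chi> h"
proof -
  obtain n \<rho> where \<rho>: "irreducible_rep G n \<rho>" "is_rep G n \<rho>" "\<chi> = rep_character G \<rho>" "\<chi> \<one> = of_nat n"
    by (rule Irr_obtain_rep[OF assms(1)])
  show ?thesis
    using irr_character_class_sum[OF \<rho>(1) assms(2,3)] \<rho>(3,4) by simp
qed

lemma Irr_subgroup_sum:
  assumes "\<chi> \<in> Irr G" "finite (carrier G)" "subgroup Q G"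
  shows "\<exists>m::nat. (\<Sum>x\<in>Q. \<chi> x) = of_nat (card Q * m)"
proof -
  obtain n \<rho> where \<rho>: "irreducible_rep G n \<rho>" "is_rep G n \<rho>" "\<chi> = rep_character G \<rho>" "\<chi> \<one> = of_nat n"
    by (rule Irr_obtain_rep[OF assms(1)])
  show ?thesis
    using subgroup_sum_Nat[OF \<rho>(2) assms(2,3)] \<rho>(3,4) by simp
qed

text \<open>This is the decomposition of the regular character. The element
  \<open>z = 1 - \<Sum> e_\<chi>\<close> of the group algebra is a central idempotent killed by
  every irreducible representation, hence zero; its coefficient at \<open>inv g\<close> gives the
  claim.\<close>

lemma Irr_regular:
  assumes fin: "finite (carrier G)" and finI: "finite (Irr G)" and g: "g \<in> carrier G"
  shows "(\<Sum>\<chi>\<in>Irr G. \<chi> \<one> * \<chi> g) = (if g = \<one> then of_nat (Coset.order G) else 0)"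
proof -
  define z where "z h = (if h = \<one> then 1 else 0) -
    (\<Sum>\<chi>\<in>Irr G. \<chi> \<one> / of_nat (Coset.order G) * \<chi> (inv h))" for h
  have N: "Coset.order G > 0" using order_gt_0_iff_finite fin by auto
  \<comment> \<open>By \<open>irreducible_class_sum\<close> exactly one of the
    \<open>e_\<chi>\<close> acts as the identity on \<open>\<sigma>\<close> and cancels the 1; the
    others act as zero.\<close>
  have kills: "mat_sum m m (\<lambda>x. z x \<cdot>\<^sub>m \<sigma> x) (carrier G) = 0\<^sub>m m m" if irr: "irreducible_rep G m \<sigma>" for m \<sigma>
  proof (rule eq_matI)
    fix i j assume "i < dim_row (0\<^sub>m m m :: complex mat)" "j < dim_col (0\<^sub>m m m :: complex mat)"
    hence ij: "i < m" "j < m" by auto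
    define \<psi> where "\<psi> = rep_character G \<sigma>"
    have \<psi>: "\<psi> \<in> Irr G" using irr unfolding \<psi>_def Irr_def by auto
    have rep: "is_rep G m \<sigma>" and m: "m > 0" using irr unfolding irreducible_rep_def by auto
    note rc = rep_carrier[OF rep]
    have I: "(\<Sum>x\<in>carrier G. \<chi> (inv x) * \<sigma> x $$ (i,j)) =
        (if \<chi> = \<psi> then of_nat (Coset.order G) / of_nat m * 1\<^sub>m m $$ (i,j) else 0)" if \<chi>: "\<chi> \<in> Irr G" for \<chi>
    proof -
      obtain n \<rho> where \<rho>: "irreducible_rep G n \<rho>" "\<chi> = rep_character G \<rho>" by (rule Irr_obtain_rep[OF \<chi>])
      have "mat_sum m m (\<lambda>x. rep_character G \<rho> (inv x) \<cdot>\<^sub>m \<sigma> x) (carrier G) $$ (i,j) =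
        ((if rep_character G \<rho> = rep_character G \<sigma> then of_nat (Coset.order G) / of_nat m else 0) \<cdot>\<^sub>m 1\<^sub>m m) $$ (i,j)"
        by (simp only: irreducible_class_sum[OF \<rho>(1) irr])
      moreover have "mat_sum m m (\<lambda>x. rep_character G \<rho> (inv x) \<cdot>\<^sub>m \<sigma> x) (carrier G) $$ (i,j) =
          (\<Sum>x\<in>carrier G. \<chi> (inv x) * \<sigma> x $$ (i,j))"
        unfolding mat_sum_index[OF ij] \<rho>(2) using rc ij by (intro sum.cong) (auto dest!: rc)
      ultimately show ?thesis using ij by (simp add: \<rho>(2) \<psi>_def)
    qed
    have "mat_sum m m (\<lambda>x. z x \<cdot>\<^sub>m \<sigma> x) (carrier G) $$ (i,j) = (\<Sum>x\<in>carrier G. z x * \<sigma> x $$ (i,j))"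
      unfolding mat_sum_index[OF ij] using rc ij by (intro sum.cong) (auto dest!: rc)
    also have "\<dots> = (\<Sum>x\<in>carrier G. (if x = \<one> then \<sigma> x $$ (i,j) else 0) -
        (\<Sum>\<chi>\<in>Irr G. \<chi> \<one> / of_nat (Coset.order G) * (\<chi> (inv x) * \<sigma> x $$ (i,j))))"
      by (intro sum.cong) (auto simp: z_def left_diff_distrib sum_distrib_right mult.assoc)
    also have "\<dots> = \<sigma> \<one> $$ (i,j) -
        (\<Sum>\<chi>\<in>Irr G. \<chi> \<one> / of_nat (Coset.order G) * (\<Sum>x\<in>carrier G. \<chi> (inv x) * \<sigma> x $$ (i,j)))"
      unfolding sum_subtractf using fin by (subst sum.swap) (simp add: sum_distrib_left)
    also have "\<dots> = 1\<^sub>m m $$ (i,j) - (\<Sum>\<chi>\<in>Irr G. if \<chi> = \<psi> then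
        \<chi> \<one> / of_nat (Coset.order G) * (of_nat (Coset.order G) / of_nat m * 1\<^sub>m m $$ (i,j)) else 0)"
      using I rep_one[OF rep] by (intro arg_cong2[where f = minus] sum.cong) auto
    also have "\<dots> = 1\<^sub>m m $$ (i,j) -
        \<psi> \<one> / of_nat (Coset.order G) * (of_nat (Coset.order G) / of_nat m * 1\<^sub>m m $$ (i,j))"
      using finI \<psi> by simp
    also have "\<psi> \<one> = of_nat m" unfolding \<psi>_def by (rule rep_character_one[OF rep])
    finally show "mat_sum m m (\<lambda>x. z x \<cdot>\<^sub>m \<sigma> x) (carrier G) $$ (i,j) = 0\<^sub>m m m $$ (i,j)"
      using ij m N by simp
  qed auto
  \<comment> \<open>Up to a factor these are the coefficients of the product of \<open>z\<close> and
    \<open>e_\<chi>\<close>. They are traces of products with the zero matrix from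
    \<open>kills\<close>, and their vanishing makes \<open>z\<close> idempotent.\<close>
  have tr: "(\<Sum>x\<in>carrier G. z x * \<chi> (inv h \<otimes> x)) = 0" if \<chi>: "\<chi> \<in> Irr G" and h: "h \<in> carrier G" for \<chi> h
  proof -
    obtain n \<rho> where \<rho>: "irreducible_rep G n \<rho>" "is_rep G n \<rho>" "\<chi> = rep_character G \<rho>"
      by (rule Irr_obtain_rep[OF \<chi>])
    note rc = rep_carrier[OF \<rho>(2)]
    have "(\<Sum>x\<in>carrier G. z x * \<chi> (inv h \<otimes> x)) = (\<Sum>x\<in>carrier G. mat_trace (\<rho> (inv h) * (z x \<cdot>\<^sub>m \<rho> x)))"
    proof (intro sum.cong refl)
      fix x assume x: "x \<in> carrier G"
      have "\<rho> (inv h) * (z x \<cdot>\<^sub>m \<rho> x) = z x \<cdot>\<^sub>m (\<rho> (inv h) * \<rho> x)"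
        using rc h x by (intro mult_smult_distrib[of _ n n _ n]) auto
      moreover have "\<rho> (inv h) * \<rho> x \<in> carrier_mat n n"
        using rc[of "inv h"] rc[of x] h x by auto
      ultimately show "z x * \<chi> (inv h \<otimes> x) = mat_trace (\<rho> (inv h) * (z x \<cdot>\<^sub>m \<rho> x))"
        using h x by (simp add: \<rho>(3) rep_character_apply rep_mult[OF \<rho>(2)] mat_trace_smult[of _ n])
    qed
    also have "\<dots> = mat_trace (mat_sum n n (\<lambda>x. \<rho> (inv h) * (z x \<cdot>\<^sub>m \<rho> x)) (carrier G))"
      using rc h by (intro mat_trace_mat_sum[symmetric] mult_carrier_mat[of _ n n] smult_carrier_mat) auto
    also have "mat_sum n n (\<lambda>x. \<rho> (inv h) * (z x \<cdot>\<^sub>m \<rho> x)) (carrier G) =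
        \<rho> (inv h) * mat_sum n n (\<lambda>x. z x \<cdot>\<^sub>m \<rho> x) (carrier G)"
      using rc h by (intro mult_mat_sum[symmetric] smult_carrier_mat) auto
    also have "\<dots> = 0\<^sub>m n n" unfolding kills[OF \<rho>(1)] using rc[of "inv h"] h by simp
    finally show ?thesis by (simp add: mat_trace_def)
  qed
  have "z (inv g) = 0"
  proof (rule regular_rep_annihilated[OF fin _ _ kills])
    fix h x assume hx: "h \<in> carrier G" "x \<in> carrier G"
    have "inv (h \<otimes> x \<otimes> inv h) = h \<otimes> inv x \<otimes> inv h" using hx by (simp add: inv_mult_group m_assoc)
    hence "(\<Sum>\<chi>\<in>Irr G. \<chi> \<one> / of_nat (Coset.order G) * \<chi> (inv (h \<otimes> x \<otimes> inv h))) =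
        (\<Sum>\<chi>\<in>Irr G. \<chi> \<one> / of_nat (Coset.order G) * \<chi> (inv x))"
      using hx Irr_conj[of _ h "inv x"] by (intro sum.cong) auto
    thus "z (h \<otimes> x \<otimes> inv h) = z x" using conj_eq_one[OF hx] by (simp add: z_def)
  next
    fix h assume h: "h \<in> carrier G"
    have "(\<Sum>x\<in>carrier G. z x * z (inv x \<otimes> h)) = (\<Sum>x\<in>carrier G. (if x = h then z x else 0) -
        (\<Sum>\<chi>\<in>Irr G. \<chi> \<one> / of_nat (Coset.order G) * (z x * \<chi> (inv h \<otimes> x))))"
    proof (intro sum.cong refl)
      fix x assume x: "x \<in> carrier G"
      have "inv x \<otimes> h = \<one> \<longleftrightarrow> x = h" using x h mult_inv_eq_one[of "inv x" "inv h"] by (metis inv_closed inv_inv)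
      moreover have "inv (inv x \<otimes> h) = inv h \<otimes> x" using x h by (simp add: inv_mult_group)
      ultimately show "z x * z (inv x \<otimes> h) = (if x = h then z x else 0) -
          (\<Sum>\<chi>\<in>Irr G. \<chi> \<one> / of_nat (Coset.order G) * (z x * \<chi> (inv h \<otimes> x)))"
        unfolding z_def[of "inv x \<otimes> h"] by (auto simp: right_diff_distrib sum_distrib_left mult_ac)
    qed
    also have "\<dots> = z h - (\<Sum>\<chi>\<in>Irr G. \<chi> \<one> / of_nat (Coset.order G) * (\<Sum>x\<in>carrier G. z x * \<chi> (inv h \<otimes> x)))"
      unfolding sum_subtractf using fin h by (subst sum.swap) (simp add: sum_distrib_left)
    also have "\<dots> = z h" using tr h by simp
    finally show "(\<Sum>x\<in>carrier G. z x * z (inv x \<otimes> h)) = z h" .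
  qed (use g in auto)
  hence "(\<Sum>\<chi>\<in>Irr G. \<chi> \<one> * \<chi> g) / of_nat (Coset.order G) = (if g = \<one> then 1 else 0)"
    using g by (simp add: z_def sum_divide_distrib)
  thus ?thesis using N by (simp add: field_simps split: if_splits)
qed

text \<open>The class sum formula rewrites each product of values as a sum over the group. After
  exchanging the sums, \<open>Irr_regular\<close> retains exactly those \<open>x\<close> that
  conjugate \<open>g\<close> to \<open>h\<close>.\<close>

lemma Irr_column_orthogonality:
  assumes fin: "finite (carrier G)" and finI: "finite (Irr G)"
    and g: "g \<in> carrier G" and h: "h \<in> carrier G"
  shows "(\<Sum>\<chi>\<in>Irr G. \<chi> g * \<chi> (inv h)) = of_nat (card {x \<in> carrier G. x \<otimes> g \<otimes> inv x = h})"
proof -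
  have N: "Coset.order G > 0" using order_gt_0_iff_finite fin by auto
  have "(\<Sum>\<chi>\<in>Irr G. \<chi> g * \<chi> (inv h)) =
      (\<Sum>\<chi>\<in>Irr G. \<Sum>x\<in>carrier G. \<chi> \<one> * \<chi> (x \<otimes> g \<otimes> inv x \<otimes> inv h) / of_nat (Coset.order G))"
  proof (intro sum.cong refl)
    fix \<chi> assume \<chi>: "\<chi> \<in> Irr G"
    have "\<chi> \<one> \<noteq> 0" by (rule Irr_degree[OF \<chi>]) simp
    have "(\<Sum>x\<in>carrier G. \<chi> \<one> * \<chi> (x \<otimes> g \<otimes> inv x \<otimes> inv h) / of_nat (Coset.order G)) =
        \<chi> \<one> * (\<Sum>x\<in>carrier G. \<chi> (x \<otimes> g \<otimes> inv x \<otimes> inv h)) / of_nat (Coset.order G)"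
      by (simp add: sum_distrib_left sum_divide_distrib)
    thus "\<chi> g * \<chi> (inv h) = (\<Sum>x\<in>carrier G. \<chi> \<one> * \<chi> (x \<otimes> g \<otimes> inv x \<otimes> inv h) / of_nat (Coset.order G))"
      using Irr_class_sum[OF \<chi> g, of "inv h"] h N \<open>\<chi> \<one> \<noteq> 0\<close> by simp
  qed
  also have "\<dots> = (\<Sum>x\<in>carrier G. (\<Sum>\<chi>\<in>Irr G. \<chi> \<one> * \<chi> (x \<otimes> g \<otimes> inv x \<otimes> inv h)) / of_nat (Coset.order G))"
    by (subst sum.swap) (simp add: sum_divide_distrib)
  also have "\<dots> = (\<Sum>x\<in>carrier G. if x \<otimes> g \<otimes> inv x = h then 1 else 0)"
  proof (intro sum.cong refl)
    fix x assume x: "x \<in> carrier G"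
    have "x \<otimes> g \<otimes> inv x \<otimes> inv h = \<one> \<longleftrightarrow> x \<otimes> g \<otimes> inv x = h"
      using x g h by (intro mult_inv_eq_one) auto
    thus "(\<Sum>\<chi>\<in>Irr G. \<chi> \<one> * \<chi> (x \<otimes> g \<otimes> inv x \<otimes> inv h)) / of_nat (Coset.order G) =
        (if x \<otimes> g \<otimes> inv x = h then 1 else 0)"
      using x g h N by (subst Irr_regular[OF fin finI]) auto
  qed
  also have "\<dots> = of_nat (card {x \<in> carrier G. x \<otimes> g \<otimes> inv x = h})"
    by (simp add: sum.inter_filter[OF fin, symmetric])
  finally show ?thesis .
qed

end

section \<open>Conjugation and p-groups\<close>

lemma prime_power_of_prime_divisors:
  fixes n :: nat
  assumes "prime p" "n > 0" and "\<And>q. prime q \<Longrightarrow> q dvd n \<Longrightarrow> q = p"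
  shows "\<exists>k. n = p ^ k"
proof (rule ccontr)
  assume "\<not> (\<exists>k. n = p ^ k)"
  hence "\<exists>q \<in> prime_factors n. q \<noteq> p" using assms by (intro Ex_other_prime_factor) auto
  with assms(3) show False by auto
qed

context group
begin

text \<open>Sylow's theorem with exponent 1 yields a subgroup of order \<open>q\<close> inside
  \<open>H\<close>, and any nontrivial element of it will do.\<close>

lemma Cauchy_element:
  assumes fin: "finite (carrier G)" and H: "subgroup H G" and q: "prime q" "q dvd card H"
  obtains h where "h \<in> H" "h \<noteq> \<one>" "h [^] q = \<one>"
proof -
  interpret H: group "G\<lparr>carrier := H\<rparr>" by (rule subgroup.subgroup_is_group[OF H is_group])
  have finH: "finite H" using finite_subset[OF subgroup.subset[OF H] fin] .
  obtain m where "card H = q ^ 1 * m" using q by auto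
  then obtain Q where Q: "subgroup Q (G\<lparr>carrier := H\<rparr>)" "card Q = q ^ 1"
    using sylow_thm[OF q(1) H.is_group, of 1 m] finH by (auto simp: Coset.order_def simp del: power_one_right)
  have QG: "subgroup Q G" using incl_subgroup[OF H Q(1)] .
  have QH: "Q \<subseteq> H" using subgroup.subset[OF Q(1)] by simp
  have "\<not> Q \<subseteq> {\<one>}"
  proof
    assume "Q \<subseteq> {\<one>}"
    hence "card Q \<le> 1" using card_mono[of "{\<one>}" Q] by simp
    thus False using Q(2) prime_gt_1_nat[OF q(1)] by simp
  qed
  then obtain h where h: "h \<in> Q" "h \<noteq> \<one>" by auto
  interpret Q: group "G\<lparr>carrier := Q\<rparr>" by (rule subgroup.subgroup_is_group[OF QG is_group])
  have "h [^]\<^bsub>G\<lparr>carrier := Q\<rparr>\<^esub> Coset.order (G\<lparr>carrier := Q\<rparr>) = \<one>"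
    using Q.pow_order_eq_1[of h] h by simp
  hence "h [^] Coset.order (G\<lparr>carrier := Q\<rparr>) = \<one>"
    unfolding nat_pow_consistent[of h _ Q, symmetric] .
  hence "h [^] q = \<one>" using Q(2) by (simp add: Coset.order_def)
  with h QH show ?thesis by (intro that[of h]) auto
qed

section \<open>Orbits under conjugation by a subgroup\<close>

definition conj_orbit :: "'a set \<Rightarrow> 'a \<Rightarrow> 'a set" where
  "conj_orbit P s = (\<lambda>x. x \<otimes> s \<otimes> inv x) ` P"

lemma conj_eq_iff:
  assumes "x \<in> carrier G" "s \<in> carrier G" "t \<in> carrier G"
  shows "x \<otimes> s \<otimes> inv x = t \<longleftrightarrow> x \<otimes> s = t \<otimes> x"
  using inv_solve_right'[of t "x \<otimes> s" x] assms by simp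

lemma conj_mult:
  assumes "x \<in> carrier G" "y \<in> carrier G" "s \<in> carrier G"
  shows "x \<otimes> (y \<otimes> s \<otimes> inv y) \<otimes> inv x = (x \<otimes> y) \<otimes> s \<otimes> inv (x \<otimes> y)"
  using assms by (simp add: inv_mult_group m_assoc)

text \<open>The elements carrying \<open>s\<close> to its conjugate by \<open>a\<close> form the
  left coset by \<open>a\<close> of the stabilizer of \<open>s\<close> in \<open>P\<close>.\<close>

lemma card_transporter:
  assumes P: "subgroup P G" and s: "s \<in> carrier G" and a: "a \<in> P"
  shows "card {x \<in> P. x \<otimes> s \<otimes> inv x = a \<otimes> s \<otimes> inv a} = card {x \<in> P. x \<otimes> s = s \<otimes> x}"
proof -
  have PG: "x \<in> carrier G" if "x \<in> P" for x using subgroup.mem_carrier[OF P that] .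
  note cl = subgroup.m_closed[OF P] subgroup.m_inv_closed[OF P]
  have conj: "c \<otimes> s \<otimes> inv c = s" if "c \<in> P" "c \<otimes> s = s \<otimes> c" for c
    using that s PG conj_eq_iff[of c s s] by simp
  have "bij_betw (\<lambda>x. a \<otimes> x) {x \<in> P. x \<otimes> s = s \<otimes> x}
      {x \<in> P. x \<otimes> s \<otimes> inv x = a \<otimes> s \<otimes> inv a}"
  proof (rule bij_betw_byWitness[where f' = "\<lambda>x. inv a \<otimes> x"])
    show "(\<lambda>x. a \<otimes> x) ` {x \<in> P. x \<otimes> s = s \<otimes> x} \<subseteq> {x \<in> P. x \<otimes> s \<otimes> inv x = a \<otimes> s \<otimes> inv a}"
    proof safe
      fix c assume c: "c \<in> P" "c \<otimes> s = s \<otimes> c"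
      show "a \<otimes> c \<in> P" using cl a c by blast
      show "(a \<otimes> c) \<otimes> s \<otimes> inv (a \<otimes> c) = a \<otimes> s \<otimes> inv a"
        using conj_mult[of a c s] conj[OF c] a c s PG by simp
    qed
    show "(\<lambda>x. inv a \<otimes> x) ` {x \<in> P. x \<otimes> s \<otimes> inv x = a \<otimes> s \<otimes> inv a} \<subseteq> {x \<in> P. x \<otimes> s = s \<otimes> x}"
    proof safe
      fix x assume x: "x \<in> P" "x \<otimes> s \<otimes> inv x = a \<otimes> s \<otimes> inv a"
      show xP: "inv a \<otimes> x \<in> P" using cl a x by blast
      have "(inv a \<otimes> x) \<otimes> s \<otimes> inv (inv a \<otimes> x) = inv a \<otimes> (a \<otimes> s \<otimes> inv a) \<otimes> inv (inv a)"
        using conj_mult[of "inv a" x s] x a s PG cl by simp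
      also have "\<dots> = s" using a s PG by (subst conj_mult) simp_all
      finally show "inv a \<otimes> x \<otimes> s = s \<otimes> (inv a \<otimes> x)" using conj_eq_iff[of "inv a \<otimes> x" s s] xP s PG by simp
    qed
  qed (use a PG cl in \<open>auto simp: m_assoc[symmetric]\<close>)
  thus ?thesis by (simp add: bij_betw_same_card)
qed

text \<open>Orbit-stabilizer: the fibres of the orbit map partition \<open>P\<close>, and each has
  the size of the stabilizer.\<close>

lemma card_conj_orbit:
  assumes P: "subgroup P G" and fin: "finite P" and s: "s \<in> carrier G"
  shows "card (conj_orbit P s) * card {x \<in> P. x \<otimes> s = s \<otimes> x} = card P"
proof -
  define F where "F t = {x \<in> P. x \<otimes> s \<otimes> inv x = t}" for t
  have "P = (\<Union>t\<in>conj_orbit P s. F t)" by (auto simp: conj_orbit_def F_def)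
  hence "card P = card (\<Union>t\<in>conj_orbit P s. F t)" by simp
  also have "\<dots> = (\<Sum>t\<in>conj_orbit P s. card (F t))"
    using fin by (intro card_UN_disjoint) (auto simp: conj_orbit_def F_def)
  also have "\<dots> = (\<Sum>t\<in>conj_orbit P s. card {x \<in> P. x \<otimes> s = s \<otimes> x})"
    by (intro sum.cong refl) (auto simp: conj_orbit_def F_def card_transporter[OF P s])
  finally show ?thesis by simp
qed

lemma conj_orbit_eq_iff:
  assumes P: "subgroup P G" and s: "s \<in> carrier G" "t \<in> conj_orbit P s"
  shows "conj_orbit P t = conj_orbit P s"
proof -
  obtain a where a: "a \<in> P" "t = a \<otimes> s \<otimes> inv a" using s by (auto simp: conj_orbit_def)
  have PG: "x \<in> carrier G" if "x \<in> P" for x using subgroup.mem_carrier[OF P that] .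
  note cl = subgroup.m_closed[OF P] subgroup.m_inv_closed[OF P]
  have "x \<otimes> t \<otimes> inv x \<in> conj_orbit P s" if x: "x \<in> P" for x
    unfolding a(2) conj_orbit_def using conj_mult[of x a s] a x s PG cl by auto
  moreover have "x \<otimes> s \<otimes> inv x \<in> conj_orbit P t" if x: "x \<in> P" for x
  proof -
    have "x \<otimes> s \<otimes> inv x = (x \<otimes> inv a) \<otimes> t \<otimes> inv (x \<otimes> inv a)"
      unfolding a(2) using a x s PG cl by (subst conj_mult) (auto simp: m_assoc)
    thus ?thesis unfolding conj_orbit_def using cl a x by blast
  qed
  ultimately show ?thesis unfolding conj_orbit_def by blast
qed

text \<open>Orbits of \<open>P\<close> have \<open>p\<close>-power length; if none of them were a
  single point, \<open>p\<close> would divide \<open>card S\<close>.\<close>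

lemma pgroup_fixed_point:
  assumes P: "subgroup P G" "card P = p ^ a" "prime p" and S: "finite S" "S \<subseteq> carrier G"
    and inv: "\<And>x s. x \<in> P \<Longrightarrow> s \<in> S \<Longrightarrow> x \<otimes> s \<otimes> inv x \<in> S" and ndvd: "\<not> p dvd card S"
  obtains s where "s \<in> S" "\<And>x. x \<in> P \<Longrightarrow> x \<otimes> s = s \<otimes> x"
proof -
  have "card P \<noteq> 0" using P prime_gt_0_nat by simp
  hence finP: "finite P" by (metis card.infinite)
  have one: "\<one> \<in> P" using subgroup.one_closed[OF P(1)] .
  have "\<exists>s\<in>S. \<not> p dvd card (conj_orbit P s)"
  proof (rule ccontr)
    assume contra: "\<not> (\<exists>s\<in>S. \<not> p dvd card (conj_orbit P s))"
    have U: "\<Union> (conj_orbit P ` S) = S"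
    proof
      show "\<Union> (conj_orbit P ` S) \<subseteq> S" using inv by (auto simp: conj_orbit_def)
      show "S \<subseteq> \<Union> (conj_orbit P ` S)"
      proof
        fix s assume s: "s \<in> S"
        hence "s = \<one> \<otimes> s \<otimes> inv \<one>" using S by auto
        thus "s \<in> \<Union> (conj_orbit P ` S)" using s one unfolding conj_orbit_def by blast
      qed
    qed
    have "p dvd card (\<Union> (conj_orbit P ` S))"
    proof (rule dvd_partition)
      show "finite (\<Union> (conj_orbit P ` S))" unfolding U by (rule S)
      show "\<forall>c\<in>conj_orbit P ` S. p dvd card c" using contra by auto
      show "\<forall>c1\<in>conj_orbit P ` S. \<forall>c2\<in>conj_orbit P ` S. c1 \<noteq> c2 \<longrightarrow> c1 \<inter> c2 = {}"
        using conj_orbit_eq_iff[OF P(1)] S(2) by blast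
    qed
    with ndvd U show False by simp
  qed
  then obtain s where s: "s \<in> S" "\<not> p dvd card (conj_orbit P s)" by blast
  have sG: "s \<in> carrier G" using s S by auto
  have "card (conj_orbit P s) dvd p ^ a"
    using card_conj_orbit[OF P(1) finP sG] P(2) by (metis dvd_triv_left)
  then obtain i where "card (conj_orbit P s) = p ^ i" using divides_primepow_nat[OF P(3)] by blast
  with s(2) have c1: "card (conj_orbit P s) = 1" by (cases i) auto
  have "s \<in> conj_orbit P s" unfolding conj_orbit_def using one sG by (auto intro!: image_eqI[of _ _ \<one>])
  moreover obtain z where "conj_orbit P s = {z}" using c1 by (rule card_1_singletonE)
  ultimately have orb: "conj_orbit P s = {s}" by simp
  have "x \<otimes> s = s \<otimes> x" if x: "x \<in> P" for x
  proof -
    have "x \<otimes> s \<otimes> inv x = s" using orb x unfolding conj_orbit_def by blast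
    thus ?thesis using conj_eq_iff[of x s s] sG subgroup.mem_carrier[OF P(1) x] by simp
  qed
  with s(1) that show ?thesis by blast
qed

section \<open>Conjugation, centralizers and normalizers\<close>

lemma conj_hom:
  assumes "x \<in> carrier G" "s \<in> carrier G" "t \<in> carrier G"
  shows "x \<otimes> (s \<otimes> t) \<otimes> inv x = (x \<otimes> s \<otimes> inv x) \<otimes> (x \<otimes> t \<otimes> inv x)"
proof -
  have "inv x \<otimes> (x \<otimes> (t \<otimes> inv x)) = t \<otimes> inv x" using assms by (simp add: m_assoc[symmetric])
  thus ?thesis using assms by (simp add: m_assoc)
qed

lemma conj_nat_pow:
  assumes "x \<in> carrier G" "s \<in> carrier G"
  shows "(x \<otimes> s \<otimes> inv x) [^] (m::nat) = x \<otimes> s [^] m \<otimes> inv x"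
proof (induction m)
  case (Suc m)
  thus ?case using assms conj_hom[of x "s [^] m" s] by simp
qed (use assms in auto)

lemma ord_conj:
  assumes "x \<in> carrier G" "s \<in> carrier G"
  shows "ord (x \<otimes> s \<otimes> inv x) = ord s"
proof (rule dvd_antisym)
  have eq: "ord (x \<otimes> s \<otimes> inv x) dvd m \<longleftrightarrow> ord s dvd m" for m
  proof -
    have "(x \<otimes> s \<otimes> inv x) [^] m = \<one> \<longleftrightarrow> s [^] m = \<one>"
      unfolding conj_nat_pow[OF assms] using assms by (intro conj_eq_one) auto
    moreover have "x \<otimes> s \<otimes> inv x \<in> carrier G" using assms by simp
    ultimately show ?thesis using pow_eq_id[of _ m] assms by blast
  qed
  show "ord (x \<otimes> s \<otimes> inv x) dvd ord s" unfolding eq by (rule dvd_refl)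
  show "ord s dvd ord (x \<otimes> s \<otimes> inv x)" unfolding eq[symmetric] by (rule dvd_refl)
qed

lemma mem_centralizer: "g \<in> centralizer G {s} \<longleftrightarrow> g \<in> carrier G \<and> g \<otimes> s = s \<otimes> g"
  by (auto simp: centralizer_def)

lemma centralizer_subgroup:
  assumes "S \<subseteq> carrier G"
  shows "subgroup (centralizer G S) G"
proof
  fix x y assume xy: "x \<in> centralizer G S" "y \<in> centralizer G S"
  show "x \<otimes> y \<in> centralizer G S"
    unfolding centralizer_def
  proof safe
    fix s assume s: "s \<in> S"
    have c: "x \<otimes> s = s \<otimes> x" "y \<otimes> s = s \<otimes> y" "x \<in> carrier G" "y \<in> carrier G" "s \<in> carrier G"
      using xy s assms by (auto simp: centralizer_def)
    have "x \<otimes> y \<otimes> s = x \<otimes> (s \<otimes> y)" using c(2-5) by (simp add: m_assoc)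
    also have "\<dots> = x \<otimes> s \<otimes> y" using c(3-5) by (simp add: m_assoc)
    also have "\<dots> = s \<otimes> (x \<otimes> y)" unfolding c(1) by (rule m_assoc[OF c(5,3,4)])
    finally show "x \<otimes> y \<otimes> s = s \<otimes> (x \<otimes> y)" .
  qed (use xy in \<open>auto simp: centralizer_def\<close>)
next
  fix x assume x: "x \<in> centralizer G S"
  show "inv x \<in> centralizer G S"
    unfolding centralizer_def
  proof safe
    fix s assume s: "s \<in> S"
    have c: "s \<otimes> x = x \<otimes> s" "x \<in> carrier G" "s \<in> carrier G" using x s assms by (auto simp: centralizer_def)
    have "inv x \<otimes> s = inv x \<otimes> (s \<otimes> x) \<otimes> inv x" using c(2,3) by (simp add: m_assoc)
    also have "\<dots> = inv x \<otimes> (x \<otimes> s) \<otimes> inv x" unfolding c(1) ..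
    also have "\<dots> = s \<otimes> inv x" using c(2,3) by (simp add: m_assoc[symmetric])
    finally show "inv x \<otimes> s = s \<otimes> inv x" .
  qed (use x in \<open>auto simp: centralizer_def\<close>)
qed (use assms in \<open>auto simp: centralizer_def\<close>)

lemma card_subgroup_dvd:
  assumes "finite (carrier G)" "subgroup P G" "subgroup H G" "P \<subseteq> H"
  shows "card P dvd card H"
proof -
  interpret H: group "G\<lparr>carrier := H\<rparr>" by (rule subgroup.subgroup_is_group[OF assms(3) is_group])
  have "card (rcosets\<^bsub>G\<lparr>carrier := H\<rparr>\<^esub> P) * card P = card H"
    using H.lagrange[OF subgroup_incl[OF assms(2,3,4)]] by (simp add: Coset.order_def)
  thus ?thesis by (metis dvd_triv_right)
qed

lemma mem_group_center:
  "z \<in> group_center (G\<lparr>carrier := P\<rparr>) \<longleftrightarrow> z \<in> P \<and> (\<forall>y\<in>P. z \<otimes> y = y \<otimes> z)"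
  by (simp add: group_center_def centralizer_def)

lemma centralizer_normal:
  assumes "H \<lhd> G"
  shows "centralizer G H \<lhd> G"
  unfolding normal_inv_iff
proof (intro conjI ballI)
  have H: "subgroup H G" "\<And>x h. x \<in> carrier G \<Longrightarrow> h \<in> H \<Longrightarrow> x \<otimes> h \<otimes> inv x \<in> H"
    using assms unfolding normal_inv_iff by auto
  show "subgroup (centralizer G H) G" by (rule centralizer_subgroup[OF subgroup.subset[OF H(1)]])
  fix x g assume x: "x \<in> carrier G" and g: "g \<in> centralizer G H"
  have gG: "g \<in> carrier G" and comm: "\<And>h. h \<in> H \<Longrightarrow> g \<otimes> h = h \<otimes> g"
    using g by (auto simp: centralizer_def)
  show "x \<otimes> g \<otimes> inv x \<in> centralizer G H"
    unfolding centralizer_def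
  proof (intro CollectI conjI ballI)
    fix h assume h: "h \<in> H"
    have hG: "h \<in> carrier G" using subgroup.mem_carrier[OF H(1) h] .
    define k where "k = inv x \<otimes> h \<otimes> x"
    have k: "k \<in> H" using H(2)[of "inv x" h] x h by (simp add: k_def)
    have kG: "k \<in> carrier G" using subgroup.mem_carrier[OF H(1) k] .
    have h_eq: "h = x \<otimes> k \<otimes> inv x"
      unfolding k_def using x hG by (simp add: m_assoc) (simp add: m_assoc[symmetric])
    have "(x \<otimes> g \<otimes> inv x) \<otimes> h = x \<otimes> (g \<otimes> k) \<otimes> inv x"
      unfolding h_eq by (rule conj_hom[symmetric, OF x gG kG])
    also have "\<dots> = x \<otimes> (k \<otimes> g) \<otimes> inv x" using comm[OF k] by simp
    also have "\<dots> = h \<otimes> (x \<otimes> g \<otimes> inv x)" unfolding h_eq by (rule conj_hom[OF x kG gG])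
    finally show "(x \<otimes> g \<otimes> inv x) \<otimes> h = h \<otimes> (x \<otimes> g \<otimes> inv x)" .
  qed (use x gG in auto)
qed

text \<open>Conjugation is an automorphism, which gives one inclusion for arbitrary elements; the
  other is that inclusion applied to \<open>inv x\<close>.\<close>

lemma conj_image_centralizer:
  assumes x: "x \<in> carrier G" and s: "s \<in> carrier G"
  shows "(\<lambda>y. x \<otimes> y \<otimes> inv x) ` centralizer G {s} = centralizer G {x \<otimes> s \<otimes> inv x}"
proof -
  have sub: "a \<otimes> y \<otimes> inv a \<in> centralizer G {a \<otimes> u \<otimes> inv a}"
    if a: "a \<in> carrier G" and u: "u \<in> carrier G" and y: "y \<in> centralizer G {u}" for a u y
  proof -
    have y: "y \<in> carrier G" "y \<otimes> u = u \<otimes> y" using y by (auto simp: mem_centralizer)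
    have "(a \<otimes> y \<otimes> inv a) \<otimes> (a \<otimes> u \<otimes> inv a) = a \<otimes> (y \<otimes> u) \<otimes> inv a"
      by (rule conj_hom[symmetric, OF a y(1) u])
    also have "\<dots> = (a \<otimes> u \<otimes> inv a) \<otimes> (a \<otimes> y \<otimes> inv a)"
      unfolding y(2) by (rule conj_hom[OF a u y(1)])
    finally show ?thesis using a y by (simp add: mem_centralizer)
  qed
  show ?thesis
  proof
    show "(\<lambda>y. x \<otimes> y \<otimes> inv x) ` centralizer G {s} \<subseteq> centralizer G {x \<otimes> s \<otimes> inv x}"
      using sub[OF x s] by blast
    show "centralizer G {x \<otimes> s \<otimes> inv x} \<subseteq> (\<lambda>y. x \<otimes> y \<otimes> inv x) ` centralizer G {s}"
    proof
      fix y assume y: "y \<in> centralizer G {x \<otimes> s \<otimes> inv x}"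
      have yG: "y \<in> carrier G" using y by (simp add: mem_centralizer)
      have "inv x \<otimes> y \<otimes> inv (inv x) \<in> centralizer G {inv x \<otimes> (x \<otimes> s \<otimes> inv x) \<otimes> inv (inv x)}"
        using x s y by (intro sub) auto
      moreover have "inv x \<otimes> (x \<otimes> s \<otimes> inv x) \<otimes> inv (inv x) = s"
        using conj_mult[of "inv x" x s] x s by simp
      moreover have "x \<otimes> (inv x \<otimes> y \<otimes> inv (inv x)) \<otimes> inv x = y"
        using conj_mult[of x "inv x" y] x yG by simp
      ultimately show "y \<in> (\<lambda>y. x \<otimes> y \<otimes> inv x) ` centralizer G {s}" by (metis image_eqI)
    qed
  qed
qed

lemma normalizer_iff:
  assumes S: "S \<subseteq> carrier G"
  shows "g \<in> normalizer G S \<longleftrightarrow> g \<in> carrier G \<and> (\<lambda>s. g \<otimes> s \<otimes> inv g) ` S = S"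
proof -
  have "g <# S #> inv g = (\<lambda>s. g \<otimes> s \<otimes> inv g) ` S"
    by (auto simp: l_coset_def r_coset_def)
  thus ?thesis using S by (simp add: normalizer_def stabilizer_def)
qed

end

section \<open>Two columns differing in one row\<close>

text \<open>At this stage \<open>\<theta>\<close> is only the row in which the columns of 1 and
  \<open>b\<close> differ; that it comes last in the numbering will follow from
  \<open>degree_less_d\<close>.\<close>

locale CD1_row = group G for G (structure) +
  fixes \<theta> :: "'a \<Rightarrow> complex" and b :: 'a and d :: nat
  assumes fin: "finite (carrier G)" and finI: "finite (Irr G)"
    and \<theta>: "\<theta> \<in> Irr G" and triv: "trivial_character G \<in> Irr G"
    and b: "b \<in> carrier G" and diff: "\<theta> \<one> \<noteq> \<theta> b"
    and same: "\<And>\<psi>. \<psi> \<in> Irr G \<Longrightarrow> \<psi> \<noteq> \<theta> \<Longrightarrow> \<psi> b = \<psi> \<one>"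
    and deg: "\<theta> \<one> = of_nat d"
begin

definition K :: "'a set" where "K = conj_orbit (carrier G) b"

text \<open>\<open>N_char_iff\<close> identifies this set with the intersection of the kernels of
  the characters other than \<open>\<theta>\<close>.\<close>

definition N :: "'a set" where "N = insert \<one> K"

definition c :: "'a \<Rightarrow> nat" where "c g = card (centralizer G {g})"

section \<open>Conjugacy classes, centralizer orders and degrees\<close>

lemma centralizer_eq: "centralizer G {g} = {x \<in> carrier G. x \<otimes> g = g \<otimes> x}"
  by (auto simp: mem_centralizer)

lemma c_pos: "g \<in> carrier G \<Longrightarrow> c g > 0"
  using fin unfolding c_def centralizer_eq by (auto simp: card_gt_0_iff intro!: exI[of _ \<one>])

lemma orbit_mem_carrier: "g \<in> carrier G \<Longrightarrow> h \<in> conj_orbit (carrier G) g \<Longrightarrow> h \<in> carrier G"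
  by (auto simp: conj_orbit_def)

lemma orbit_self: "g \<in> carrier G \<Longrightarrow> g \<in> conj_orbit (carrier G) g"
  unfolding conj_orbit_def by (rule image_eqI[of _ _ \<one>]) auto

lemma orbit_eq: "g \<in> carrier G \<Longrightarrow> h \<in> conj_orbit (carrier G) g \<Longrightarrow>
    conj_orbit (carrier G) h = conj_orbit (carrier G) g"
  by (rule conj_orbit_eq_iff[OF subgroup_self])

lemma orbit_sym: "g \<in> carrier G \<Longrightarrow> h \<in> conj_orbit (carrier G) g \<Longrightarrow> g \<in> conj_orbit (carrier G) h"
  using orbit_eq[of g h] orbit_self[of g] by simp

lemma card_orbit: "g \<in> carrier G \<Longrightarrow> card (conj_orbit (carrier G) g) * c g = Coset.order G"
  using card_conj_orbit[OF subgroup_self fin, of g] by (simp add: c_def centralizer_eq Coset.order_def)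

lemma order_pos: "Coset.order G > 0"
  using order_gt_0_iff_finite fin by auto

lemma c_orbit:
  assumes g: "g \<in> carrier G" and h: "h \<in> conj_orbit (carrier G) g"
  shows "c h = c g"
proof -
  have "card (conj_orbit (carrier G) g) * c h = card (conj_orbit (carrier G) g) * c g"
    using card_orbit[OF g] card_orbit[OF orbit_mem_carrier[OF g h]] orbit_eq[OF g h] by simp
  moreover have "card (conj_orbit (carrier G) g) \<noteq> 0"
    using card_orbit[OF g] order_pos by (intro notI) simp
  ultimately show ?thesis by simp
qed

lemma card_conj_to:
  assumes g: "g \<in> carrier G"
  shows "card {x \<in> carrier G. x \<otimes> g \<otimes> inv x = h} = (if h \<in> conj_orbit (carrier G) g then c g else 0)"
proof (cases "h \<in> conj_orbit (carrier G) g")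
  case True
  then obtain a where "a \<in> carrier G" "h = a \<otimes> g \<otimes> inv a" by (auto simp: conj_orbit_def)
  thus ?thesis using True card_transporter[OF subgroup_self g, of a] by (simp add: c_def centralizer_eq)
next
  case False
  hence empty: "{x \<in> carrier G. x \<otimes> g \<otimes> inv x = h} = {}" by (auto simp: conj_orbit_def)
  show ?thesis unfolding empty using False by simp
qed

lemma column_orthogonality:
  assumes "g \<in> carrier G" "h \<in> carrier G"
  shows "(\<Sum>\<chi>\<in>Irr G. \<chi> g * \<chi> (inv h)) = of_nat (if h \<in> conj_orbit (carrier G) g then c g else 0)"
  using Irr_column_orthogonality[OF fin finI assms] card_conj_to[OF assms(1)] by simp

lemma orbit_one: "g \<in> carrier G \<Longrightarrow> \<one> \<in> conj_orbit (carrier G) g \<longleftrightarrow> g = \<one>"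
proof
  assume g: "g \<in> carrier G" and "\<one> \<in> conj_orbit (carrier G) g"
  then obtain a where "a \<in> carrier G" "a \<otimes> g \<otimes> inv a = \<one>" by (auto simp: conj_orbit_def)
  thus "g = \<one>" using conj_eq_one g by blast
qed (auto simp: conj_orbit_def intro!: image_eqI[of _ _ \<one>])

lemma class_fun:
  assumes "\<chi> \<in> Irr G" "g \<in> carrier G" "h \<in> conj_orbit (carrier G) g"
  shows "\<chi> h = \<chi> g"
  using assms Irr_conj by (auto simp: conj_orbit_def)

lemma b_ne_one: "b \<noteq> \<one>"
  using diff by auto

lemma d_pos: "d > 0"
  by (rule Irr_degree[OF \<theta>]) (simp add: deg)

lemma triv_neq: "trivial_character G \<noteq> \<theta>"
  using diff b by (auto simp: trivial_character_def)

lemma sum_Irr_split: "(\<Sum>\<chi>\<in>Irr G. f \<chi>) = f \<theta> + (\<Sum>\<chi>\<in>Irr G - {\<theta>}. f \<chi>)" for f :: "_ \<Rightarrow> complex"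
  using sum.remove[OF finI \<theta>] .

text \<open>Character values are complex; passing through the real part gives the degree as a
  natural number, so that degrees can be compared.\<close>

definition degree_of :: "('a \<Rightarrow> complex) \<Rightarrow> nat" where
  "degree_of \<chi> = nat \<lfloor>Re (\<chi> \<one>)\<rfloor>"

lemma degree_of: "\<chi> \<in> Irr G \<Longrightarrow> \<chi> \<one> = of_nat (degree_of \<chi>)"
  by (rule Irr_degree[of \<chi>]) (simp_all add: degree_of_def)

lemma degree_of_pos: "\<chi> \<in> Irr G \<Longrightarrow> degree_of \<chi> > 0"
  by (rule Irr_degree[of \<chi>]) (simp_all add: degree_of_def)

definition s :: nat where "s = (\<Sum>\<chi>\<in>Irr G - {\<theta>}. degree_of \<chi> ^ 2)"

lemma s_eq: "(\<Sum>\<chi>\<in>Irr G - {\<theta>}. \<chi> \<one> * \<chi> \<one>) = of_nat s"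
  unfolding s_def of_nat_sum by (intro sum.cong refl) (simp add: degree_of power2_eq_square)

lemma degree_triv: "degree_of (trivial_character G) = 1"
  by (simp add: degree_of_def trivial_character_def)

lemma s_pos: "s > 0"
proof -
  have "degree_of (trivial_character G) ^ 2 \<le> s"
    unfolding s_def using finI triv triv_neq by (intro member_le_sum) auto
  thus ?thesis by (simp add: degree_triv)
qed

text \<open>The trivial character contributes a second summand, equal to 1, which makes the bound
  strict.\<close>

lemma degree_square_less:
  assumes "\<chi> \<in> Irr G" "\<chi> \<noteq> \<theta>" "\<chi> \<noteq> trivial_character G"
  shows "degree_of \<chi> ^ 2 < s"
proof -
  have "(\<Sum>\<chi>\<in>{\<chi>, trivial_character G}. degree_of \<chi> ^ 2) \<le> s"
    unfolding s_def using finI triv triv_neq assms by (intro sum_mono2) auto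
  thus ?thesis using assms by (simp add: degree_triv)
qed

definition \<beta> :: complex where "\<beta> = - \<theta> b"

text \<open>Subtract the orthogonality relations of column \<open>g\<close> with the columns of 1
  and of \<open>inv b\<close>: only the row \<open>\<theta>\<close> survives. The relations pair a
  column with an inverse, which is why the class of \<open>inv b\<close> has to be avoided;
  \<open>inv_b\<close> shows that it is the class of \<open>b\<close>.\<close>

lemma theta_vanish:
  assumes g: "g \<in> carrier G" "g \<noteq> \<one>" "inv b \<notin> conj_orbit (carrier G) g"
  shows "\<theta> g = 0"
proof -
  have "(\<Sum>\<chi>\<in>Irr G. \<chi> g * \<chi> \<one>) = 0" using column_orthogonality[OF g(1) one_closed] g orbit_one by simp
  moreover have "(\<Sum>\<chi>\<in>Irr G. \<chi> g * \<chi> b) = 0"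
    using column_orthogonality[OF g(1), of "inv b"] g b by simp
  ultimately have "(\<Sum>\<chi>\<in>Irr G. \<chi> g * (\<chi> \<one> - \<chi> b)) = 0"
    by (simp add: right_diff_distrib sum_subtractf)
  also have "(\<Sum>\<chi>\<in>Irr G. \<chi> g * (\<chi> \<one> - \<chi> b)) = \<theta> g * (\<theta> \<one> - \<theta> b)"
  proof -
    have "(\<Sum>\<chi>\<in>Irr G - {\<theta>}. \<chi> g * (\<chi> \<one> - \<chi> b)) = 0"
      by (intro sum.neutral) (simp add: same)
    thus ?thesis unfolding sum_Irr_split by simp
  qed
  finally show ?thesis using diff by simp
qed

text \<open>Orthogonality of the columns of \<open>b\<close> and 1, where the characters other than
  \<open>\<theta>\<close> contribute the squares of their degrees.\<close>

lemma sum_b: "of_nat s = of_nat d * \<beta>"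
proof -
  have "(\<Sum>\<chi>\<in>Irr G. \<chi> b * \<chi> \<one>) = 0"
    using column_orthogonality[OF b one_closed] b b_ne_one orbit_one by simp
  moreover have "(\<Sum>\<chi>\<in>Irr G - {\<theta>}. \<chi> b * \<chi> \<one>) = of_nat s"
    unfolding s_eq[symmetric] using same by (intro sum.cong) auto
  ultimately show ?thesis unfolding sum_Irr_split \<beta>_def using deg by (simp add: algebra_simps add_eq_0_iff)
qed

text \<open>By \<open>sum_b\<close> the value \<open>\<theta> b\<close> is nonzero, so
  \<open>theta_vanish\<close> must fail to apply at \<open>b\<close>.\<close>

lemma inv_b: "inv b \<in> K"
proof -
  have "\<theta> b \<noteq> 0" using sum_b s_pos by (auto simp: \<beta>_def)
  thus ?thesis unfolding K_def using theta_vanish[OF b b_ne_one] by blast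
qed

section \<open>The class \<open>K\<close>, the values of \<open>\<theta>\<close> and the resulting
  orders\<close>

lemma K_carrier: "K \<subseteq> carrier G"
  unfolding K_def using orbit_mem_carrier b by blast

lemma N_carrier: "N \<subseteq> carrier G"
  using K_carrier by (simp add: N_def)

lemma b_in_K: "b \<in> K"
  unfolding K_def using orbit_self b .

lemma K_orbit: "g \<in> K \<Longrightarrow> conj_orbit (carrier G) g = K"
  unfolding K_def using orbit_eq b by blast

lemma inv_K: "g \<in> K \<Longrightarrow> inv g \<in> K"
proof -
  assume "g \<in> K"
  then obtain a where a: "a \<in> carrier G" "g = a \<otimes> b \<otimes> inv a" by (auto simp: K_def conj_orbit_def)
  hence "inv g = a \<otimes> inv b \<otimes> inv a" using b by (simp add: inv_mult_group m_assoc)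
  hence "inv g \<in> conj_orbit (carrier G) (inv b)" using a by (auto simp: conj_orbit_def)
  thus ?thesis using K_orbit[OF inv_b] by simp
qed

lemma one_notin_K: "\<one> \<notin> K"
  unfolding K_def using orbit_one b b_ne_one by blast

lemma theta_outside: "g \<in> carrier G \<Longrightarrow> g \<notin> N \<Longrightarrow> \<theta> g = 0"
proof (rule theta_vanish)
  assume g: "g \<in> carrier G" "g \<notin> N"
  show "inv b \<notin> conj_orbit (carrier G) g"
  proof
    assume "inv b \<in> conj_orbit (carrier G) g"
    hence "g \<in> conj_orbit (carrier G) (inv b)" using orbit_sym g by blast
    thus False using K_orbit[OF inv_b] g by (simp add: N_def)
  qed
qed (auto simp: N_def)

lemma theta_K: "g \<in> K \<Longrightarrow> \<theta> g = - \<beta>"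
  using class_fun[OF \<theta> b] by (simp add: K_def \<beta>_def)

lemma char_K: "\<chi> \<in> Irr G \<Longrightarrow> \<chi> \<noteq> \<theta> \<Longrightarrow> g \<in> K \<Longrightarrow> \<chi> g = \<chi> \<one>"
  using class_fun[OF _ b, of \<chi> g] same[of \<chi>] by (simp add: K_def)

text \<open>The squares of all degrees sum to the group order; the characters other than
  \<open>\<theta>\<close> contribute \<open>s\<close>, evaluated by \<open>sum_b\<close>.\<close>

lemma order_eq: "of_nat (Coset.order G) = of_nat d * (of_nat d + \<beta>)"
proof -
  have "(\<Sum>\<chi>\<in>Irr G. \<chi> \<one> * \<chi> \<one>) = of_nat (Coset.order G)"
    using Irr_regular[OF fin finI one_closed] by simp
  thus ?thesis unfolding sum_Irr_split using s_eq sum_b deg by (simp add: algebra_simps)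
qed

text \<open>Column orthogonality for \<open>b\<close> and its conjugate \<open>inv b\<close>; the
  contribution of the rows other than \<open>\<theta>\<close> is again \<open>s\<close>.\<close>

lemma centralizer_card_eq: "of_nat (c b) = \<beta> * (of_nat d + \<beta>)"
proof -
  have "(\<Sum>\<chi>\<in>Irr G. \<chi> b * \<chi> b) = of_nat (c b)"
    using column_orthogonality[OF b, of "inv b"] b inv_b by (simp add: K_def)
  moreover have "(\<Sum>\<chi>\<in>Irr G - {\<theta>}. \<chi> b * \<chi> b) = of_nat s"
    unfolding s_eq[symmetric]
  proof (intro sum.cong refl)
    fix \<chi> assume "\<chi> \<in> Irr G - {\<theta>}"
    hence "\<chi> b = \<chi> \<one>" using same by blast
    thus "\<chi> b * \<chi> b = \<chi> \<one> * \<chi> \<one>" by simp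
  qed
  ultimately show ?thesis unfolding sum_Irr_split using sum_b by (simp add: \<beta>_def algebra_simps)
qed

lemma d_plus_beta: "of_nat d + \<beta> \<noteq> 0"
proof
  assume "of_nat d + \<beta> = 0"
  hence "(of_nat (Coset.order G) :: complex) = 0" using order_eq by simp
  thus False using order_pos by simp
qed

text \<open>Class length times centralizer order is the group order; the common factor
  \<open>d + \<beta>\<close> is cancelled.\<close>

lemma degree_eq: "of_nat d = of_nat (card K) * \<beta>"
proof -
  have "of_nat (card K * c b) = (of_nat (Coset.order G) :: complex)" using card_orbit[OF b] by (simp add: K_def)
  hence "(of_nat (card K) * \<beta>) * (of_nat d + \<beta>) = of_nat d * (of_nat d + \<beta>)"
    using order_eq centralizer_card_eq by simp
  thus ?thesis using d_plus_beta by simp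
qed

lemma beta_nonzero: "\<beta> \<noteq> 0"
  using degree_eq d_pos by auto

text \<open>Off \<open>N\<close> the character \<open>\<theta>\<close> vanishes. If all the others
  took their degree at such a \<open>g\<close>, orthogonality with the column of 1 would read
  \<open>s = 0\<close>.\<close>

lemma N_char_iff:
  assumes g: "g \<in> carrier G"
  shows "g \<in> N \<longleftrightarrow> (\<forall>\<chi>\<in>Irr G - {\<theta>}. \<chi> g = \<chi> \<one>)"
proof
  assume "g \<in> N"
  thus "\<forall>\<chi>\<in>Irr G - {\<theta>}. \<chi> g = \<chi> \<one>" using char_K by (auto simp: N_def)
next
  assume eq: "\<forall>\<chi>\<in>Irr G - {\<theta>}. \<chi> g = \<chi> \<one>"
  show "g \<in> N"
  proof (rule ccontr)
    assume g': "g \<notin> N"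
    hence "g \<noteq> \<one>" by (auto simp: N_def)
    hence "(\<Sum>\<chi>\<in>Irr G. \<chi> g * \<chi> \<one>) = 0" using column_orthogonality[OF g one_closed] g orbit_one by simp
    moreover have "(\<Sum>\<chi>\<in>Irr G - {\<theta>}. \<chi> g * \<chi> \<one>) = of_nat s"
      unfolding s_eq[symmetric] using eq by (intro sum.cong) auto
    ultimately show False unfolding sum_Irr_split using theta_outside[OF g g'] s_pos by simp
  qed
qed

text \<open>Counting with the class sum formula for \<open>\<theta>\<close>: the value of the sum forces every product of
  two elements of \<open>K\<close> back into \<open>N\<close>.\<close>

lemma K_mult_N:
  assumes g: "g \<in> K" and h: "h \<in> K"
  shows "g \<otimes> h \<in> N"
proof -
  have gG: "g \<in> carrier G" and hG: "h \<in> carrier G" using g h K_carrier by auto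
  define F where "F x = x \<otimes> g \<otimes> inv x \<otimes> h" for x
  have FG: "F x \<in> carrier G" if "x \<in> carrier G" for x using that gG hG by (simp add: F_def)
  \<comment> \<open>For \<open>x\<close> outside \<open>A\<close> and \<open>B\<close> the element
    \<open>F x\<close> lies off \<open>N\<close> and contributes nothing, so the sum of
    \<open>\<theta>\<close> is \<open>d |A| - \<beta> |B|\<close>.\<close>
  define A where "A = {x \<in> carrier G. F x = \<one>}"
  define B where "B = {x \<in> carrier G. F x \<in> K}"
  have finAB: "finite A" "finite B" using fin by (auto simp: A_def B_def)
  have disj: "A \<inter> B = {}" using one_notin_K by (auto simp: A_def B_def)
  have "A = {x \<in> carrier G. x \<otimes> g \<otimes> inv x = inv h}"
    unfolding A_def F_def using gG hG mult_inv_eq_one[of _ "inv h"] by auto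
  hence cA: "card A = c b"
    using card_conj_to[OF gG] K_orbit[OF g] inv_K[OF h] c_orbit[OF b, of g] g by (simp add: K_def)
  have "(\<Sum>x\<in>carrier G. \<theta> (F x)) = (\<Sum>x\<in>A. \<theta> (F x)) + (\<Sum>x\<in>B. \<theta> (F x))"
  proof -
    have "(\<Sum>x\<in>carrier G. \<theta> (F x)) = (\<Sum>x\<in>A \<union> B. \<theta> (F x))"
      using fin FG theta_outside by (intro sum.mono_neutral_right) (auto simp: A_def B_def N_def)
    thus ?thesis using sum.union_disjoint[OF finAB disj] by simp
  qed
  also have "(\<Sum>x\<in>A. \<theta> (F x)) = of_nat (card A) * of_nat d" using deg by (simp add: A_def)
  also have "(\<Sum>x\<in>B. \<theta> (F x)) = - of_nat (card B) * \<beta>" using theta_K by (simp add: B_def)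
  \<comment> \<open>Cancelling \<open>\<beta>\<close>, with \<open>card A = c b\<close> and the
    formulas for the two orders, turns this into \<open>card A + card B = |G|\<close>. So every
    \<open>F x\<close> lies in \<open>N\<close>, and \<open>x = 1\<close> gives the product of
    \<open>g\<close> and \<open>h\<close>.\<close>
  finally have 1: "of_nat (c b) * of_nat d - of_nat (card B) * \<beta> = of_nat (Coset.order G) / of_nat d * \<beta> * \<beta>"
    using Irr_class_sum[OF \<theta> gG hG] theta_K[OF g] theta_K[OF h] deg cA by (simp add: F_def)
  have "of_nat (Coset.order G) / of_nat d = of_nat d + \<beta>" using order_eq d_pos by simp
  with 1 have "(of_nat d * (of_nat d + \<beta>) - of_nat (card B)) * \<beta> = \<beta> * (of_nat d + \<beta>) * \<beta>"
    using centralizer_card_eq by (simp add: algebra_simps)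
  hence "\<beta> * (of_nat (card B) + \<beta> * (of_nat d + \<beta>)) = \<beta> * (of_nat d * (of_nat d + \<beta>))"
    by (simp add: algebra_simps)
  hence "of_nat (card B) + \<beta> * (of_nat d + \<beta>) = of_nat d * (of_nat d + \<beta>)"
    using beta_nonzero mult_left_cancel by blast
  hence "(of_nat (card A + card B) :: complex) = of_nat (Coset.order G)"
    using order_eq centralizer_card_eq cA by (simp add: algebra_simps)
  hence "card A + card B = Coset.order G" by (simp only: of_nat_eq_iff)
  hence "card (A \<union> B) = card (carrier G)" using card_Un_disjoint[OF finAB disj] by (simp add: Coset.order_def)
  hence "A \<union> B = carrier G" using fin by (intro card_subset_eq) (auto simp: A_def B_def)
  hence "\<one> \<in> A \<union> B" by simp
  thus ?thesis using gG hG by (auto simp: A_def B_def F_def N_def)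
qed

section \<open>Normality of \<open>N\<close> and conjugacy inside its cosets\<close>

lemma N_normal: "N \<lhd> G"
  unfolding normal_inv_iff
proof (intro conjI ballI)
  show "subgroup N G"
  proof
    fix x y assume "x \<in> N" "y \<in> N"
    thus "x \<otimes> y \<in> N" using K_mult_N K_carrier by (auto simp: N_def)
  next
    fix x assume "x \<in> N"
    thus "inv x \<in> N" using inv_K by (auto simp: N_def)
  qed (use N_carrier in \<open>auto simp: N_def\<close>)
next
  fix x h assume xh: "x \<in> carrier G" "h \<in> N"
  show "x \<otimes> h \<otimes> inv x \<in> N"
  proof (cases "h = \<one>")
    case False
    hence "conj_orbit (carrier G) h = K" using xh K_orbit by (simp add: N_def)
    hence "x \<otimes> h \<otimes> inv x \<in> K" using xh by (auto simp: conj_orbit_def)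
    thus ?thesis by (simp add: N_def)
  qed (use xh in \<open>simp add: N_def\<close>)
qed

text \<open>Averaging over the conjugates of \<open>u\<close>: column orthogonality bounds each term by \<open>c y\<close>,
  and the average equals \<open>c y\<close>, so every term attains the bound.\<close>

lemma coset_conj:
  assumes u: "u \<in> N" and y: "y \<in> carrier G" "y \<notin> N"
  shows "u \<otimes> y \<in> conj_orbit (carrier G) y"
proof (cases "u = \<one>")
  case True
  thus ?thesis using y orbit_self by simp
next
  case False
  hence uK: "u \<in> K" using u by (simp add: N_def)
  have uG: "u \<in> carrier G" using uK K_carrier by auto
  define w where "w x = x \<otimes> u \<otimes> inv x \<otimes> y" for x
  have wG: "w x \<in> carrier G" if "x \<in> carrier G" for x using that uG y by (simp add: w_def)
  \<comment> \<open>By column orthogonality \<open>f x\<close> is the pairing of the columns of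
    \<open>w x\<close> and \<open>y\<close>; it equals \<open>c y\<close> if the two are conjugate
    and 0 otherwise.\<close>
  define f where "f x = (if y \<in> conj_orbit (carrier G) (w x) then c (w x) else 0)" for x
  have fle: "f x \<le> c y" if "x \<in> carrier G" for x
    using c_orbit[OF wG[OF that], of y] by (auto simp: f_def)
  have "(\<Sum>x\<in>carrier G. (of_nat (f x) :: complex)) = (\<Sum>x\<in>carrier G. \<Sum>\<chi>\<in>Irr G. \<chi> (w x) * \<chi> (inv y))"
    using column_orthogonality[OF wG y(1)] by (intro sum.cong) (auto simp: f_def)
  also have "\<dots> = (\<Sum>\<chi>\<in>Irr G. (\<Sum>x\<in>carrier G. \<chi> (w x)) * \<chi> (inv y))"
    by (subst sum.swap) (simp add: sum_distrib_right)
  also have "\<dots> = (\<Sum>\<chi>\<in>Irr G. of_nat (Coset.order G) * (\<chi> y * \<chi> (inv y)))"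
  proof (intro sum.cong refl)
    fix \<chi> assume \<chi>: "\<chi> \<in> Irr G"
    have "\<chi> \<one> \<noteq> 0" using degree_of[OF \<chi>] degree_of_pos[OF \<chi>] by simp
    \<comment> \<open>For \<open>\<chi> \<noteq> \<theta>\<close> the quotient of
      \<open>\<chi> u\<close> by the degree is 1; for \<open>\<theta>\<close> both sides vanish
      because \<open>y\<close> is outside \<open>N\<close>.\<close>
    hence "of_nat (Coset.order G) / \<chi> \<one> * \<chi> u * \<chi> y = of_nat (Coset.order G) * \<chi> y"
      using char_K[OF \<chi> _ uK] theta_outside[OF y] by (cases "\<chi> = \<theta>") simp_all
    thus "(\<Sum>x\<in>carrier G. \<chi> (w x)) * \<chi> (inv y) = of_nat (Coset.order G) * (\<chi> y * \<chi> (inv y))"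
      using Irr_class_sum[OF \<chi> uG y(1)] by (simp add: w_def)
  qed
  also have "\<dots> = of_nat (Coset.order G) * of_nat (c y)"
    using column_orthogonality[OF y(1) y(1)] orbit_self[OF y(1)] by (simp add: sum_distrib_left[symmetric])
  also have "\<dots> = of_nat (\<Sum>x\<in>carrier G. c y)" by (simp add: Coset.order_def)
  finally have "(of_nat (\<Sum>x\<in>carrier G. f x) :: complex) = of_nat (\<Sum>x\<in>carrier G. c y)"
    by (simp only: of_nat_sum)
  hence eq: "(\<Sum>x\<in>carrier G. f x) = (\<Sum>x\<in>carrier G. c y)" by (simp only: of_nat_eq_iff)
  \<comment> \<open>The instance \<open>x = 1\<close> is the one wanted, since
    \<open>w \<one>\<close> is \<open>u \<otimes> y\<close>.\<close>
  have "f \<one> = c y"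
  proof (rule ccontr)
    assume "f \<one> \<noteq> c y"
    hence "f \<one> < c y" using fle[of \<one>] by simp
    hence "(\<Sum>x\<in>carrier G. f x) < (\<Sum>x\<in>carrier G. c y)"
      using fle fin by (intro sum_strict_mono_ex1) auto
    thus False using eq by simp
  qed
  hence "y \<in> conj_orbit (carrier G) (w \<one>)" using c_pos[OF y(1)] by (auto simp: f_def split: if_splits)
  hence "w \<one> \<in> conj_orbit (carrier G) y" using orbit_sym[OF wG[OF one_closed]] by blast
  thus ?thesis using uG y by (simp add: w_def)
qed

section \<open>Orders of the elements of \<open>N\<close> and arithmetic of
  \<open>\<beta>\<close>\<close>

lemma ord_N:
  assumes "x \<in> N" "x \<noteq> \<one>"
  shows "ord x = ord b"
  using assms b ord_conj by (auto simp: N_def K_def conj_orbit_def)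

text \<open>A suitable power of \<open>b\<close> has prime order \<open>q\<close>. It is a
  nontrivial element of \<open>N\<close>, hence conjugate to \<open>b\<close>, so \<open>b\<close>
  has order \<open>q\<close> as well.\<close>

lemma prime_ord_b: "prime (ord b)"
proof -
  have "ord b \<noteq> 1" using b b_ne_one ord_eq_1 by blast
  then obtain q where q: "prime q" "q dvd ord b" using prime_factor_nat by blast
  then obtain m where m: "ord b = q * m" by auto
  have N: "subgroup N G" using N_normal by (rule normal_imp_subgroup)
  have pos: "ord b > 0" using ord_ge_1[OF fin b] by simp
  have "(b [^] m) [^] q = \<one>" using b m pow_ord_eq_1[of b] by (simp add: nat_pow_pow mult.commute)
  have ne: "b [^] m \<noteq> \<one>"
  proof
    assume "b [^] m = \<one>"
    hence "ord b dvd m" using pow_eq_id[OF b] by simp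
    hence "ord b \<le> m" using pos m by (intro dvd_imp_le) auto
    moreover have "m < ord b" using m pos prime_gt_1_nat[OF q(1)] by simp
    ultimately show False by simp
  qed
  have "b [^] m \<in> N"
  proof (induction m)
    case (Suc m)
    thus ?case using subgroup.m_closed[OF N] b_in_K by (simp add: N_def[symmetric]) (simp add: N_def)
  qed (simp add: N_def)
  hence "ord (b [^] m) = ord b" using ord_N ne by blast
  hence "ord b dvd q" using \<open>(b [^] m) [^] q = \<one>\<close> pow_eq_id[of "b [^] m" q] b by simp
  thus ?thesis using q \<open>ord b \<noteq> 1\<close> by (metis prime_nat_iff)
qed

lemma card_N: "card N = Suc (card K)"
  unfolding N_def using one_notin_K finite_subset[OF K_carrier fin] by simp

text \<open>By Cauchy every prime divisor of \<open>card N\<close> is the order of a nontrivial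
  element of \<open>N\<close>, and all of these have order \<open>ord b\<close>. The exponent is
  positive because \<open>K\<close> is nonempty.\<close>

lemma card_N_power: "\<exists>n. card N = ord b ^ n \<and> n > 0"
proof -
  have N: "subgroup N G" using N_normal by (rule normal_imp_subgroup)
  have "\<exists>n. card N = ord b ^ n"
  proof (rule prime_power_of_prime_divisors[OF prime_ord_b])
    fix q assume q: "prime q" "q dvd card N"
    obtain h where h: "h \<in> N" "h \<noteq> \<one>" "h [^] q = \<one>" using Cauchy_element[OF fin N q] by blast
    hence "ord b dvd q" using ord_N[OF h(1,2)] pow_eq_id[of h q] N_carrier by auto
    thus "q = ord b" using primes_dvd_imp_eq[OF prime_ord_b q(1)] by simp
  qed (simp add: card_N)
  then obtain n where n: "card N = ord b ^ n" by blast
  have "card K > 0" using b_in_K finite_subset[OF K_carrier fin] by (auto simp: card_gt_0_iff)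
  hence "n > 0" using n card_N by (cases n) auto
  with n show ?thesis by blast
qed

lemma centralizer_card_eq': "of_nat (c b) = \<beta> ^ 2 * of_nat (card N)"
  using centralizer_card_eq degree_eq by (simp add: card_N algebra_simps power2_eq_square)

text \<open>Summing \<open>\<theta>\<close> over the subgroup generated by \<open>b\<close> shows
  that \<open>(p - 1) \<beta>\<close> is an integer \<open>e\<close>. Since
  \<open>\<beta>^2 |N|\<close> is the integer \<open>c b\<close>, the square of \<open>p - 1\<close>
  divides \<open>e^2 p^n\<close>, and by coprimality \<open>p - 1\<close> divides \<open>e\<close>.
  The sign comes from \<open>degree_eq\<close>.\<close>

lemma beta_nat: "\<exists>r::nat. \<beta> = of_nat r"
proof -
  define p where "p = ord b"
  have p: "prime p" using prime_ord_b by (simp add: p_def)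
  define Q where "Q = generate G {b}"
  have Q: "subgroup Q G" unfolding Q_def using b by (intro generate_is_subgroup) auto
  have cQ: "card Q = p" unfolding Q_def p_def using generate_pow_card[OF b] by simp
  have QN: "Q \<subseteq> N" unfolding Q_def
    using generate_subgroup_incl[of "{b}" N] normal_imp_subgroup[OF N_normal] b_in_K by (auto simp: N_def)
  have finQ: "finite Q" using QN finite_subset[OF N_carrier fin] finite_subset by blast
  have one: "\<one> \<in> Q" using subgroup.one_closed[OF Q] .
  obtain m where m: "(\<Sum>x\<in>Q. \<theta> x) = of_nat (card Q * m)" using Irr_subgroup_sum[OF \<theta> fin Q] by blast
  have "(\<Sum>x\<in>Q. \<theta> x) = \<theta> \<one> + (\<Sum>x\<in>Q - {\<one>}. \<theta> x)" by (rule sum.remove[OF finQ one])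
  also have "(\<Sum>x\<in>Q - {\<one>}. \<theta> x) = (\<Sum>x\<in>Q - {\<one>}. - \<beta>)"
    using QN theta_K by (intro sum.cong) (auto simp: N_def)
  also have "\<dots> = - (of_nat (p - 1) * \<beta>)" using cQ finQ one by (simp add: card_Diff_singleton)
  finally have eq: "of_nat (p - 1) * \<beta> = of_nat d - of_nat (p * m)" using m deg cQ by (simp add: algebra_simps)
  define e where "e = int d - int (p * m)"
  have e: "of_nat (p - 1) * \<beta> = of_int e" using eq by (simp add: e_def)
  obtain n where n: "card N = p ^ n" using card_N_power by (auto simp: p_def)
  have "of_nat (p - 1) ^ 2 * (of_nat (c b) :: complex) = of_int e ^ 2 * of_nat (card N)"
    unfolding e[symmetric] centralizer_card_eq' by (simp add: power_mult_distrib)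
  hence "of_int (int (p - 1) ^ 2 * int (c b)) = (of_int (e ^ 2 * int p ^ n) :: complex)"
    by (simp add: n)
  hence "int (p - 1) ^ 2 * int (c b) = e ^ 2 * int p ^ n" by (simp only: of_int_eq_iff)
  hence "int (p - 1) ^ 2 dvd e ^ 2 * int p ^ n" by (metis dvd_triv_left)
  moreover have "coprime (int (p - 1) ^ 2) (int p ^ n)"
  proof -
    have "coprime (int (p - 1)) (int p)"
      using prime_gt_1_nat[OF p] coprime_diff_one_left_nat[of p] by simp
    thus ?thesis by simp
  qed
  ultimately have "int (p - 1) ^ 2 dvd e ^ 2" by (simp add: coprime_dvd_mult_left_iff)
  hence "int (p - 1) dvd e" by simp
  then obtain r where r: "e = int (p - 1) * r" by auto
  have "of_nat (p - 1) * \<beta> = of_nat (p - 1) * of_int r" unfolding e r by simp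
  moreover have "(of_nat (p - 1) :: complex) \<noteq> 0" using prime_gt_1_nat[OF p] by simp
  ultimately have \<beta>: "\<beta> = of_int r" by simp
  have "(of_int (int d) :: complex) = of_int (int (card K) * r)" using degree_eq \<beta> by simp
  hence "int d = int (card K) * r" by (simp only: of_int_eq_iff)
  hence "r > 0" using d_pos by (metis of_nat_0_le_iff of_nat_0_less_iff zero_less_mult_pos not_le mult_nonneg_nonpos)
  hence "\<beta> = of_nat (nat r)" using \<beta> by simp
  thus ?thesis by blast
qed

text \<open>The natural number provided by \<open>beta_nat\<close>, so that divisibility arguments
  apply to \<open>\<beta>\<close>.\<close>

definition r :: nat where "r = nat \<lfloor>Re \<beta>\<rfloor>"

lemma beta_r: "\<beta> = of_nat r"
  using beta_nat by (auto simp: r_def)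

lemma d_eq: "d = card K * r"
proof -
  have "(of_nat d :: complex) = of_nat (card K * r)" using degree_eq beta_r by simp
  thus ?thesis by (simp only: of_nat_eq_iff)
qed

lemma c_eq: "c b = r ^ 2 * card N"
proof -
  have "(of_nat (c b) :: complex) = of_nat (r ^ 2 * card N)" using centralizer_card_eq' beta_r by simp
  thus ?thesis by (simp only: of_nat_eq_iff)
qed

lemma order_eq': "Coset.order G = r ^ 2 * card N * card K"
  using card_orbit[OF b] c_eq by (simp add: K_def mult.commute)

text \<open>Suppose a prime \<open>q\<close> other than \<open>ord b\<close> divides
  \<open>r\<close>. A Sylow \<open>q\<close>-subgroup \<open>Q\<close> meets \<open>N\<close>
  trivially, so \<open>\<theta>\<close> sums to \<open>d\<close> over it and \<open>card Q\<close>
  divides \<open>d\<close>. As the group order is \<open>d r |N|\<close>, it would contain one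
  factor \<open>q\<close> too many.\<close>

lemma beta_power: "\<exists>t. r = ord b ^ t"
proof (rule prime_power_of_prime_divisors[OF prime_ord_b])
  show "r > 0" using d_eq d_pos by (cases r) auto
  fix q assume q: "prime q" "q dvd r"
  show "q = ord b"
  proof (rule ccontr)
    assume qp: "q \<noteq> ord b"
    define a where "a = multiplicity q (Coset.order G)"
    obtain m where m: "Coset.order G = q ^ a * m" unfolding a_def using multiplicity_dvd by (metis dvdE)
    then obtain Q where Q: "subgroup Q G" "card Q = q ^ a"
      using sylow_thm[OF q(1) is_group _ fin] by blast
    have QG: "Q \<subseteq> carrier G" using Q(1) by (rule subgroup.subset)
    have finQ: "finite Q" using QG fin finite_subset by blast
    have one: "\<one> \<in> Q" using subgroup.one_closed[OF Q(1)] .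
    \<comment> \<open>A nontrivial element of \<open>N\<close> has order \<open>ord b\<close>, which
      cannot divide a power of \<open>q\<close>.\<close>
    have notN: "x \<notin> N" if x: "x \<in> Q" "x \<noteq> \<one>" for x
    proof
      assume xN: "x \<in> N"
      interpret Q: group "G\<lparr>carrier := Q\<rparr>" by (rule subgroup.subgroup_is_group[OF Q(1) is_group])
      have "x [^]\<^bsub>G\<lparr>carrier := Q\<rparr>\<^esub> Coset.order (G\<lparr>carrier := Q\<rparr>) = \<one>"
        using Q.pow_order_eq_1[of x] x by simp
      hence "x [^] Coset.order (G\<lparr>carrier := Q\<rparr>) = \<one>"
        unfolding nat_pow_consistent[of x _ Q, symmetric] .
      hence "x [^] (q ^ a) = \<one>" using Q(2) by (simp add: Coset.order_def)
      hence "ord b dvd q ^ a" using ord_N[OF xN x(2)] pow_eq_id[of x] x QG by auto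
      hence "ord b dvd q" using prime_ord_b prime_dvd_power by blast
      thus False using primes_dvd_imp_eq[OF prime_ord_b q(1)] qp by simp
    qed
    obtain m' where m': "(\<Sum>x\<in>Q. \<theta> x) = of_nat (card Q * m')" using Irr_subgroup_sum[OF \<theta> fin Q(1)] by blast
    have "(\<Sum>x\<in>Q - {\<one>}. \<theta> x) = 0"
      using notN theta_outside QG by (intro sum.neutral) auto
    hence "(\<Sum>x\<in>Q. \<theta> x) = of_nat d" using sum.remove[OF finQ one, of \<theta>] deg by simp
    hence "(of_nat d :: complex) = of_nat (card Q * m')" using m' by simp
    hence "d = card Q * m'" by (simp only: of_nat_eq_iff)
    hence "q ^ a dvd card K * r" using d_eq Q(2) by simp
    hence "q ^ a * q dvd (card K * r) * r" using q(2) by (rule mult_dvd_mono)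
    moreover have "Coset.order G = (card K * r) * r * card N"
      unfolding order_eq' by (simp add: power2_eq_square mult_ac)
    ultimately have "q ^ Suc a dvd Coset.order G" by (simp add: mult.commute[of q] dvd_mult2)
    moreover have "Coset.order G \<noteq> 0" "\<not> is_unit q" using order_pos q(1) by auto
    ultimately have "Suc a \<le> a" unfolding a_def by (intro multiplicity_geI) auto
    thus False by simp
  qed
qed

lemma s_nat_eq: "s = d * r"
proof -
  have "(of_nat s :: complex) = of_nat (d * r)" using sum_b beta_r by simp
  thus ?thesis by (simp only: of_nat_eq_iff)
qed

text \<open>The square of the degree is below \<open>s = d r\<close>, and \<open>r \<le> d\<close>.
  This is what makes \<open>\<theta>\<close> the last character in a numbering by degree.\<close>

lemma degree_less_d:
  assumes "\<chi> \<in> Irr G" "\<chi> \<noteq> \<theta>" "\<chi> \<noteq> trivial_character G"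
  shows "Re (\<chi> \<one>) < Re (\<theta> \<one>)"
proof -
  have "card K > 0" using b_in_K finite_subset[OF K_carrier fin] by (auto simp: card_gt_0_iff)
  hence "r \<le> d" unfolding d_eq by simp
  hence "s \<le> d ^ 2" unfolding s_nat_eq by (simp add: power2_eq_square)
  hence "degree_of \<chi> ^ 2 < d ^ 2" using degree_square_less[OF assms] by simp
  hence "degree_of \<chi> < d" by (rule power_less_imp_less_base) simp
  thus ?thesis using degree_of[OF assms(1)] deg by simp
qed

end

text \<open>Gives names to the prime and to the exponents whose existence is
  \<open>card_N_power\<close> and \<open>beta_power\<close>.\<close>

locale CD1_prime = CD1_row +
  fixes p n t :: nat
  assumes p_eq: "p = ord b" and cN: "card N = p ^ n" and r_pow: "r = p ^ t"
begin

section \<open>Sylow \<open>p\<close>-subgroups as centralizers\<close>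

lemma p: "prime p"
  using prime_ord_b p_eq by simp

lemma n_pos: "n > 0"
  using cN card_N b_in_K finite_subset[OF K_carrier fin] by (cases n) (auto simp: card_eq_0_iff)

lemma N_subgroup: "subgroup N G"
  using N_normal by (rule normal_imp_subgroup)

lemma finK: "finite K"
  using finite_subset[OF K_carrier fin] .

text \<open>\<open>card K\<close> is one less than a positive power of \<open>p\<close>.\<close>

lemma not_dvd_card_K: "\<not> p dvd card K"
proof
  assume "p dvd card K"
  moreover have "p dvd card N" using cN n_pos by simp
  ultimately have "p dvd 1" unfolding card_N using dvd_diff_nat[of p "Suc (card K)" "card K"] by simp
  thus False using p by simp
qed

lemma c_K: "x \<in> K \<Longrightarrow> c x = p ^ (n + 2 * t)"
  using c_orbit[OF b, of x] c_eq cN r_pow by (simp add: K_def power_add power_mult mult.commute power2_eq_square)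

text \<open>Together with \<open>not_dvd_card_K\<close> this isolates the \<open>p\<close>-part of
  the group order, which is the order of the centralizer of an element of \<open>K\<close>.\<close>

lemma order_factor: "Coset.order G = p ^ (n + 2 * t) * card K"
  using card_orbit[OF b] c_K[OF b_in_K] by (simp add: K_def mult.commute)

lemma multiplicity_order: "multiplicity p (Coset.order G) = n + 2 * t"
  using order_factor not_dvd_card_K p by (intro multiplicity_decomposeI) auto

lemma Syl_iff: "P \<in> Syl p G \<longleftrightarrow> subgroup P G \<and> card P = p ^ (n + 2 * t)"
  by (simp add: Syl_def multiplicity_order)

lemma K_in_carrier: "x \<in> K \<Longrightarrow> x \<in> carrier G"
  using K_carrier by auto

lemma centralizer_Syl: "x \<in> K \<Longrightarrow> centralizer G {x} \<in> Syl p G"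
  using c_K K_in_carrier centralizer_subgroup[of "{x}"] by (simp add: Syl_iff c_def)

lemma conj_K: "g \<in> carrier G \<Longrightarrow> x \<in> K \<Longrightarrow> g \<otimes> x \<otimes> inv g \<in> K"
  using K_orbit[of x] by (auto simp: conj_orbit_def)

text \<open>\<open>P\<close> acts on \<open>K\<close> by conjugation. As \<open>p\<close> does not
  divide \<open>card K\<close> there is a fixed point, and \<open>P\<close> fills its centralizer
  because the orders agree.\<close>

lemma Syl_centralizer:
  assumes P: "P \<in> Syl p G"
  obtains x where "x \<in> K" "P = centralizer G {x}"
proof -
  have P': "subgroup P G" "card P = p ^ (n + 2 * t)" using P by (auto simp: Syl_iff)
  obtain x where x: "x \<in> K" "\<And>g. g \<in> P \<Longrightarrow> g \<otimes> x = x \<otimes> g"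
    using pgroup_fixed_point[OF P' p finK K_carrier _ not_dvd_card_K] conj_K subgroup.mem_carrier[OF P'(1)]
    by blast
  have "P \<subseteq> centralizer G {x}" using x(2) subgroup.mem_carrier[OF P'(1)] by (auto simp: mem_centralizer)
  moreover have "card (centralizer G {x}) = card P" using c_K[OF x(1)] P'(2) by (simp add: c_def)
  moreover have "finite (centralizer G {x})"
    using fin by (rule finite_subset[rotated]) (auto simp: mem_centralizer)
  ultimately have "P = centralizer G {x}" by (intro card_subset_eq) auto
  with x(1) that show ?thesis by blast
qed

text \<open>\<open>H\<close> fixes some \<open>s\<close> in \<open>K\<close>. As \<open>K\<close> is
  a single class and \<open>H\<close> is normal, conjugation transports this to all of
  \<open>K\<close>.\<close>

lemma normal_pgroup_centralizes:
  assumes H: "H \<lhd> G" "card H = p ^ a"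
  shows "H \<subseteq> centralizer G N"
proof
  have Hs: "subgroup H G" using H(1) by (rule normal_imp_subgroup)
  note HG = subgroup.mem_carrier[OF Hs]
  obtain s where s: "s \<in> K" "\<And>h. h \<in> H \<Longrightarrow> h \<otimes> s = s \<otimes> h"
    using pgroup_fixed_point[OF Hs H(2) p finK K_carrier _ not_dvd_card_K] conj_K HG by blast
  have sG: "s \<in> carrier G" using s K_in_carrier by auto
  fix h assume h: "h \<in> H"
  have "h \<otimes> u = u \<otimes> h" if u: "u \<in> K" for u
  proof -
    obtain g where g: "g \<in> carrier G" "u = g \<otimes> s \<otimes> inv g"
      using u K_orbit[OF s(1)] by (auto simp: conj_orbit_def)
    define k where "k = inv g \<otimes> h \<otimes> g"
    have kH: "k \<in> H" using H(1) g h HG unfolding normal_inv_iff k_def by (metis inv_closed inv_inv)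
    have kG: "k \<in> carrier G" using HG[OF kH] .
    have h_eq: "h = g \<otimes> k \<otimes> inv g"
      unfolding k_def using g HG[OF h] by (simp add: m_assoc) (simp add: m_assoc[symmetric])
    have "h \<otimes> u = g \<otimes> (k \<otimes> s) \<otimes> inv g" unfolding h_eq g(2) by (rule conj_hom[symmetric, OF g(1) kG sG])
    also have "\<dots> = g \<otimes> (s \<otimes> k) \<otimes> inv g" using s(2)[OF kH] by simp
    also have "\<dots> = u \<otimes> h" unfolding h_eq g(2) by (rule conj_hom[OF g(1) sG kG])
    finally show ?thesis .
  qed
  thus "h \<in> centralizer G N" using HG[OF h] by (auto simp: centralizer_def N_def)
qed

lemma N_abelian: "N \<subseteq> centralizer G N"
  by (rule normal_pgroup_centralizes[OF N_normal cN])

lemma centralizer_N_subset: "x \<in> K \<Longrightarrow> centralizer G N \<subseteq> centralizer G {x}"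
  by (auto simp: centralizer_def N_def)

text \<open>\<open>N\<close> is abelian, so it lies in its own centralizer, which lies in the
  centralizer of each element of \<open>K\<close>.\<close>

lemma N_subset_Syl: "P \<in> Syl p G \<Longrightarrow> N \<subseteq> P"
proof -
  assume "P \<in> Syl p G"
  then obtain x where "x \<in> K" "P = centralizer G {x}" by (rule Syl_centralizer)
  thus ?thesis using N_abelian centralizer_N_subset by blast
qed

lemma center_centralizer: "x \<in> K \<Longrightarrow> x \<in> group_center (G\<lparr>carrier := centralizer G {x}\<rparr>)"
  using K_in_carrier by (auto simp: mem_group_center mem_centralizer)

text \<open>\<open>P\<close> lies in the centralizer of its central element \<open>x\<close>, and
  the orders agree.\<close>

lemma Syl_unique:
  assumes P: "P \<in> Syl p G" and x: "x \<in> K" "x \<in> group_center (G\<lparr>carrier := P\<rparr>)"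
  shows "P = centralizer G {x}"
proof (rule card_subset_eq)
  have P': "subgroup P G" "card P = p ^ (n + 2 * t)" using P by (auto simp: Syl_iff)
  show "finite (centralizer G {x})"
    using fin by (rule finite_subset[rotated]) (auto simp: mem_centralizer)
  show "P \<subseteq> centralizer G {x}"
  proof
    fix y assume y: "y \<in> P"
    hence "x \<otimes> y = y \<otimes> x" using x(2) by (simp add: mem_group_center)
    thus "y \<in> centralizer G {x}" using subgroup.mem_carrier[OF P'(1) y] by (simp add: mem_centralizer)
  qed
  show "card P = card (centralizer G {x})" using c_K[OF x(1)] P'(2) by (simp add: c_def)
qed

text \<open>By \<open>coset_conj\<close> the class of \<open>y\<close> is a union of cosets of
  \<open>N\<close>. Both the location of the Sylow centers and the Camina property rest on this
  count.\<close>

lemma orbit_cosets: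
  assumes y: "y \<in> carrier G" "y \<notin> N"
  shows "card N * card ((\<lambda>z. N #> z) ` conj_orbit (carrier G) y) = card (conj_orbit (carrier G) y)"
proof -
  define orb where "orb = conj_orbit (carrier G) y"
  have orbG: "orb \<subseteq> carrier G" unfolding orb_def using orbit_mem_carrier y by blast
  have fin_orb: "finite orb" using finite_subset[OF orbG fin] .
  have orbN: "z \<notin> N" if z: "z \<in> orb" for z
  proof
    assume zN: "z \<in> N"
    have "y \<in> conj_orbit (carrier G) z" using z y orbit_sym unfolding orb_def by blast
    then obtain g where "g \<in> carrier G" "y = g \<otimes> z \<otimes> inv g" by (auto simp: conj_orbit_def)
    hence "y \<in> N" using N_normal zN unfolding normal_inv_iff by blast
    with y show False by simp
  qed
  have sub: "N #> z \<subseteq> orb" if z: "z \<in> orb" for z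
  proof
    fix w assume "w \<in> N #> z"
    then obtain u where u: "u \<in> N" "w = u \<otimes> z" by (auto simp: r_coset_def)
    have "w \<in> conj_orbit (carrier G) z" unfolding u(2) using u(1) z orbG orbN by (intro coset_conj) auto
    thus "w \<in> orb" using z orbit_eq[OF y(1)] unfolding orb_def by blast
  qed
  have U: "\<Union> ((\<lambda>z. N #> z) ` orb) = orb"
  proof
    show "\<Union> ((\<lambda>z. N #> z) ` orb) \<subseteq> orb" using sub by blast
    show "orb \<subseteq> \<Union> ((\<lambda>z. N #> z) ` orb)" using rcos_self[OF _ N_subgroup] orbG by blast
  qed
  have inR: "N #> z \<in> rcosets N" if "z \<in> orb" for z using that orbG rcosetsI[OF N_carrier] by blast
  have "card N * card ((\<lambda>z. N #> z) ` orb) = card (\<Union> ((\<lambda>z. N #> z) ` orb))"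
  proof (rule card_partition)
    show "finite ((\<lambda>z. N #> z) ` orb)" using fin_orb by simp
    show "finite (\<Union> ((\<lambda>z. N #> z) ` orb))" unfolding U by (rule fin_orb)
    fix C assume "C \<in> (\<lambda>z. N #> z) ` orb"
    hence "C \<in> rcosets N" using inR by blast
    thus "card C = card N" using card_cosets_equal[OF _ N_carrier] bij_betw_same_card by metis
  next
    fix C D assume "C \<in> (\<lambda>z. N #> z) ` orb" "D \<in> (\<lambda>z. N #> z) ` orb" "C \<noteq> D"
    hence "C \<in> rcosets N" "D \<in> rcosets N" "C \<noteq> D" using inR by blast+
    thus "C \<inter> D = {}" using rcos_disjoint[OF N_subgroup] by (simp add: pairwise_def disjnt_def)
  qed
  thus ?thesis using U by (simp add: orb_def)
qed

text \<open>For a central \<open>y\<close> outside \<open>N\<close> the class length is divisible by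
  \<open>card N\<close>, hence by \<open>p\<close>, and the centralizer order by
  \<open>card P\<close>. Their product is the group order, whose \<open>p\<close>-part is only
  \<open>card P\<close>.\<close>

lemma center_subset_N:
  assumes P: "P \<in> Syl p G"
  shows "group_center (G\<lparr>carrier := P\<rparr>) \<subseteq> N"
proof
  fix y assume y: "y \<in> group_center (G\<lparr>carrier := P\<rparr>)"
  have P': "subgroup P G" "card P = p ^ (n + 2 * t)" using P by (auto simp: Syl_iff)
  have yP: "y \<in> P" and comm: "\<And>z. z \<in> P \<Longrightarrow> y \<otimes> z = z \<otimes> y" using y by (auto simp: mem_group_center)
  have yG: "y \<in> carrier G" using subgroup.mem_carrier[OF P'(1) yP] .
  show "y \<in> N"
  proof (rule ccontr)
    assume "y \<notin> N"
    hence "card N dvd card (conj_orbit (carrier G) y)" using orbit_cosets[OF yG] by (metis dvd_triv_left)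
    hence "p dvd card (conj_orbit (carrier G) y)" using n_pos cN by (metis dvd_power dvd_trans)
    moreover have "P \<subseteq> centralizer G {y}"
      using comm subgroup.mem_carrier[OF P'(1)] by (auto simp: mem_centralizer)
    hence "p ^ (n + 2 * t) dvd c y"
      using card_subgroup_dvd[OF fin P'(1) centralizer_subgroup[of "{y}"]] yG P'(2) by (simp add: c_def)
    ultimately have "p * p ^ (n + 2 * t) dvd Coset.order G"
      unfolding card_orbit[OF yG, symmetric] by (rule mult_dvd_mono)
    hence "p ^ (n + 2 * t) * p dvd p ^ (n + 2 * t) * card K" unfolding order_factor by (simp only: mult.commute)
    hence "p dvd card K" using p by simp
    with not_dvd_card_K show False by simp
  qed
qed

section \<open>Centers of the Sylow subgroups\<close>

lemma one_in_center: "P \<in> Syl p G \<Longrightarrow> \<one> \<in> group_center (G\<lparr>carrier := P\<rparr>)"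
proof -
  assume "P \<in> Syl p G"
  hence P: "subgroup P G" by (simp add: Syl_iff)
  show ?thesis unfolding mem_group_center
    using subgroup.one_closed[OF P] subgroup.mem_carrier[OF P] by auto
qed

lemma center_union: "N = (\<Union>P \<in> Syl p G. group_center (G\<lparr>carrier := P\<rparr>))"
proof
  show "(\<Union>P \<in> Syl p G. group_center (G\<lparr>carrier := P\<rparr>)) \<subseteq> N" using center_subset_N by blast
  show "N \<subseteq> (\<Union>P \<in> Syl p G. group_center (G\<lparr>carrier := P\<rparr>))"
  proof
    fix x assume "x \<in> N"
    then consider "x = \<one>" | "x \<in> K" by (auto simp: N_def)
    thus "x \<in> (\<Union>P \<in> Syl p G. group_center (G\<lparr>carrier := P\<rparr>))"
    proof cases
      case 1
      thus ?thesis using one_in_center centralizer_Syl[OF b_in_K] by blast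
    next
      case 2
      thus ?thesis using centralizer_Syl center_centralizer by blast
    qed
  qed
qed

text \<open>A common nontrivial central element lies in \<open>K\<close>, and by
  \<open>Syl_unique\<close> both subgroups equal its centralizer.\<close>

lemma center_inter:
  assumes P: "P \<in> Syl p G" and Q: "Q \<in> Syl p G" and neq: "P \<noteq> Q"
  shows "group_center (G\<lparr>carrier := P\<rparr>) \<inter> group_center (G\<lparr>carrier := Q\<rparr>) = {\<one>}"
proof
  show "group_center (G\<lparr>carrier := P\<rparr>) \<inter> group_center (G\<lparr>carrier := Q\<rparr>) \<subseteq> {\<one>}"
  proof
    fix x assume x: "x \<in> group_center (G\<lparr>carrier := P\<rparr>) \<inter> group_center (G\<lparr>carrier := Q\<rparr>)"
    show "x \<in> {\<one>}"
    proof (rule ccontr)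
      assume "x \<notin> {\<one>}"
      hence "x \<in> K" using x center_subset_N[OF P] by (auto simp: N_def)
      hence "P = Q" using x Syl_unique[OF P] Syl_unique[OF Q] by blast
      with neq show False by simp
    qed
  qed
qed (use one_in_center P Q in auto)

text \<open>An abelian \<open>P\<close> equals its center, which lies in \<open>N\<close>, while
  \<open>N\<close> lies in \<open>P\<close>.\<close>

lemma not_abelian:
  assumes "N \<notin> Syl p G" and P: "P \<in> Syl p G"
  shows "\<not> comm_group (G\<lparr>carrier := P\<rparr>)"
proof
  assume "comm_group (G\<lparr>carrier := P\<rparr>)"
  then interpret P: comm_group "G\<lparr>carrier := P\<rparr>" .
  have "P \<subseteq> group_center (G\<lparr>carrier := P\<rparr>)"
    using P.m_comm by (auto simp: mem_group_center)
  hence "P = N" using center_subset_N[OF P] N_subset_Syl[OF P] by blast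
  with assms show False by simp
qed

lemma center_nontrivial:
  assumes "P \<in> Syl p G"
  obtains x where "x \<in> K" "x \<in> group_center (G\<lparr>carrier := P\<rparr>)" "P = centralizer G {x}"
proof -
  obtain x where "x \<in> K" "P = centralizer G {x}" using assms by (rule Syl_centralizer)
  with that center_centralizer show ?thesis by blast
qed

text \<open>If the center is \<open>N\<close>, then \<open>P\<close> lies in the centralizer of
  \<open>N\<close>, which lies in the centralizer of some \<open>x\<close> in \<open>K\<close>,
  which is \<open>P\<close> again; so \<open>P\<close> is the centralizer of a normal subgroup.
  Conversely a normal \<open>P\<close> centralizes \<open>N\<close> and contains it.\<close>

lemma center_eq_N_iff:
  assumes P: "P \<in> Syl p G"
  shows "group_center (G\<lparr>carrier := P\<rparr>) = N \<longleftrightarrow> P \<lhd> G"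
proof
  have Ps: "subgroup P G" using P by (simp add: Syl_iff)
  assume Z: "group_center (G\<lparr>carrier := P\<rparr>) = N"
  have "P \<subseteq> centralizer G N"
  proof
    fix y assume y: "y \<in> P"
    have "y \<otimes> u = u \<otimes> y" if "u \<in> N" for u
      using that y unfolding Z[symmetric] mem_group_center by auto
    thus "y \<in> centralizer G N" using subgroup.mem_carrier[OF Ps y] by (simp add: centralizer_def)
  qed
  moreover obtain x where x: "x \<in> K" "P = centralizer G {x}" using P by (rule Syl_centralizer)
  ultimately have "P = centralizer G N" using centralizer_N_subset by blast
  thus "P \<lhd> G" using centralizer_normal[OF N_normal] by simp
next
  assume PN: "P \<lhd> G"
  have "card P = p ^ (n + 2 * t)" using P by (simp add: Syl_iff)
  hence "P \<subseteq> centralizer G N" using normal_pgroup_centralizes PN by blast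
  hence "N \<subseteq> group_center (G\<lparr>carrier := P\<rparr>)"
    using N_subset_Syl[OF P] unfolding centralizer_def by (fastforce simp: mem_group_center)
  thus "group_center (G\<lparr>carrier := P\<rparr>) = N" using center_subset_N[OF P] by blast
qed

section \<open>The \<open>p\<close>-core and the core of order prime to \<open>p\<close>\<close>

lemma centralizer_N_card: "\<exists>i. card (centralizer G N) = p ^ i"
proof -
  have "card (centralizer G N) dvd c b"
    unfolding c_def using b N_carrier centralizer_N_subset[OF b_in_K]
    by (intro card_subgroup_dvd[OF fin] centralizer_subgroup) auto
  thus ?thesis unfolding c_K[OF b_in_K] using divides_primepow_nat[OF p] by blast
qed

text \<open>The centralizer of \<open>N\<close> is normal, and a \<open>p\<close>-group since it
  lies in that of \<open>b\<close>. Conversely \<open>normal_pgroup_centralizes\<close> applies to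
  each subgroup generating the core.\<close>

lemma centralizer_N_eq_core: "centralizer G N = pi_core G {p}"
proof
  obtain i where "card (centralizer G N) = p ^ i" using centralizer_N_card by blast
  hence "prime_factors (card (centralizer G N)) \<subseteq> {p}"
  proof (intro subsetI)
    fix q assume "q \<in> prime_factors (card (centralizer G N))"
    hence q: "prime q" "q dvd p ^ i" using \<open>card (centralizer G N) = p ^ i\<close> by auto
    hence "q dvd p" using prime_dvd_power by blast
    thus "q \<in> {p}" using primes_dvd_imp_eq[OF q(1) p] by simp
  qed
  hence "centralizer G N \<subseteq> \<Union>{H. H \<lhd> G \<and> prime_factors (card H) \<subseteq> {p}}"
    using centralizer_normal[OF N_normal] by blast
  thus "centralizer G N \<subseteq> pi_core G {p}" unfolding pi_core_def by (meson generate.incl subsetD subsetI)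
  show "pi_core G {p} \<subseteq> centralizer G N"
    unfolding pi_core_def
  proof (rule generate_subgroup_incl[OF _ centralizer_subgroup[OF N_carrier]], rule Union_least)
    fix H assume "H \<in> {H. H \<lhd> G \<and> prime_factors (card H) \<subseteq> {p}}"
    hence H: "H \<lhd> G" and pf: "prime_factors (card H) \<subseteq> {p}" by auto
    have Hs: "subgroup H G" using H by (rule normal_imp_subgroup)
    have "card H > 0"
      using subgroup.one_closed[OF Hs] finite_subset[OF subgroup.subset[OF Hs] fin] by (auto simp: card_gt_0_iff)
    hence "\<exists>a. card H = p ^ a"
      using pf by (intro prime_power_of_prime_divisors[OF p]) (auto simp: in_prime_factors_iff)
    thus "H \<subseteq> centralizer G N" using normal_pgroup_centralizes[OF H] by blast
  qed
qed

text \<open>A normal subgroup \<open>H\<close> of order prime to \<open>p\<close> meets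
  \<open>N\<close> trivially. Commutators of its elements with \<open>b\<close> lie in both, so
  \<open>H\<close> centralizes \<open>b\<close>; but the centralizer of \<open>b\<close> is a
  \<open>p\<close>-group.\<close>

lemma complement_core_trivial: "pi_core G (- {p}) = {\<one>}"
proof
  show "{\<one>} \<subseteq> pi_core G (- {p})" unfolding pi_core_def by (simp add: generate.one)
  show "pi_core G (- {p}) \<subseteq> {\<one>}"
    unfolding pi_core_def
  proof (rule generate_subgroup_incl[OF _ triv_subgroup], rule Union_least)
    fix H assume "H \<in> {H. H \<lhd> G \<and> prime_factors (card H) \<subseteq> - {p}}"
    hence H: "H \<lhd> G" and pf: "prime_factors (card H) \<subseteq> - {p}" by auto
    have Hs: "subgroup H G" using H by (rule normal_imp_subgroup)
    note HG = subgroup.mem_carrier[OF Hs]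
    have "card H > 0"
      using subgroup.one_closed[OF Hs] finite_subset[OF subgroup.subset[OF Hs] fin] by (auto simp: card_gt_0_iff)
    hence np: "\<not> p dvd card H" using pf p by (auto simp: in_prime_factors_iff)
    have trivial: "x = \<one>" if x: "x \<in> H" "x [^] (p ^ i) = \<one>" for x i
    proof -
      interpret H: group "G\<lparr>carrier := H\<rparr>" by (rule subgroup.subgroup_is_group[OF Hs is_group])
      have "x [^]\<^bsub>G\<lparr>carrier := H\<rparr>\<^esub> Coset.order (G\<lparr>carrier := H\<rparr>) = \<one>"
        using H.pow_order_eq_1[of x] x by simp
      hence "x [^] Coset.order (G\<lparr>carrier := H\<rparr>) = \<one>"
        unfolding nat_pow_consistent[of x _ H, symmetric] .
      hence dvd: "ord x dvd card H" using pow_eq_id[OF HG[OF x(1)]] by (simp add: Coset.order_def)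
      have "ord x dvd p ^ i" using pow_eq_id[OF HG[OF x(1)], of "p ^ i"] x(2) by simp
      then obtain j where j: "ord x = p ^ j" using divides_primepow_nat[OF p] by blast
      have "j = 0"
      proof (rule ccontr)
        assume "j \<noteq> 0"
        hence "p dvd ord x" unfolding j by simp
        thus False using dvd np dvd_trans by blast
      qed
      hence "ord x = 1" using j by simp
      thus ?thesis using ord_eq_1[OF HG[OF x(1)]] by blast
    qed
    have inter: "x = \<one>" if "x \<in> H" "x \<in> N" for x
    proof (rule ccontr)
      assume "x \<noteq> \<one>"
      hence "ord x = p" using ord_N that p_eq by simp
      hence "x [^] (p ^ 1) = \<one>" using pow_ord_eq_1[OF HG[OF that(1)]] by simp
      thus False using trivial that \<open>x \<noteq> \<one>\<close> by blast
    qed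
    have "h = \<one>" if h: "h \<in> H" for h
    proof -
      have hG: "h \<in> carrier G" using HG[OF h] .
      \<comment> \<open>The commutator of \<open>h\<close> and \<open>b\<close> is bracketed in two
        ways, once as a product inside \<open>N\<close> and once as a product inside
        \<open>H\<close>.\<close>
      have "h \<otimes> b \<otimes> inv h \<in> N" "inv b \<in> N"
        using conj_K[OF hG b_in_K] inv_K[OF b_in_K] by (auto simp: N_def)
      hence inN: "h \<otimes> b \<otimes> inv h \<otimes> inv b \<in> N" by (rule subgroup.m_closed[OF N_subgroup])
      have "\<forall>x\<in>carrier G. \<forall>h\<in>H. x \<otimes> h \<otimes> inv x \<in> H" using H unfolding normal_inv_iff by (rule conjunct2)
      hence "b \<otimes> inv h \<otimes> inv b \<in> H" using b subgroup.m_inv_closed[OF Hs h] by blast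
      with h have "h \<otimes> (b \<otimes> inv h \<otimes> inv b) \<in> H" by (rule subgroup.m_closed[OF Hs])
      also have "h \<otimes> (b \<otimes> inv h \<otimes> inv b) = h \<otimes> b \<otimes> inv h \<otimes> inv b" using hG b by (simp add: m_assoc)
      finally have "h \<otimes> b \<otimes> inv h \<otimes> inv b = \<one>" using inN by (rule inter)
      hence "h \<otimes> b \<otimes> inv h = b" using mult_inv_eq_one[of "h \<otimes> b \<otimes> inv h" b] hG b by simp
      hence hC: "h \<in> centralizer G {b}" using conj_eq_iff[OF hG b b] hG by (simp add: mem_centralizer)
      interpret C: group "G\<lparr>carrier := centralizer G {b}\<rparr>"
        using b by (intro subgroup.subgroup_is_group[OF centralizer_subgroup is_group]) auto
      have "h [^]\<^bsub>G\<lparr>carrier := centralizer G {b}\<rparr>\<^esub> Coset.order (G\<lparr>carrier := centralizer G {b}\<rparr>) = \<one>"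
        using C.pow_order_eq_1[of h] hC by simp
      hence "h [^] Coset.order (G\<lparr>carrier := centralizer G {b}\<rparr>) = \<one>"
        unfolding nat_pow_consistent[of h _ "centralizer G {b}", symmetric] .
      hence "h [^] (p ^ (n + 2 * t)) = \<one>" using c_K[OF b_in_K] by (simp add: Coset.order_def c_def)
      thus ?thesis using trivial h by blast
    qed
    thus "H \<subseteq> {\<one>}" by blast
  qed
qed

text \<open>The class of \<open>N #> x\<close> is the image of the class of \<open>x\<close>. By
  \<open>orbit_cosets\<close> it is smaller by the factor \<open>card N\<close>, just as the
  quotient group is, so the two centralizer orders agree.\<close>

lemma quotient_centralizer_card:
  assumes x: "x \<in> carrier G" "x \<notin> N"
  shows "card (centralizer G {x}) = card (centralizer (G Mod N) {N #> x})"
proof -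
  interpret N: normal N G by (rule N_normal)
  interpret Q: group "G Mod N" by (rule N.factorgroup_is_group)
  interpret hom: group_hom G "G Mod N" "\<lambda>a. N #> a"
    using N.r_coset_hom_Mod by unfold_locales
  have carQ: "carrier (G Mod N) = (\<lambda>a. N #> a) ` carrier G" by (rule carrier_FactGroup)
  have finQ: "finite (carrier (G Mod N))" unfolding carQ using fin by simp
  have xQ: "N #> x \<in> carrier (G Mod N)" unfolding carQ using x by blast
  have "Q.conj_orbit (carrier (G Mod N)) (N #> x) = (\<lambda>a. N #> a) ` conj_orbit (carrier G) x"
    unfolding Q.conj_orbit_def conj_orbit_def carQ image_image
  proof (intro image_cong refl)
    fix g assume g: "g \<in> carrier G"
    show "(N #> g) \<otimes>\<^bsub>G Mod N\<^esub> (N #> x) \<otimes>\<^bsub>G Mod N\<^esub> inv\<^bsub>G Mod N\<^esub> (N #> g) = N #> (g \<otimes> x \<otimes> inv g)"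
      unfolding hom.hom_mult[OF m_closed[OF g x(1)] inv_closed[OF g]] hom.hom_mult[OF g x(1)] hom.hom_inv[OF g] ..
  qed
  hence 1: "card (conj_orbit (carrier G) x) = card N * card (Q.conj_orbit (carrier (G Mod N)) (N #> x))"
    using orbit_cosets[OF x] by simp
  have 2: "card (Q.conj_orbit (carrier (G Mod N)) (N #> x)) * card (centralizer (G Mod N) {N #> x}) =
      card (carrier (G Mod N))"
    using Q.card_conj_orbit[OF Q.subgroup_self finQ xQ]
    unfolding centralizer_def by simp
  have 3: "card N * card (carrier (G Mod N)) = Coset.order G"
    using lagrange[OF N_subgroup] by (simp add: FactGroup_def mult.commute)
  have "card (conj_orbit (carrier G) x) * card (centralizer G {x}) = Coset.order G"
    using card_orbit[OF x(1)] by (simp add: c_def)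
  also have "\<dots> = card (conj_orbit (carrier G) x) * card (centralizer (G Mod N) {N #> x})"
    unfolding 1 mult.assoc 2 3 ..
  finally have "card (conj_orbit (carrier G) x) * card (centralizer G {x}) =
      card (conj_orbit (carrier G) x) * card (centralizer (G Mod N) {N #> x})" .
  moreover have "card (conj_orbit (carrier G) x) \<noteq> 0"
    using card_orbit[OF x(1)] order_pos by (intro notI) simp
  ultimately show ?thesis by simp
qed

text \<open>If \<open>N\<close> were everything, the class length \<open>card K\<close> would divide
  \<open>card K + 1\<close>, which forces group order 2.\<close>

lemma N_proper:
  assumes "Coset.order G > 2"
  shows "N \<noteq> carrier G"
proof
  assume "N = carrier G"
  hence "Coset.order G = Suc (card K)" using card_N by (simp add: Coset.order_def)
  moreover have "card K dvd Coset.order G" unfolding order_factor by simp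
  ultimately have "card K dvd 1" using dvd_diff_nat[of "card K" "Suc (card K)" "card K"] by simp
  hence "card K = 1" by simp
  with \<open>Coset.order G = Suc (card K)\<close> assms show False by simp
qed

text \<open>An element normalizing the center carries \<open>x\<close> to another element of
  \<open>K\<close> in the center, and by \<open>Syl_unique\<close> both have \<open>P\<close> as
  centralizer; so it normalizes \<open>P\<close>. Conversely conjugation preserving \<open>P\<close>
  preserves its center.\<close>

lemma normalizer_center:
  assumes P: "P \<in> Syl p G"
  shows "normalizer G (group_center (G\<lparr>carrier := P\<rparr>)) = normalizer G P"
proof -
  define Z where "Z = group_center (G\<lparr>carrier := P\<rparr>)"
  have PG: "P \<subseteq> carrier G" using P subgroup.subset by (auto simp: Syl_iff)
  have ZP: "Z \<subseteq> P" unfolding Z_def using mem_group_center by blast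
  have ZG: "Z \<subseteq> carrier G" using ZP PG by blast
  obtain x where x: "x \<in> K" "x \<in> Z" "P = centralizer G {x}"
    unfolding Z_def using P by (rule center_nontrivial)
  have "g \<in> normalizer G Z \<longleftrightarrow> g \<in> normalizer G P" for g
  proof
    assume "g \<in> normalizer G Z"
    hence g: "g \<in> carrier G" and im: "(\<lambda>s. g \<otimes> s \<otimes> inv g) ` Z = Z" using normalizer_iff[OF ZG] by auto
    have "g \<otimes> x \<otimes> inv g \<in> Z" using im x(2) by blast
    hence "P = centralizer G {g \<otimes> x \<otimes> inv g}"
      unfolding Z_def by (rule Syl_unique[OF P conj_K[OF g x(1)]])
    hence "(\<lambda>s. g \<otimes> s \<otimes> inv g) ` P = P"
      using conj_image_centralizer[OF g K_in_carrier[OF x(1)]] x(3) by simp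
    thus "g \<in> normalizer G P" using normalizer_iff[OF PG] g by blast
  next
    assume "g \<in> normalizer G P"
    hence g: "g \<in> carrier G" and im: "(\<lambda>s. g \<otimes> s \<otimes> inv g) ` P = P" using normalizer_iff[OF PG] by auto
    have sub: "(\<lambda>s. g \<otimes> s \<otimes> inv g) ` Z \<subseteq> Z"
    proof safe
      fix z assume z: "z \<in> Z"
      have zG: "z \<in> carrier G" using z ZG by blast
      have "g \<otimes> z \<otimes> inv g \<in> P" using im z ZP by blast
      moreover have "(g \<otimes> z \<otimes> inv g) \<otimes> w = w \<otimes> (g \<otimes> z \<otimes> inv g)" if "w \<in> P" for w
      proof -
        obtain y where y: "y \<in> P" "w = g \<otimes> y \<otimes> inv g" using im \<open>w \<in> P\<close> by blast
        have yG: "y \<in> carrier G" using y PG by blast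
        have "z \<otimes> y = y \<otimes> z" using z y(1) unfolding Z_def mem_group_center by blast
        thus ?thesis unfolding y(2) conj_hom[symmetric, OF g zG yG] conj_hom[symmetric, OF g yG zG] by simp
      qed
      ultimately show "g \<otimes> z \<otimes> inv g \<in> Z" unfolding Z_def mem_group_center by blast
    qed
    have "inj_on (\<lambda>s. g \<otimes> s \<otimes> inv g) Z"
      using bij_betw_conj[OF g] ZG by (meson bij_betw_imp_inj_on inj_on_subset)
    hence "card ((\<lambda>s. g \<otimes> s \<otimes> inv g) ` Z) = card Z" by (rule card_image)
    hence "(\<lambda>s. g \<otimes> s \<otimes> inv g) ` Z = Z"
      using sub finite_subset[OF ZG fin] by (intro card_subset_eq) auto
    thus "g \<in> normalizer G Z" using normalizer_iff[OF ZG] g by blast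
  qed
  thus ?thesis unfolding Z_def by blast
qed

end

section \<open>From the numbered character table to the row \<open>\<theta>\<close>\<close>

theorem proposition2p6:
  fixes G :: "('a, 'm) monoid_scheme"
    and k p n t :: nat
    and \<chi> :: "nat \<Rightarrow> 'a \<Rightarrow> complex"
    and b :: 'a
    and N :: "'a set"
  assumes CD1: "CD1_group G"
    and numbering: "Irr_numbering G k \<chi>"
    and b: "b \<in> carrier G" "\<not> conjugate_in G \<one>\<^bsub>G\<^esub> b" "columns_differ_once G \<one>\<^bsub>G\<^esub> b"
    and N: "N = (\<Inter>i \<in> {1..<k}. char_ker G (\<chi> i))"
    and p: "p = group.ord G b"
    and n: "n = (THE m. card N = p ^ m)"
    and t: "t = (THE m. \<chi> k b = - (of_nat p ^ m))"
  shows
    \<comment> \<open>(1)\<close>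
    "(card (centralizer G {b}) = p ^ (n + 2 * t) \<and>
      (\<forall>x \<in> N - {\<one>\<^bsub>G\<^esub>}. centralizer G {x} \<in> Syl p G) \<and>
      (\<forall>x \<in> N - {\<one>\<^bsub>G\<^esub>}. \<exists>!P. P \<in> Syl p G \<and> x \<in> group_center (G\<lparr>carrier := P\<rparr>))) \<and>
    \<comment> \<open>(2)\<close>
     (\<forall>P \<in> Syl p G. group_center (G\<lparr>carrier := P\<rparr>) \<subseteq> N) \<and>
    \<comment> \<open>(3)\<close>
     (N \<notin> Syl p G \<longrightarrow> (\<forall>P \<in> Syl p G. \<not> comm_group (G\<lparr>carrier := P\<rparr>))) \<and>
    \<comment> \<open>(4)\<close>
     (N = (\<Union>P \<in> Syl p G. group_center (G\<lparr>carrier := P\<rparr>)) \<and>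
      (\<forall>P \<in> Syl p G. \<forall>Q \<in> Syl p G. P \<noteq> Q \<longrightarrow>
         group_center (G\<lparr>carrier := P\<rparr>) \<inter> group_center (G\<lparr>carrier := Q\<rparr>) = {\<one>\<^bsub>G\<^esub>})) \<and>
    \<comment> \<open>(5)\<close>
     (\<forall>P \<in> Syl p G. group_center (G\<lparr>carrier := P\<rparr>) = N \<longleftrightarrow> P \<lhd> G) \<and>
    \<comment> \<open>(6)\<close>
     centralizer G N = pi_core G {p} \<and>
    \<comment> \<open>(7)\<close>
     pi_core G (- {p}) = {\<one>\<^bsub>G\<^esub>} \<and>
    \<comment> \<open>(8)\<close>
     ((\<forall>x \<in> carrier G - N.
         card (centralizer G {x}) = card (centralizer (G Mod N) {N #>\<^bsub>G\<^esub> x})) \<and>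
      Camina_pair G N) \<and>
    \<comment> \<open>(9)\<close>
     (\<forall>P \<in> Syl p G. normalizer G (group_center (G\<lparr>carrier := P\<rparr>)) = normalizer G P)"
proof -
  have grp: "group G" and fin: "finite (carrier G)" and big: "Coset.order G > 2"
    using CD1 unfolding CD1_group_def by auto
  have bij: "bij_betw \<chi> {1..k} (Irr G)" and one: "\<chi> 1 = trivial_character G"
    and mono: "\<And>i j. 1 \<le> i \<Longrightarrow> i \<le> j \<Longrightarrow> j \<le> k \<Longrightarrow> Re (\<chi> i \<one>\<^bsub>G\<^esub>) \<le> Re (\<chi> j \<one>\<^bsub>G\<^esub>)"
    using numbering unfolding Irr_numbering_def by auto
  have inj: "inj_on \<chi> {1..k}" and img: "\<chi> ` {1..k} = Irr G" using bij by (auto simp: bij_betw_def)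
  obtain \<theta> where \<theta>: "\<theta> \<in> Irr G" "\<theta> \<one>\<^bsub>G\<^esub> \<noteq> \<theta> b"
    and "\<forall>\<psi>\<in>Irr G. \<psi> \<noteq> \<theta> \<longrightarrow> \<psi> \<one>\<^bsub>G\<^esub> = \<psi> b"
    using b(3) unfolding columns_differ_once_def by blast
  hence same: "\<psi> b = \<psi> \<one>\<^bsub>G\<^esub>" if "\<psi> \<in> Irr G" "\<psi> \<noteq> \<theta>" for \<psi> using that by metis
  obtain j where j: "1 \<le> j" "j \<le> k" "\<chi> j = \<theta>" using \<theta>(1) unfolding img[symmetric] by auto
  have triv: "trivial_character G \<in> Irr G" unfolding img[symmetric] one[symmetric] using j by (intro imageI) simp
  obtain d :: nat where d: "\<theta> \<one>\<^bsub>G\<^esub> = of_nat d" using group.Irr_degree[OF grp \<theta>(1)] by blast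
  have finI: "finite (Irr G)" using bij_betw_finite[OF bij] by simp
  interpret R: CD1_row G \<theta> b d
    by (intro CD1_row.intro CD1_row_axioms.intro) (fact grp fin finI \<theta> triv b(1) same d)+
  \<comment> \<open>Otherwise \<open>\<chi> k\<close> is either trivial, which forces
    \<open>k = 1\<close> and so \<open>j = k\<close>, or of smaller degree than
    \<open>\<theta>\<close>, against the ordering of the numbering.\<close>
  have k: "\<chi> k = \<theta>"
  proof (rule ccontr)
    assume neq: "\<chi> k \<noteq> \<theta>"
    have "\<chi> k \<in> Irr G" unfolding img[symmetric] using j by (intro imageI) simp
    moreover have "\<chi> k \<noteq> trivial_character G"
    proof
      assume "\<chi> k = trivial_character G"
      hence "\<chi> k = \<chi> 1" by (simp only: one)
      hence "k = 1" using inj_onD[OF inj, of k 1] j by simp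
      hence "\<chi> k = \<theta>" using j by (simp add: le_antisym)
      with neq show False by simp
    qed
    ultimately have "Re (\<chi> k \<one>\<^bsub>G\<^esub>) < Re (\<theta> \<one>\<^bsub>G\<^esub>)" using neq by (intro R.degree_less_d)
    with mono[of j k] j show False by simp
  qed
  have "k \<noteq> 1" using R.triv_neq one k by auto
  hence k2: "k \<ge> 2" using j by simp
  have rest: "\<chi> ` {1..<k} = Irr G - {\<theta>}"
  proof -
    have "{1..<k} = {1..k} - {k}" using k2 by auto
    thus ?thesis using inj_on_image_set_diff[OF inj, of "{1..k}" "{k}"] img k k2 by simp
  qed
  have "g \<in> N \<longleftrightarrow> g \<in> R.N" for g
  proof -
    have "g \<in> N \<longleftrightarrow> (\<forall>i\<in>{1..<k}. g \<in> carrier G \<and> \<chi> i g = \<chi> i \<one>\<^bsub>G\<^esub>)"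
      unfolding N char_ker_def by simp
    also have "\<dots> \<longleftrightarrow> (\<forall>\<psi>\<in>\<chi> ` {1..<k}. g \<in> carrier G \<and> \<psi> g = \<psi> \<one>\<^bsub>G\<^esub>)" by simp
    \<comment> \<open>The trivial character remains in the index set, so the set is nonempty and
      membership in the carrier can be taken out of the quantifier.\<close>
    also have "\<dots> \<longleftrightarrow> g \<in> carrier G \<and> (\<forall>\<psi>\<in>Irr G - {\<theta>}. \<psi> g = \<psi> \<one>\<^bsub>G\<^esub>)"
      unfolding rest using triv R.triv_neq by blast
    also have "\<dots> \<longleftrightarrow> g \<in> R.N" using R.N_char_iff[of g] R.N_carrier by blast
    finally show ?thesis .
  qed
  hence NN: "N = R.N" by blast
  have pp: "prime p" using R.prime_ord_b p by simp
  hence p1: "p > 1" by (rule prime_gt_1_nat)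
  obtain n0 where n0: "card R.N = p ^ n0" using R.card_N_power p by blast
  \<comment> \<open>The exponent in the definite description is unique because \<open>p > 1\<close>;
    the same holds for \<open>t\<close> below.\<close>
  have n_eq: "n = n0" unfolding n NN n0 using p1 by (intro the_equality) auto
  obtain t0 where t0: "R.r = p ^ t0" using R.beta_power p by blast
  have "- \<theta> b = of_nat p ^ t0" using R.beta_r t0 by (simp add: R.\<beta>_def)
  hence "\<chi> k b = - (of_nat p ^ t0)" unfolding k by (metis minus_minus)
  hence t_eq: "t = t0"
    unfolding t
  proof (intro the_equality)
    fix m assume "\<chi> k b = - (of_nat p ^ t0)" "\<chi> k b = - (of_nat p ^ m)"
    hence "(of_nat (p ^ m) :: complex) = of_nat (p ^ t0)" by simp
    hence "p ^ m = p ^ t0" by (simp only: of_nat_eq_iff)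
    thus "m = t0" using p1 by simp
  qed
  interpret P: CD1_prime G \<theta> b d p n t
    using p n0 n_eq t0 t_eq by unfold_locales auto
  have K: "N - {\<one>\<^bsub>G\<^esub>} = R.K" unfolding NN using R.one_notin_K by (auto simp: R.N_def)
  have 1: "card (centralizer G {b}) = p ^ (n + 2 * t) \<and>
      (\<forall>x \<in> N - {\<one>\<^bsub>G\<^esub>}. centralizer G {x} \<in> Syl p G) \<and>
      (\<forall>x \<in> N - {\<one>\<^bsub>G\<^esub>}. \<exists>!P. P \<in> Syl p G \<and> x \<in> group_center (G\<lparr>carrier := P\<rparr>))"
    unfolding K
  proof (intro conjI ballI)
    show "card (centralizer G {b}) = p ^ (n + 2 * t)" using P.c_K[OF R.b_in_K] by (simp add: R.c_def)
  next
    fix x assume x: "x \<in> R.K"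
    show "centralizer G {x} \<in> Syl p G" using P.centralizer_Syl[OF x] .
    show "\<exists>!P. P \<in> Syl p G \<and> x \<in> group_center (G\<lparr>carrier := P\<rparr>)"
      using P.centralizer_Syl[OF x] P.center_centralizer[OF x] P.Syl_unique[OF _ x] by blast
  qed
  have 8: "card (centralizer G {x}) = card (centralizer (G Mod N) {N #>\<^bsub>G\<^esub> x})"
    if "x \<in> carrier G - N" for x
    using P.quotient_centralizer_card[of x] that unfolding NN by blast
  have camina: "Camina_pair G N"
    unfolding Camina_pair_def
  proof (intro conjI ballI)
    show "N \<lhd> G" unfolding NN by (rule R.N_normal)
    show "N \<noteq> {\<one>\<^bsub>G\<^esub>}" using K R.b_in_K by blast
    show "N \<noteq> carrier G" unfolding NN by (rule P.N_proper[OF big])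
  qed (rule 8)
  show ?thesis
    using 1 8 camina P.center_subset_N P.not_abelian P.center_union P.center_inter P.center_eq_N_iff
      P.centralizer_N_eq_core P.complement_core_trivial P.normalizer_center
    unfolding NN[symmetric] by (intro conjI ballI impI) auto
qed

end
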